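(* Let $(G,K)$ be one of the symmetric pairs (1)–(6) listed in the context, with associated $K'\subset GL(N,\mathbb{C})$, type $A$ flag variety $X'$ and flag variety $X\subset X'$ of $G$. The $K'$-orbits on $X'$ are the sets $Q_\gamma$ indexed by $(a,b)$-clans $\gamma$, where $K'\cong GL(a,\mathbb{C})\times GL(b,\mathbb{C})$. Then the $K'$-orbit $Q_\gamma$ corresponding to the clan $\gamma=(c_1,\dots,c_N)$ intersects $X$ if and only if: (1) [$SO(2n+1,\mathbb{C})$, $S(O(2p,\mathbb{C})\times O(2q+1,\mathbb{C}))$; $(a,b)=(2p,2q+1)$]: $\gamma$ is symmetric. (2) [$Sp(2n,\mathbb{C})$, $Sp(2p,\mathbb{C})\times Sp(2q,\mathbb{C})$; $(a,b)=(2p,2q)$]: $\gamma$ is symmetric and $c_i\ne c_{2n+1-i}$ whenever $c_i\in\mathbb{N}$. (3) [$Sp(2n,\mathbb{C})$, $GL(n,\mathbb{C})$; $(a,b)=(n,n)$]: $\gamma$ is skew-symmetric. (4) [$SO(2n,\mathbb{C})$, $S(O(2p,\mathbb{C})\times O(2q,\mathbb{C}))$; $(a,b)=(2p,2q)$]: $\gamma$ is symmetric. (5) [$SO(2n,\mathbb{C})$, $GL(n,\mathbb{C})$; $(a,b)=(n,n)$]: $\gamma$ is skew-symmetric, $c_i\ne c_{2n+1-i}$ whenever $c_i\in\mathbb{N}$, and among $(c_1,\dots,c_n)$ the total number of $-$ signs and pairs of equal natural numbers is even. (6) [$SO(2n,\mathbb{C})$, $S(O(2p+1,\mathbb{C})\times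 O(2q-1,\mathbb{C}))$; $(a,b)=(2p+1,2q-1)$]: $\gamma$ is symmetric.
   Context: Clans: an $(a,b)$-clan is a string $(c_1,\dots,c_N)$, $N=a+b$, of symbols $+$, $-$ or natural numbers, such that each natural number that appears does so exactly twice and the number of $+$'s minus the number of $-$'s is $a-b$; strings are considered up to renaming numbers (only positions of matching numbers matter). A clan is symmetric if reversing it gives the same clan: if $c_i$ is a sign then $c_{N+1-i}$ is the same sign; if $c_i$ is a number then $c_{N+1-i}$ is a number and $c_{N+1-i}=c_j$ implies $c_{N+1-j}=c_i$. It is skew-symmetric if the same holds except that $c_{N+1-i}$ is the opposite sign when $c_i$ is a sign. For a clan $\gamma$ and $i<j$: $\gamma(i;+)$ (resp. $\gamma(i;-)$) is the number of $+$ (resp. $-$) signs plus the number of pairs of equal natural numbers among $(c_1,\dots,c_i)$; $\gamma(i;j)$ is the number of pairs $c_s=c_t\in\mathbb{N}$ with $s\le i<j<t$. Notation: $J_m$ is the $m\times m$ antidiagonal matrix of $1$'s; $J_{n,n}=\begin{pmatrix}0&J_n\\-J_n&0\end{pmatrix}$; $I_{a,b}=\mathrm{diag}(1^a,(-1)^b)$; $I_{a,b,c}=\mathrm{diag}(1^a,(-1)^b,1^c)$. In each case $G\subset GL(N,\mathbb{C})$ is the group preserving the indicated form (with determinant $1$), $h$ is the indicated involutive matrix, and $K$, $K'$ are the elements of $G$, $GL(N,\mathbb{C})$ commuting with $h$. $p,q\ge0$, $p+q=n$ ($q\ge1$ in (6)). (1) $N=2n+1$, symmetric form $J_{2n+1}$,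 $h=I_{p,2q+1,p}$. (2) $N=2n$, skew form $J_{n,n}$, $h=I_{p,2q,p}$. (3) $N=2n$, skew form $J_{n,n}$, $h=I_{n,n}$. (4) $N=2n$, symmetric form $J_{2n}$, $h=I_{p,2q,p}$. (5) $N=2n$, symmetric form $J_{2n}$, $h=I_{n,n}$. (6) $N=2n$, standard form $\sum x_iy_i$, $h=I_{2p+1,2q-1}$. Let $E_+,E_-$ be the $+1$ and $-1$ eigenspaces of $h$ (of dimensions $a,b$), and $\pi:\mathbb{C}^N\to E_+$ the projection along $E_-$; $K'=GL(E_+)\times GL(E_-)$. $X'$ is the variety of complete flags $F_\bullet$ in $\mathbb{C}^N$, and $Q_\gamma$ is the set of flags with $\dim(F_i\cap E_+)=\gamma(i;+)$, $\dim(F_i\cap E_-)=\gamma(i;-)$ and $\dim(\pi(F_i)+F_j)=j+\gamma(i;j)$ for all $i<j$ (the first two for all $i$); it is known that $\gamma\mapsto Q_\gamma$ is a bijection from $(a,b)$-clans to $K'$-orbits on $X'$. In cases (1)–(3), $X\subset X'$ is the set of flags with $F_{N-i}=F_i^\perp$ for all $i$. In the $SO(2n,\mathbb{C})$ cases $X$ is one of the two components of the variety of such flags: in (4) and (5) the one with $\dim(F_n\cap\langle e_1,\dots,e_n\rangle)\equiv n\pmod2$; in (6) a fixed choice of one component. In all cases $X\cong G/B$ for a Borel subgroup $B$ of $G$. *)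

theory Defs
  imports "HOL-Analysis.Analysis" "HOL-Library.Function_Algebras"
begin

section \<open>Clans\<close>

datatype clan_symbol = Plus | Minus | Num nat

text \<open>
  A clan is given by a representing string. All notions below only test numbers for equality, so they
  are invariant under renaming the numbers. Positions are counted from 1, as in
  \<open>(c\<^sub>1, \<dots>, c\<^sub>N)\<close>.
\<close>

definition entry :: "clan_symbol list \<Rightarrow> nat \<Rightarrow> clan_symbol" where
  "entry \<gamma> i = \<gamma> ! (i - 1)"

definition is_num :: "clan_symbol \<Rightarrow> bool" where
  "is_num c \<longleftrightarrow> (\<exists>k. c = Num k)"

fun opposite :: "clan_symbol \<Rightarrow> clan_symbol" where
  "opposite Plus = Minus"
| "opposite Minus = Plus"
| "opposite (Num k) = Num k"

definition is_clan :: "nat \<Rightarrow> nat \<Rightarrow> clan_symbol list \<Rightarrow> bool" where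
  "is_clan a b \<gamma> \<longleftrightarrow>
     length \<gamma> = a + b \<and>
     (\<forall>k. Num k \<in> set \<gamma> \<longrightarrow> count_list \<gamma> (Num k) = 2) \<and>
     int (count_list \<gamma> Plus) - int (count_list \<gamma> Minus) = int a - int b"

definition numbers_symmetric :: "clan_symbol list \<Rightarrow> bool" where
  "numbers_symmetric \<gamma> \<longleftrightarrow> (let N = length \<gamma>; c = entry \<gamma> in
     \<forall>i\<in>{1..N}. is_num (c i) \<longrightarrow>
       is_num (c (N + 1 - i)) \<and>
       (\<forall>j\<in>{1..N}. c (N + 1 - i) = c j \<longrightarrow> c (N + 1 - j) = c i))"

definition symmetric_clan :: "clan_symbol list \<Rightarrow> bool" where
  "symmetric_clan \<gamma> \<longleftrightarrow> (let N = length \<gamma>; c = entry \<gamma> in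
     (\<forall>i\<in>{1..N}. \<not> is_num (c i) \<longrightarrow> c (N + 1 - i) = c i) \<and> numbers_symmetric \<gamma>)"

definition skew_symmetric_clan :: "clan_symbol list \<Rightarrow> bool" where
  "skew_symmetric_clan \<gamma> \<longleftrightarrow> (let N = length \<gamma>; c = entry \<gamma> in
     (\<forall>i\<in>{1..N}. \<not> is_num (c i) \<longrightarrow> c (N + 1 - i) = opposite (c i)) \<and> numbers_symmetric \<gamma>)"

definition no_mirror_pair :: "clan_symbol list \<Rightarrow> bool" where
  "no_mirror_pair \<gamma> \<longleftrightarrow> (let N = length \<gamma>; c = entry \<gamma> in
     \<forall>i\<in>{1..N}. is_num (c i) \<longrightarrow> c i \<noteq> c (N + 1 - i))"

definition sign_count :: "clan_symbol \<Rightarrow> clan_symbol list \<Rightarrow> nat \<Rightarrow> nat" where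
  "sign_count \<sigma> \<gamma> i = card {s \<in> {1..i}. entry \<gamma> s = \<sigma>}"

definition pair_count :: "clan_symbol list \<Rightarrow> nat \<Rightarrow> nat" where
  "pair_count \<gamma> i =
     card {(s, t). 1 \<le> s \<and> s < t \<and> t \<le> i \<and> is_num (entry \<gamma> s) \<and> entry \<gamma> s = entry \<gamma> t}"

text \<open>The numbers \<open>\<gamma>(i;+)\<close>, \<open>\<gamma>(i;-)\<close> and \<open>\<gamma>(i;j)\<close>.\<close>

definition clan_plus :: "clan_symbol list \<Rightarrow> nat \<Rightarrow> nat" where
  "clan_plus \<gamma> i = sign_count Plus \<gamma> i + pair_count \<gamma> i"

definition clan_minus :: "clan_symbol list \<Rightarrow> nat \<Rightarrow> nat" where
  "clan_minus \<gamma> i = sign_count Minus \<gamma> i + pair_count \<gamma> i"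

definition clan_cross :: "clan_symbol list \<Rightarrow> nat \<Rightarrow> nat \<Rightarrow> nat" where
  "clan_cross \<gamma> i j =
     card {(s, t). 1 \<le> s \<and> s \<le> i \<and> i < j \<and> j < t \<and> t \<le> length \<gamma> \<and>
                   is_num (entry \<gamma> s) \<and> entry \<gamma> s = entry \<gamma> t}"


section \<open>Linear algebra in \<open>\<complex>\<^sup>N\<close>\<close>

text \<open>
  Since the dimension \<open>N\<close> depends on the parameters of the theorem, \<open>\<complex>\<^sup>N\<close> is realised as the
  space of functions \<open>nat \<Rightarrow> complex\<close> supported on \<open>{1..N}\<close>, and \<open>N \<times> N\<close> matrices as functions
  of two indices, only used on \<open>{1..N} \<times> {1..N}\<close>.
\<close>

definition cscale :: "complex \<Rightarrow> (nat \<Rightarrow> complex) \<Rightarrow> nat \<Rightarrow> complex" where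
  "cscale c v = (\<lambda>i. c * v i)"

global_interpretation cvec: vector_space cscale
  by unfold_locales (simp_all add: cscale_def fun_eq_iff algebra_simps)

definition coord_space :: "nat \<Rightarrow> (nat \<Rightarrow> complex) set" where
  "coord_space N = {v. \<forall>i. i \<notin> {1..N} \<longrightarrow> v i = 0}"

definition unit_vec :: "nat \<Rightarrow> nat \<Rightarrow> complex" where
  "unit_vec k = (\<lambda>i. if i = k then 1 else 0)"

definition mat_vec :: "nat \<Rightarrow> (nat \<Rightarrow> nat \<Rightarrow> complex) \<Rightarrow> (nat \<Rightarrow> complex) \<Rightarrow> nat \<Rightarrow> complex" where
  "mat_vec N M v = (\<lambda>i. if i \<in> {1..N} then \<Sum>j\<in>{1..N}. M i j * v j else 0)"

definition eigenspace ::
  "nat \<Rightarrow> (nat \<Rightarrow> nat \<Rightarrow> complex) \<Rightarrow> complex \<Rightarrow> (nat \<Rightarrow> complex) set" where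
  "eigenspace N M c = {v \<in> coord_space N. mat_vec N M v = cscale c v}"

definition bilin ::
  "nat \<Rightarrow> (nat \<Rightarrow> nat \<Rightarrow> complex) \<Rightarrow> (nat \<Rightarrow> complex) \<Rightarrow> (nat \<Rightarrow> complex) \<Rightarrow> complex" where
  "bilin N M x y = (\<Sum>i\<in>{1..N}. \<Sum>j\<in>{1..N}. x i * M i j * y j)"

definition perp ::
  "nat \<Rightarrow> (nat \<Rightarrow> nat \<Rightarrow> complex) \<Rightarrow> (nat \<Rightarrow> complex) set \<Rightarrow> (nat \<Rightarrow> complex) set" where
  "perp N M S = {y \<in> coord_space N. \<forall>x\<in>S. bilin N M x y = 0}"

definition sum_space ::
  "(nat \<Rightarrow> complex) set \<Rightarrow> (nat \<Rightarrow> complex) set \<Rightarrow> (nat \<Rightarrow> complex) set" where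
  "sum_space S T = {x + y | x y. x \<in> S \<and> y \<in> T}"

text \<open>Projection onto \<open>S\<close> along \<open>T\<close>, for vectors of a direct sum of \<open>S\<close> and \<open>T\<close>.\<close>

definition proj_along ::
  "(nat \<Rightarrow> complex) set \<Rightarrow> (nat \<Rightarrow> complex) set \<Rightarrow> (nat \<Rightarrow> complex) \<Rightarrow> nat \<Rightarrow> complex" where
  "proj_along S T v = (THE u. u \<in> S \<and> v - u \<in> T)"

text \<open>The matrices \<open>J\<^sub>m\<close>, \<open>J\<^sub>n\<^sub>,\<^sub>n\<close>, \<open>I\<^sub>a\<^sub>,\<^sub>b\<close>, \<open>I\<^sub>a\<^sub>,\<^sub>b\<^sub>,\<^sub>c\<close> and the identity.\<close>

definition J_mat :: "nat \<Rightarrow> nat \<Rightarrow> nat \<Rightarrow> complex" where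
  "J_mat m i j = (if i + j = m + 1 then 1 else 0)"

definition J_skew :: "nat \<Rightarrow> nat \<Rightarrow> nat \<Rightarrow> complex" where
  "J_skew n i j =
     (if i \<le> n \<and> n < j then J_mat n i (j - n)
      else if n < i \<and> j \<le> n then - J_mat n (i - n) j
      else 0)"

definition I3_mat :: "nat \<Rightarrow> nat \<Rightarrow> nat \<Rightarrow> nat \<Rightarrow> nat \<Rightarrow> complex" where
  "I3_mat a b c i j =
     (if i = j \<and> 1 \<le> i \<and> i \<le> a + b + c
      then (if a < i \<and> i \<le> a + b then - 1 else 1) else 0)"

definition I2_mat :: "nat \<Rightarrow> nat \<Rightarrow> nat \<Rightarrow> nat \<Rightarrow> complex" where
  "I2_mat a b = I3_mat a b 0"

definition id_mat :: "nat \<Rightarrow> nat \<Rightarrow> complex" where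
  "id_mat i j = (if i = j then 1 else 0)"


section \<open>Flags\<close>

text \<open>
  The variety \<open>X'\<close>. Extensionality makes the representation of a flag
  \<open>F\<^sub>0 \<subseteq> \<dots> \<subseteq> F\<^sub>N\<close> unique.
\<close>

definition complete_flags :: "nat \<Rightarrow> (nat \<Rightarrow> (nat \<Rightarrow> complex) set) set" where
  "complete_flags N =
     {F \<in> extensional {0..N}.
        (\<forall>i\<le>N. cvec.subspace (F i) \<and> F i \<subseteq> coord_space N \<and> cvec.dim (F i) = i) \<and>
        (\<forall>i<N. F i \<subseteq> F (Suc i))}"

text \<open>
  \<open>Q\<^sub>\<gamma>\<close> for the involutive \<open>N \<times> N\<close> matrix \<open>h\<close>, with \<open>E\<^sub>+\<close>, \<open>E\<^sub>-\<close> the \<open>+1\<close> and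
  \<open>-1\<close> eigenspaces of \<open>h\<close>.
\<close>

definition clan_orbit ::
  "nat \<Rightarrow> (nat \<Rightarrow> nat \<Rightarrow> complex) \<Rightarrow> clan_symbol list \<Rightarrow> (nat \<Rightarrow> (nat \<Rightarrow> complex) set) set" where
  "clan_orbit N h \<gamma> =
     (let Ep = eigenspace N h 1; Em = eigenspace N h (- 1); \<pi> = proj_along Ep Em in
      {F \<in> complete_flags N.
         (\<forall>i\<in>{1..N}. cvec.dim (F i \<inter> Ep) = clan_plus \<gamma> i) \<and>
         (\<forall>i\<in>{1..N}. cvec.dim (F i \<inter> Em) = clan_minus \<gamma> i) \<and>
         (\<forall>i\<in>{1..N}. \<forall>j\<in>{1..N}. i < j \<longrightarrow>
            cvec.dim (sum_space (\<pi> ` F i) (F j)) = j + clan_cross \<gamma> i j)})"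

definition perp_flags ::
  "nat \<Rightarrow> (nat \<Rightarrow> nat \<Rightarrow> complex) \<Rightarrow> (nat \<Rightarrow> (nat \<Rightarrow> complex) set) set" where
  "perp_flags N M = {F \<in> complete_flags N. \<forall>i\<le>N. F (N - i) = perp N M (F i)}"

text \<open>
  The component of the variety of orthogonal flags in \<open>\<complex>\<^bsup>2n\<^esup>\<close> cut out by
  \<open>dim (F\<^sub>n \<inter> \<langle>e\<^sub>1, \<dots>, e\<^sub>n\<rangle>) \<equiv> n (mod 2)\<close>.
\<close>

definition even_perp_flags ::
  "nat \<Rightarrow> (nat \<Rightarrow> nat \<Rightarrow> complex) \<Rightarrow> (nat \<Rightarrow> (nat \<Rightarrow> complex) set) set" where
  "even_perp_flags n M =
     {F \<in> perp_flags (2 * n) M.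
        cvec.dim (F n \<inter> cvec.span (unit_vec ` {1..n})) mod 2 = n mod 2}"

text \<open>
  The classical topology on \<open>X'\<close>: the quotient topology along the map sending an ordered basis of
  \<open>\<complex>\<^sup>N\<close> (an element of \<open>GL(N, \<complex>)\<close>, given by its columns) to the flag it spans. Ordered bases
  carry the product topology of \<open>nat \<Rightarrow> nat \<Rightarrow> complex\<close>, in which only the coordinates in
  \<open>{1..N} \<times> {1..N}\<close> vary. The connected components of a closed subvariety of \<open>X'\<close> are the same in
  the classical and in the Zariski topology.
\<close>

definition ordered_bases :: "nat \<Rightarrow> (nat \<Rightarrow> nat \<Rightarrow> complex) set" where
  "ordered_bases N =
     {v. (\<forall>i\<in>{1..N}. v i \<in> coord_space N) \<and> (\<forall>i. i \<notin> {1..N} \<longrightarrow> v i = 0) \<and>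
         inj_on v {1..N} \<and> cvec.independent (v ` {1..N})}"

definition flag_of_basis :: "nat \<Rightarrow> (nat \<Rightarrow> nat \<Rightarrow> complex) \<Rightarrow> nat \<Rightarrow> (nat \<Rightarrow> complex) set" where
  "flag_of_basis N v = (\<lambda>i\<in>{0..N}. cvec.span (v ` {1..i}))"

definition flag_topology :: "nat \<Rightarrow> (nat \<Rightarrow> (nat \<Rightarrow> complex) set) topology" where
  "flag_topology N = topology (\<lambda>U. U \<subseteq> complete_flags N \<and>
     openin (top_of_set (ordered_bases N)) {v \<in> ordered_bases N. flag_of_basis N v \<in> U})"

lemma openin_flag_topology:
  "openin (flag_topology N) U \<longleftrightarrow> U \<subseteq> complete_flags N \<and>
     openin (top_of_set (ordered_bases N)) {v \<in> ordered_bases N. flag_of_basis N v \<in> U}"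
proof -
  let ?O = "\<lambda>U. {v \<in> ordered_bases N. flag_of_basis N v \<in> U}"
  have "istopology (\<lambda>U. U \<subseteq> complete_flags N \<and> openin (top_of_set (ordered_bases N)) (?O U))"
    unfolding istopology_def
  proof (intro conjI allI impI)
    fix S T
    assume *: "S \<subseteq> complete_flags N \<and> openin (top_of_set (ordered_bases N)) (?O S)"
      "T \<subseteq> complete_flags N \<and> openin (top_of_set (ordered_bases N)) (?O T)"
    then show "S \<inter> T \<subseteq> complete_flags N" by blast
    have "openin (top_of_set (ordered_bases N)) (?O S \<inter> ?O T)"
      using * by (intro openin_Int) (elim conjE, assumption)+
    moreover have "?O S \<inter> ?O T = ?O (S \<inter> T)" by blast
    ultimately show "openin (top_of_set (ordered_bases N)) (?O (S \<inter> T))" by (rule subst[rotated])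
  next
    fix \<U>
    assume *: "\<forall>U\<in>\<U>. U \<subseteq> complete_flags N \<and> openin (top_of_set (ordered_bases N)) (?O U)"
    then show "\<Union>\<U> \<subseteq> complete_flags N" by blast
    have "?O (\<Union>\<U>) = \<Union>(?O ` \<U>)" by blast
    moreover have "openin (top_of_set (ordered_bases N)) (\<Union>(?O ` \<U>))"
    proof (rule openin_Union)
      fix V assume "V \<in> ?O ` \<U>"
      then obtain U where "U \<in> \<U>" "V = ?O U" by (rule imageE)
      then show "openin (top_of_set (ordered_bases N)) V" using * by simp
    qed
    ultimately show "openin (top_of_set (ordered_bases N)) (?O (\<Union>\<U>))" by (rule ssubst)
  qed
  from topology_inverse'[OF this] show ?thesis
    unfolding flag_topology_def by (rule fun_cong)
qed

text \<open>The components of the variety of flags with \<open>F\<^bsub>N-i\<^esub> = F\<^sub>i\<^sup>\<bottom>\<close>.\<close>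

definition perp_flag_components ::
  "nat \<Rightarrow> (nat \<Rightarrow> nat \<Rightarrow> complex) \<Rightarrow> (nat \<Rightarrow> (nat \<Rightarrow> complex) set) set set" where
  "perp_flag_components N M =
     connected_components_of (subtopology (flag_topology N) (perp_flags N M))"

end

theory Submission
  imports Defs "HOL-Computational_Algebra.Fundamental_Theorem_Algebra"
begin

text \<open>
  A clan is encoded as the involution \<open>\<sigma>\<close> that matches equal numbers, together with signs on its fixed
  points; the mirror map is \<open>i \<mapsto> N + 1 - i\<close>. For each of the six pairs the form satisfies
  \<open>B y x = \<epsilon> B x y\<close> and \<open>B (h x) (h y) = \<delta> B x y\<close> with signs \<open>\<epsilon>\<close> and \<open>\<delta>\<close>. For \<open>\<delta> = 1\<close> the eigenspaces
  \<open>E\<^sub>+\<close> and \<open>E\<^sub>-\<close> are orthogonal to each other, for \<open>\<delta> = - 1\<close> both are isotropic. Apart from the choice of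
  a component, one argument with these two signs covers all pairs (\<open>orbit_meets_iff\<close>): \<open>\<delta>\<close> decides
  between symmetric and skew-symmetric clans, and mirror pairs are excluded precisely if \<open>\<epsilon> \<delta> = - 1\<close>.

  Necessity. For a flag with \<open>F\<^bsub>N-i\<^esub> = F\<^sub>i\<^sup>\<bottom>\<close>, passing to orthogonal complements expresses the dimensions
  that define \<open>Q\<^sub>\<gamma>\<close> by those for the mirrored indices (\<open>dim_flag_E_mirror\<close>, \<open>dim_h_flag_mirror\<close>). So
  \<open>\<gamma>(i;j) = \<gamma>(N-j;N-i)\<close>. As these numbers determine \<open>\<sigma>\<close>, it commutes with the mirror map, and the dimensions of
  \<open>F\<^sub>i \<inter> E\<^sub>\<plusminus>\<close> then determine the mirrored signs. If \<open>\<epsilon> \<delta> = - 1\<close>, the form \<open>B (h x) y\<close> is alternating, so its rank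
  \<open>\<gamma>(i;N-i)\<close> on \<open>F\<^sub>i\<close> is even (\<open>dim_h_flag_even\<close>), whereas a mirror pair would change its parity.

  Sufficiency. There is a basis with \<open>h (u i) = u (\<sigma> i)\<close>, or \<open>- u i\<close> at a \<open>-\<close> sign, and the flag of every such
  basis lies in \<open>Q\<^sub>\<gamma>\<close>.
  Self-orthogonality asks in addition that \<open>u i\<close> be orthogonal to all \<open>u j\<close> except at its mirror position.
  A second form \<open>B'\<close> compatible with \<open>h\<close> and with this property is easily written down. It is
  \<open>B' x y = B (A x) y\<close> with \<open>A\<close> self-adjoint, and a square root \<open>K\<close> of \<open>A\<close> among the polynomials in \<open>A\<close>
  commutes with \<open>h\<close> and carries \<open>B'\<close> to \<open>B\<close> (\<open>self_adjoint_sqrt\<close>, \<open>adapted_basis\<close>). This replaces normal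
  forms of \<open>(B, h)\<close> for the individual pairs.

  Components. The reflection in a non-isotropic eigenvector of \<open>h\<close> preserves \<open>Q\<^sub>\<gamma>\<close>. It changes the
  parity of the dimension of \<open>F\<^sub>n \<inter> \<langle>e\<^sub>1, \<dots>, e\<^sub>n\<rangle>\<close> (\<open>refl_changes_parity\<close>), so \<open>Q\<^sub>\<gamma>\<close> meets the even component
  whenever it contains a self-orthogonal flag. For \<open>h = I\<^sub>n\<^sub>,\<^sub>n\<close> there are no such eigenvectors; there
  \<open>\<langle>e\<^sub>1, \<dots>, e\<^sub>n\<rangle> = E\<^sub>+\<close>, and the parity is that of \<open>\<gamma>(n;+)\<close>. For an arbitrary connected component, any two
  self-orthogonal flags are related by a chain of reflections (\<open>refl_flag_transitive\<close>), and each
  reflection can be deformed into one that preserves \<open>Q\<^sub>\<gamma>\<close> (\<open>joined_reflections\<close>).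
\<close>

section \<open>Finite-dimensional subspaces\<close>

abbreviation clinear :: "((nat \<Rightarrow> complex) \<Rightarrow> nat \<Rightarrow> complex) \<Rightarrow> bool" where
  "clinear \<equiv> Vector_Spaces.linear cscale cscale"

global_interpretation cpair: vector_space_pair cscale cscale ..

text \<open>
  The type \<open>nat \<Rightarrow> complex\<close> is infinite-dimensional, so finite dimension is a hypothesis throughout.
\<close>

definition fin_dim :: "(nat \<Rightarrow> complex) set \<Rightarrow> bool" where
  "fin_dim S \<longleftrightarrow> (\<exists>A. finite A \<and> S \<subseteq> cvec.span A)"

lemma fin_dim_subset: "S \<subseteq> T \<Longrightarrow> fin_dim T \<Longrightarrow> fin_dim S"
  unfolding fin_dim_def by blast

lemma fin_dim_image: "clinear f \<Longrightarrow> fin_dim S \<Longrightarrow> fin_dim (f ` S)"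
  unfolding fin_dim_def using cpair.linear_spans_image by blast

lemma fin_dim_span: "finite A \<Longrightarrow> fin_dim (cvec.span A)"
  unfolding fin_dim_def by blast

lemma finite_if_independent: "cvec.independent B \<Longrightarrow> B \<subseteq> S \<Longrightarrow> fin_dim S \<Longrightarrow> finite B"
  unfolding fin_dim_def by (meson cvec.independent_span_bound order_trans)

lemma basis_extending:
  assumes "cvec.subspace S" "fin_dim S" "cvec.independent A" "A \<subseteq> S"
  obtains B where "A \<subseteq> B" "finite B" "cvec.independent B" "cvec.span B = S" "card B = cvec.dim S"
proof -
  obtain B where B: "A \<subseteq> B" "B \<subseteq> S" "cvec.independent B" "S \<subseteq> cvec.span B"
    using cvec.maximal_independent_subset_extend[OF assms(4,3)] by blast
  moreover have "cvec.span B = S" using B assms(1) by (simp add: cvec.span_subspace)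
  moreover have "card B = cvec.dim S" using B by (simp add: cvec.basis_card_eq_dim)
  moreover have "finite B" using B assms(2) finite_if_independent by blast
  ultimately show thesis using that by blast
qed

lemma subspace_basis:
  assumes "cvec.subspace S" "fin_dim S"
  obtains B where "finite B" "cvec.independent B" "cvec.span B = S" "card B = cvec.dim S"
  by (rule basis_extending[OF assms cvec.independent_empty empty_subsetI]) (rule that)

lemma rank_nullity:
  assumes f: "clinear f" and S: "cvec.subspace S" "fin_dim S"
  shows "cvec.dim (f ` S) + cvec.dim {x \<in> S. f x = 0} = cvec.dim S"
proof -
  let ?K = "{x \<in> S. f x = 0}"
  have K: "cvec.subspace ?K"
    using cvec.subspace_inter[OF S(1) cpair.linear_subspace_kernel[OF f]] by (simp add: Int_def)
  have "fin_dim ?K" by (rule fin_dim_subset[OF _ S(2)]) auto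
  then obtain C where C: "finite C" "cvec.independent C" "cvec.span C = ?K" "card C = cvec.dim ?K"
    using K subspace_basis by blast
  then have "C \<subseteq> S" using cvec.span_superset[of C] by blast
  then obtain B where B: "C \<subseteq> B" "finite B" "cvec.independent B" "cvec.span B = S" "card B = cvec.dim S"
    using basis_extending[OF S C(2)] by blast
  have inj: "inj_on f (cvec.span (B - C))"
  proof (subst cpair.linear_inj_on_iff_eq_0[OF f cvec.subspace_span], intro ballI impI)
    fix x assume x: "x \<in> cvec.span (B - C)" "f x = 0"
    have "x \<in> S" using x(1) B(4) cvec.span_mono[of "B - C" B] by auto
    then have "x \<in> cvec.span C" using x C by simp
    then have "cvec.representation B x = cvec.representation C x"
      using B(1,3) by (intro cvec.representation_extend) auto
    moreover have "cvec.representation B x = cvec.representation (B - C) x"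
      using B(1,3) x by (intro cvec.representation_extend) auto
    ultimately have "cvec.representation B x = (\<lambda>v. 0)"
      by (metis (mono_tags, opaque_lifting) Diff_iff cvec.representation_ne_zero)
    then show "x = 0"
      using cvec.sum_representation_eq[OF B(3) _ B(2) subset_refl, of x] \<open>x \<in> S\<close> B(4) by simp
  qed
  have "f ` S = cvec.span (f ` (B - C))"
  proof -
    have "f ` S = cvec.span (f ` B)" using B(4) cpair.linear_span_image[OF f] by simp
    also have "f ` B \<subseteq> cvec.span (f ` (B - C))"
    proof
      fix y assume "y \<in> f ` B"
      then obtain b where b: "b \<in> B" "y = f b" by blast
      show "y \<in> cvec.span (f ` (B - C))"
      proof (cases "b \<in> C")
        case True
        then have "y = 0" using b C(3) cvec.span_base by blast
        then show ?thesis by (simp add: cvec.span_zero)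
      next
        case False
        then show ?thesis using b by (auto intro: cvec.span_base)
      qed
    qed
    then have "cvec.span (f ` B) = cvec.span (f ` (B - C))"
      by (meson Diff_subset cvec.span_minimal cvec.span_mono cvec.subspace_span image_mono subset_antisym)
    finally show ?thesis .
  qed
  moreover have "cvec.independent (B - C)" using B(3) cvec.independent_mono by blast
  then have "cvec.independent (f ` (B - C))"
    using inj cpair.linear_independent_injective_image[OF f] by blast
  ultimately have "cvec.dim (f ` S) = card (f ` (B - C))"
    by (simp add: cvec.dim_eq_card_independent)
  also have "\<dots> = card (B - C)"
    using inj by (meson card_image cvec.span_superset inj_on_subset)
  also have "\<dots> = card B - card C" using B C by (simp add: card_Diff_subset)
  finally have "cvec.dim (f ` S) = card B - card C" .
  moreover have "card C \<le> card B" using B by (intro card_mono) auto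
  ultimately show ?thesis using B C by linarith
qed

lemma dim_mono:
  assumes "S \<subseteq> T" "cvec.subspace T" "fin_dim T"
  shows "cvec.dim S \<le> cvec.dim T"
proof -
  obtain B where "finite B" "cvec.span B = T" "card B = cvec.dim T"
    using subspace_basis assms by metis
  then show ?thesis using cvec.dim_le_card[of S B] assms by simp
qed

lemma dim_eq_imp_eq:
  assumes "S \<subseteq> T" "cvec.subspace S" "cvec.subspace T" "fin_dim T" "cvec.dim T \<le> cvec.dim S"
  shows "S = T"
proof -
  obtain A where A: "finite A" "cvec.independent A" "cvec.span A = S" "card A = cvec.dim S"
    using subspace_basis fin_dim_subset assms by metis
  then have "A \<subseteq> T" using assms(1) cvec.span_superset by blast
  then obtain B where B: "A \<subseteq> B" "finite B" "cvec.span B = T" "card B = cvec.dim T"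
    using basis_extending[OF assms(3,4) A(2)] by metis
  then have "A = B" using A assms(5) by (intro card_seteq) auto
  then show ?thesis using A B by simp
qed

lemma subspace_sum_space:
  "cvec.subspace S \<Longrightarrow> cvec.subspace T \<Longrightarrow> cvec.subspace (sum_space S T)"
  unfolding sum_space_def by (rule cvec.subspace_sums)

lemma sum_spaceI: "x \<in> S \<Longrightarrow> y \<in> T \<Longrightarrow> x + y \<in> sum_space S T"
  unfolding sum_space_def by blast

lemma sum_space_left: "cvec.subspace T \<Longrightarrow> S \<subseteq> sum_space S T"
  using sum_spaceI[OF _ cvec.subspace_0] by fastforce

lemma sum_space_right: "cvec.subspace S \<Longrightarrow> T \<subseteq> sum_space S T"
  using sum_spaceI[OF cvec.subspace_0] by fastforce

lemma sum_space_least: "cvec.subspace U \<Longrightarrow> S \<subseteq> U \<Longrightarrow> T \<subseteq> U \<Longrightarrow> sum_space S T \<subseteq> U"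
  unfolding sum_space_def by (auto intro: cvec.subspace_add)

lemma sum_space_span: "sum_space (cvec.span A) (cvec.span B) = cvec.span (A \<union> B)"
  unfolding sum_space_def cvec.span_Un by simp

lemma fin_dim_sum_space: "fin_dim S \<Longrightarrow> fin_dim T \<Longrightarrow> fin_dim (sum_space S T)"
proof -
  assume "fin_dim S" "fin_dim T"
  then obtain A B where *: "finite A" "S \<subseteq> cvec.span A" "finite B" "T \<subseteq> cvec.span B"
    unfolding fin_dim_def by blast
  then have "sum_space S T \<subseteq> sum_space (cvec.span A) (cvec.span B)"
    unfolding sum_space_def by blast
  then show ?thesis
    using * unfolding sum_space_span fin_dim_def by (intro exI[of _ "A \<union> B"]) auto
qed

text \<open>
  Every subspace is the kernel of a linear map, namely of a projection along it. Applying rank and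
  nullity to such a map with kernel \<open>T\<close> gives the dimension formula for \<open>S + T\<close>.
\<close>

lemma linear_with_kernel:
  assumes T: "cvec.subspace T"
  obtains f where "clinear f" "\<And>x. f x = 0 \<longleftrightarrow> x \<in> T"
proof -
  obtain B where B: "B \<subseteq> T" "cvec.independent B" "T \<subseteq> cvec.span B"
    using cvec.maximal_independent_subset[of T] by blast
  then have spB: "cvec.span B = T" using T by (simp add: cvec.span_subspace)
  define E where "E = cvec.extend_basis B"
  have E: "B \<subseteq> E" "cvec.independent E" "cvec.span E = UNIV"
    unfolding E_def using B(2) cvec.extend_basis_superset cvec.independent_extend_basis
      cvec.span_extend_basis by auto
  obtain f where f: "clinear f" "\<forall>x\<in>E. f x = (if x \<in> B then 0 else x)"
    using cpair.linear_independent_extend[OF E(2), of "\<lambda>x. if x \<in> B then 0 else x"] by blast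
  have ker: "f x = 0" if "x \<in> T" for x
  proof (rule cpair.linear_eq_0_on_span[OF f(1)])
    show "x \<in> cvec.span B" using that spB by simp
    show "f b = 0" if "b \<in> B" for b using that f(2) E(1) by (simp add: subset_eq)
  qed
  have fix': "f x = x" if "x \<in> cvec.span (E - B)" for x
  proof (rule cpair.linear_eq_on[OF f(1) cvec.linear_id[unfolded id_def] that])
    show "f b = b" if "b \<in> E - B" for b using that f(2) by simp
  qed
  have "x \<in> T" if x: "f x = 0" for x
  proof -
    have "x \<in> cvec.span (B \<union> (E - B))" using E by (simp add: Un_absorb1)
    then obtain b c where bc: "x = b + c" "b \<in> T" "c \<in> cvec.span (E - B)"
      unfolding cvec.span_Un spB by blast
    then have "f x = c" using ker fix' cpair.linear_add[OF f(1)] by simp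
    then show ?thesis using bc x by simp
  qed
  then show thesis using that[OF f(1)] ker by blast
qed

lemma dim_sum_space:
  assumes S: "cvec.subspace S" "fin_dim S" and T: "cvec.subspace T" "fin_dim T"
  shows "cvec.dim (sum_space S T) + cvec.dim (S \<inter> T) = cvec.dim S + cvec.dim T"
proof -
  obtain f where f: "clinear f" "\<And>x. f x = 0 \<longleftrightarrow> x \<in> T"
    by (rule linear_with_kernel[OF T(1)]) (rule that)
  have "f ` sum_space S T = f ` S"
  proof
    show "f ` sum_space S T \<subseteq> f ` S"
      unfolding sum_space_def using f(2)[THEN iffD2] cpair.linear_add[OF f(1)] by auto
    show "f ` S \<subseteq> f ` sum_space S T" using sum_space_left[OF T(1)] by blast
  qed
  moreover have "{x \<in> sum_space S T. f x = 0} = T" using f(2) sum_space_right[OF S(1)] by blast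
  moreover have "{x \<in> S. f x = 0} = S \<inter> T" using f(2) by blast
  ultimately show ?thesis
    using rank_nullity[OF f(1) S] rank_nullity[OF f(1) subspace_sum_space[OF S(1) T(1)]
        fin_dim_sum_space[OF S(2) T(2)]] by simp
qed

lemma dim_injective_image:
  assumes "clinear f" "cvec.subspace S" "fin_dim S" "\<And>x. x \<in> S \<Longrightarrow> f x = 0 \<Longrightarrow> x = 0"
  shows "cvec.dim (f ` S) = cvec.dim S"
proof -
  have "{x \<in> S. f x = 0} = {0}"
    using assms cvec.subspace_0 cpair.linear_0[OF assms(1)] by fastforce
  then have "cvec.dim {x \<in> S. f x = 0} = 0" 
    using cvec.dim_span[of "{}"] cvec.dim_eq_card_independent[of "{}"] by (simp add: cvec.independent_empty)
  then show ?thesis using rank_nullity[OF assms(1-3)] by linarith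
qed

lemma dim_zero_space [simp]: "cvec.dim {0} = 0"
  using cvec.dim_span[of "{}"] cvec.dim_eq_card_independent[of "{}"] by (simp add: cvec.independent_empty)

lemma dim_eq_0_iff:
  assumes "cvec.subspace S" "fin_dim S"
  shows "cvec.dim S = 0 \<longleftrightarrow> S = {0}"
proof
  assume "cvec.dim S = 0"
  then obtain B where "finite B" "cvec.span B = S" "card B = 0" using subspace_basis[OF assms] by metis
  then show "S = {0}" by auto
qed simp

lemma independent_image_if_span:
  assumes "finite I" "cvec.subspace S" "cvec.span (v ` I) = S" "cvec.dim S = card I"
  shows "inj_on v I" "cvec.independent (v ` I)"
proof -
  have *: "cvec.dim (v ` I) = card I" using assms by (metis cvec.dim_span)
  have "cvec.dim (v ` I) \<le> card (v ` I)" using assms(1) by (intro cvec.dim_le_card') auto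
  then have "card (v ` I) = card I" using card_image_le[OF assms(1), of v] * by linarith
  then show "inj_on v I" using assms(1) by (simp add: eq_card_imp_inj_on)
  obtain B where B: "B \<subseteq> v ` I" "cvec.independent B" "v ` I \<subseteq> cvec.span B"  "card B = cvec.dim (v ` I)"
    using cvec.basis_exists by blast
  then have "B = v ` I" using * \<open>card (v ` I) = card I\<close> assms(1) by (intro card_seteq) auto
  then show "cvec.independent (v ` I)" using B by simp
qed

lemma dim_span_image:
  assumes "inj_on v I" "cvec.independent (v ` I)" "J \<subseteq> I"
  shows "cvec.dim (cvec.span (v ` J)) = card J"
proof -
  have "cvec.independent (v ` J)" using assms cvec.independent_mono by blast
  moreover have "inj_on v J" using assms inj_on_subset by blast
  ultimately show ?thesis by (simp add: cvec.dim_eq_card_independent card_image)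
qed

subsection \<open>The coordinate space\<close>

lemma subspace_coord_space [simp]: "cvec.subspace (coord_space N)"
  unfolding cvec.subspace_def coord_space_def cscale_def by auto

lemma unit_vec_in_coord_space [simp]: "k \<in> {1..N} \<Longrightarrow> unit_vec k \<in> coord_space N"
  unfolding coord_space_def unit_vec_def by auto

lemma coord_space_expand:
  assumes "v \<in> coord_space N"
  shows "v = (\<Sum>k\<in>{1..N}. cscale (v k) (unit_vec k))"
proof
  fix i
  have *: "(\<Sum>k\<in>K. g k) i = (\<Sum>k\<in>K. g k i)" for K and g :: "nat \<Rightarrow> nat \<Rightarrow> complex"
    by (induction K rule: infinite_finite_induct) auto
  show "v i = (\<Sum>k\<in>{1..N}. cscale (v k) (unit_vec k)) i"
    using assms by (auto simp: * cscale_def unit_vec_def coord_space_def if_distrib cong: if_cong)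
qed

lemma span_unit_vec_index:
  assumes "I \<subseteq> {1..N}"
  shows "cvec.span (unit_vec ` I) = {v \<in> coord_space N. \<forall>i. i \<notin> I \<longrightarrow> v i = 0}" (is "_ = ?R")
proof (rule cvec.span_subspace)
  show "unit_vec ` I \<subseteq> ?R" using assms by (auto simp: unit_vec_def coord_space_def)
  show "cvec.subspace ?R"
    unfolding cvec.subspace_def coord_space_def cscale_def by auto
  show "?R \<subseteq> cvec.span (unit_vec ` I)"
  proof
    fix v assume v: "v \<in> ?R"
    have "v = (\<Sum>k\<in>{1..N}. cscale (v k) (unit_vec k))" using v coord_space_expand by blast
    also have "\<dots> = (\<Sum>k\<in>I. cscale (v k) (unit_vec k))"
      using v assms by (intro sum.mono_neutral_right) (auto simp: cscale_def zero_fun_def)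
    also have "\<dots> \<in> cvec.span (unit_vec ` I)"
      by (intro cvec.span_sum cvec.span_scale cvec.span_base) auto
    finally show "v \<in> cvec.span (unit_vec ` I)" .
  qed
qed

lemma span_unit_vec: "cvec.span (unit_vec ` {1..N}) = coord_space N"
  by (subst span_unit_vec_index[OF subset_refl]) (auto simp: coord_space_def)

lemma inj_unit_vec: "inj_on unit_vec I"
  by (rule inj_onI) (metis unit_vec_def zero_neq_one)

lemma independent_unit_vec: "cvec.independent (unit_vec ` I)"
  unfolding cvec.dependent_def
proof safe
  fix k assume k: "k \<in> I" "unit_vec k \<in> cvec.span (unit_vec ` I - {unit_vec k})"
  have "cvec.subspace {v. v k = 0}" unfolding cvec.subspace_def cscale_def by auto
  then have "cvec.span (unit_vec ` I - {unit_vec k}) \<subseteq> {v. v k = 0}"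
    by (intro cvec.span_minimal) (auto simp: unit_vec_def)
  then show False using k by (auto simp: unit_vec_def)
qed

lemma dim_span_unit_vec: "cvec.dim (cvec.span (unit_vec ` I)) = card I"
  using dim_span_image[OF inj_unit_vec independent_unit_vec subset_refl] .

lemma dim_coord_space [simp]: "cvec.dim (coord_space N) = N"
  using dim_span_unit_vec[of "{1..N}"] unfolding span_unit_vec by simp

lemma fin_dim_coord_space: "S \<subseteq> coord_space N \<Longrightarrow> fin_dim S"
  unfolding fin_dim_def using span_unit_vec[of N] by (intro exI[of _ "unit_vec ` {1..N}"]) auto

lemma dim_le_coord: "S \<subseteq> coord_space N \<Longrightarrow> cvec.dim S \<le> N"
  using dim_mono[of S "coord_space N"] fin_dim_coord_space by auto

section \<open>Bilinear forms and orthogonal complements\<close>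

lemma cscale_apply: "cscale c x i = c * x i"
  by (simp add: cscale_def)

lemma bilin_add_left: "bilin N M (x + y) z = bilin N M x z + bilin N M y z"
  unfolding bilin_def by (simp add: algebra_simps sum.distrib)

lemma bilin_add_right: "bilin N M z (x + y) = bilin N M z x + bilin N M z y"
  unfolding bilin_def by (simp add: algebra_simps sum.distrib)

lemma bilin_scale_left: "bilin N M (cscale c x) z = c * bilin N M x z"
  unfolding bilin_def cscale_def by (simp add: algebra_simps sum_distrib_left)

lemma bilin_scale_right: "bilin N M z (cscale c x) = c * bilin N M z x"
  unfolding bilin_def cscale_def by (simp add: algebra_simps sum_distrib_left)

lemma cscale_minus_one: "cscale (- 1) x = - x"
  by (simp add: cscale_def fun_eq_iff)

lemma bilin_minus_left: "bilin N M (- x) z = - bilin N M x z"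
  using bilin_scale_left[of N M "-1" x z] by (simp add: cscale_minus_one)

lemma bilin_minus_right: "bilin N M z (- x) = - bilin N M z x"
  using bilin_scale_right[of N M z "-1" x] by (simp add: cscale_minus_one)

lemma bilin_diff_left: "bilin N M (x - y) z = bilin N M x z - bilin N M y z"
  using bilin_add_left[of N M x "- y" z] by (simp add: bilin_minus_left)

lemma bilin_diff_right: "bilin N M z (x - y) = bilin N M z x - bilin N M z y"
  using bilin_add_right[of N M z x "- y"] by (simp add: bilin_minus_right)

lemma bilin_zero_left [simp]: "bilin N M 0 z = 0"
  unfolding bilin_def by simp

lemma bilin_zero_right [simp]: "bilin N M z 0 = 0"
  unfolding bilin_def by simp

lemmas bilin_simps = bilin_add_left bilin_add_right bilin_scale_left bilin_scale_right
  bilin_minus_left bilin_minus_right bilin_diff_left bilin_diff_right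

lemma clinear_iff: "clinear f \<longleftrightarrow>
    (\<forall>x y. f (x + y) = f x + f y) \<and> (\<forall>c x. f (cscale c x) = cscale c (f x))"
  by (simp add: Vector_Spaces.linear_iff cvec.vector_space_axioms)

lemma mat_vec_linear: "clinear (mat_vec N H)"
  unfolding clinear_iff mat_vec_def cscale_def
  by (auto simp: fun_eq_iff algebra_simps sum.distrib sum_distrib_left)

lemma mat_vec_in_coord_space [simp]: "mat_vec N H x \<in> coord_space N"
  unfolding mat_vec_def coord_space_def by auto

text \<open>
  The common zeros are the kernel of \<open>z \<mapsto> (\<beta> 1 z, \<dots>, \<beta> k z)\<close>, whose image has dimension at most \<open>k\<close>.
\<close>

lemma dim_common_zeros:
  assumes \<beta>: "\<And>i x y. \<beta> i (x + y) = \<beta> i x + \<beta> i y" "\<And>i c x. \<beta> i (cscale c x) = c * \<beta> i x"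
    and U: "cvec.subspace U" "fin_dim U"
  shows "cvec.dim U \<le> k + cvec.dim {z \<in> U. \<forall>i\<in>{1..k}. \<beta> i z = 0}"
proof -
  define \<phi> where "\<phi> = (\<lambda>z i. if i \<in> {1..k} then \<beta> i z else 0)"
  have "clinear \<phi>"
    unfolding clinear_iff \<phi>_def by (auto simp: fun_eq_iff \<beta> cscale_apply)
  from rank_nullity[OF this U]
  have "cvec.dim (\<phi> ` U) + cvec.dim {x \<in> U. \<phi> x = 0} = cvec.dim U" .
  moreover have "{x \<in> U. \<phi> x = 0} = {z \<in> U. \<forall>i\<in>{1..k}. \<beta> i z = 0}"
    unfolding \<phi>_def by (auto simp: fun_eq_iff)
  moreover have "cvec.dim (\<phi> ` U) \<le> k"
    by (rule dim_le_coord) (auto simp: \<phi>_def coord_space_def)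
  ultimately show ?thesis by simp
qed

lemma subspace_perp [simp]: "cvec.subspace (perp N M S)"
  unfolding cvec.subspace_def perp_def
  using cvec.subspace_0[OF subspace_coord_space] cvec.subspace_add[OF subspace_coord_space]
    cvec.subspace_scale[OF subspace_coord_space]
  by (auto simp: bilin_simps)

lemma perp_subset_coord_space: "perp N M S \<subseteq> coord_space N"
  unfolding perp_def by auto

lemma perp_antimono: "S \<subseteq> T \<Longrightarrow> perp N M T \<subseteq> perp N M S"
  unfolding perp_def by auto

lemma perp_span: "perp N M (cvec.span S) = perp N M S"
proof
  show "perp N M (cvec.span S) \<subseteq> perp N M S"
    by (intro perp_antimono cvec.span_superset)
  show "perp N M S \<subseteq> perp N M (cvec.span S)"
  proof
    fix y assume y: "y \<in> perp N M S"
    have "cvec.subspace {x. bilin N M x y = 0}"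
      unfolding cvec.subspace_def by (auto simp: bilin_simps)
    then have "cvec.span S \<subseteq> {x. bilin N M x y = 0}"
      using y by (intro cvec.span_minimal) (auto simp: perp_def)
    then show "y \<in> perp N M (cvec.span S)" using y by (auto simp: perp_def)
  qed
qed

lemma perp_sum_space:
  assumes "cvec.subspace S" "cvec.subspace T"
  shows "perp N M (sum_space S T) = perp N M S \<inter> perp N M T"
proof -
  have "cvec.span S = S" "cvec.span T = T" using assms by (simp_all only: cvec.span_eq_iff)
  then have "perp N M (sum_space S T) = perp N M (S \<union> T)"
    by (metis perp_span sum_space_span)
  then show ?thesis by (auto simp: perp_def)
qed

locale form_space =
  fixes N :: nat and M :: "nat \<Rightarrow> nat \<Rightarrow> complex" and \<epsilon> :: complex
  assumes M_swap: "\<And>i j. i \<in> {1..N} \<Longrightarrow> j \<in> {1..N} \<Longrightarrow> M j i = \<epsilon> * M i j"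
    and eps_sign: "\<epsilon> = 1 \<or> \<epsilon> = - 1"
    and nondegenerate: "\<And>x. x \<in> coord_space N \<Longrightarrow> (\<And>y. y \<in> coord_space N \<Longrightarrow> bilin N M x y = 0) \<Longrightarrow> x = 0"
begin

abbreviation V where "V \<equiv> coord_space N"
abbreviation B where "B \<equiv> bilin N M"
abbreviation orth where "orth \<equiv> perp N M"

lemma B_swap: "B y x = \<epsilon> * B x y"
proof -
  have "B y x = (\<Sum>i\<in>{1..N}. \<Sum>j\<in>{1..N}. \<epsilon> * (x j * M j i * y i))"
    unfolding bilin_def
  proof (intro sum.cong refl)
    fix i j assume "i \<in> {1..N}" "j \<in> {1..N}"
    then show "y i * M i j * x j = \<epsilon> * (x j * M j i * y i)" using M_swap[of j i] by simp
  qed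
  also have "\<dots> = \<epsilon> * (\<Sum>i\<in>{1..N}. \<Sum>j\<in>{1..N}. x j * M j i * y i)"
    by (simp add: sum_distrib_left)
  also have "(\<Sum>i\<in>{1..N}. \<Sum>j\<in>{1..N}. x j * M j i * y i) = B x y"
    unfolding bilin_def by (rule sum.swap)
  finally show ?thesis .
qed

lemma eps_nonzero: "\<epsilon> \<noteq> 0"
  using eps_sign by auto

lemma B_swap_zero: "B x y = 0 \<longleftrightarrow> B y x = 0"
  using B_swap[of x y] eps_nonzero by simp

lemma nondegenerate_right: "x \<in> V \<Longrightarrow> (\<And>y. y \<in> V \<Longrightarrow> B y x = 0) \<Longrightarrow> x = 0"
  using nondegenerate B_swap_zero by blast

lemma fin_dim_sub: "S \<subseteq> V \<Longrightarrow> fin_dim S" by (rule fin_dim_coord_space)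

text \<open>
  The defining equations of \<open>S\<^sup>\<bottom>\<close> give \<open>dim S\<^sup>\<bottom> \<ge> N - dim S\<close>. The same bound for a complement \<open>T\<close>
  of \<open>S\<close>, together with \<open>S\<^sup>\<bottom> \<inter> T\<^sup>\<bottom> = 0\<close>, forces equality.
\<close>

lemma dim_orth_ge:
  assumes S: "cvec.subspace S" "S \<subseteq> V"
  shows "N \<le> cvec.dim S + cvec.dim (orth S)"
proof -
  obtain A where A: "finite A" "cvec.span A = S" "card A = cvec.dim S"
    using subspace_basis[OF S(1) fin_dim_sub[OF S(2)]] by metis
  obtain s where s: "bij_betw s {1..card A} A" using A(1) ex_bij_betw_nat_finite_1 by blast
  have "cvec.dim V \<le> card A + cvec.dim {z \<in> V. \<forall>i\<in>{1..card A}. B (s i) z = 0}"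
    by (rule dim_common_zeros) (auto simp: bilin_simps fin_dim_sub)
  moreover have sA: "A = s ` {1..card A}" using s by (simp add: bij_betw_def)
  have "(\<forall>x\<in>A. P x) \<longleftrightarrow> (\<forall>i\<in>{1..card A}. P (s i))" for P by (subst (1) sA) simp
  then have "{z \<in> V. \<forall>i\<in>{1..card A}. B (s i) z = 0} = orth A"
    unfolding perp_def by simp
  moreover have "orth A = orth S" using A(2) perp_span by metis
  ultimately show ?thesis using A(3) by simp
qed

lemma dim_orth:
  assumes S: "cvec.subspace S" "S \<subseteq> V"
  shows "cvec.dim S + cvec.dim (orth S) = N"
proof -
  obtain A where A: "finite A" "cvec.independent A" "cvec.span A = S" "card A = cvec.dim S"
    using subspace_basis[OF S(1) fin_dim_sub[OF S(2)]] by metis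
  then have "A \<subseteq> V" using cvec.span_superset S(2) by blast
  then obtain C where C: "A \<subseteq> C" "finite C" "cvec.independent C" "cvec.span C = V" "card C = N"
    using basis_extending[OF subspace_coord_space fin_dim_sub[OF subset_refl] A(2), of thesis]
    by simp
  define T where "T = cvec.span (C - A)"
  have T: "cvec.subspace T" "T \<subseteq> V"
    using C(4) cvec.span_mono[of "C - A" C] unfolding T_def by auto
  have "sum_space S T = V"
    unfolding T_def A(3)[symmetric] sum_space_span using C by (simp add: Un_absorb1)
  then have "orth S \<inter> orth T = orth V" using perp_sum_space[OF S(1) T(1)] by simp
  also have "\<dots> = {0}"
    using nondegenerate_right cvec.subspace_0[OF subspace_coord_space] by (auto simp: perp_def)
  finally have int: "orth S \<inter> orth T = {0}" .
  have "cvec.dim (orth S) + cvec.dim (orth T) = cvec.dim (sum_space (orth S) (orth T))"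
    using dim_sum_space[OF subspace_perp fin_dim_sub[OF perp_subset_coord_space]
        subspace_perp fin_dim_sub[OF perp_subset_coord_space], of M S M T] int by simp
  also have "\<dots> \<le> N"
    by (intro dim_le_coord sum_space_least) (auto simp: perp_subset_coord_space)
  finally have 1: "cvec.dim (orth S) + cvec.dim (orth T) \<le> N" .
  have "cvec.dim T = N - cvec.dim S"
  proof -
    have "cvec.dim T = card (C - A)"
      unfolding T_def using C cvec.independent_mono[of C "C - A"]
      by (intro cvec.dim_span_eq_card_independent) auto
    also have "\<dots> = N - cvec.dim S" using C A by (simp add: card_Diff_subset)
    finally show ?thesis .
  qed
  moreover have "cvec.dim S \<le> N" using S dim_le_coord by blast
  ultimately show ?thesis using dim_orth_ge[OF S] dim_orth_ge[OF T] 1 by linarith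
qed

lemma orth_orth:
  assumes S: "cvec.subspace S" "S \<subseteq> V"
  shows "orth (orth S) = S"
proof (rule sym, rule dim_eq_imp_eq)
  show "S \<subseteq> orth (orth S)" using S(2) B_swap_zero by (auto simp: perp_def)
  show "cvec.dim (orth (orth S)) \<le> cvec.dim S"
    using dim_orth[OF S] dim_orth[OF subspace_perp perp_subset_coord_space, of M S] by linarith
qed (auto simp: S fin_dim_sub perp_subset_coord_space)

end

text \<open>
  The rank of an alternating form is even: if \<open>\<beta> x y \<noteq> 0\<close>, then the common zeros of \<open>\<beta> x\<close> and \<open>\<beta> y\<close>
  form a complement of the plane spanned by \<open>x\<close> and \<open>y\<close> with the same radical.
\<close>

lemma even_rank_skew_form:
  assumes \<beta>: "\<And>x y z. \<beta> (x + y) z = \<beta> x z + \<beta> y z" "\<And>c x z. \<beta> (cscale c x) z = c * \<beta> x z"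
    "\<And>x y z. \<beta> z (x + y) = \<beta> z x + \<beta> z y" "\<And>c x z. \<beta> z (cscale c x) = c * \<beta> z x"
    and U: "cvec.subspace U" "fin_dim U"
    and skew: "\<And>x y. x \<in> U \<Longrightarrow> y \<in> U \<Longrightarrow> \<beta> x y = - \<beta> y (x :: nat \<Rightarrow> complex)"
  shows "even (cvec.dim U + cvec.dim {x \<in> U. \<forall>y\<in>U. \<beta> x y = 0})"
  using U skew
proof (induction "cvec.dim U" arbitrary: U rule: less_induct)
  case less
  let ?R = "{x \<in> U. \<forall>y\<in>U. \<beta> x y = 0}"
  show ?case
  proof (cases "\<forall>x\<in>U. \<forall>y\<in>U. \<beta> x y = 0")
    case True
    then have "?R = U" by auto
    then show ?thesis by simp
  next
    case False
    then obtain x y where xy: "x \<in> U" "y \<in> U" "\<beta> x y \<noteq> 0" by blast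
    have alt: "\<beta> z z = 0" if "z \<in> U" for z using less.prems(3)[OF that that] by simp
    define U' where "U' = {z \<in> U. \<beta> x z = 0 \<and> \<beta> y z = 0}"
    have U': "cvec.subspace U'"
      using less.prems(1) unfolding U'_def cvec.subspace_def
      by (auto simp: \<beta> cvec.subspace_def) (metis \<beta>(4) cvec.scale_zero_left mult_zero_left)+
    have U'_sub: "U' \<subseteq> U" unfolding U'_def by auto
    have fU': "fin_dim U'" using fin_dim_subset[OF U'_sub less.prems(2)] .
    let ?P = "cvec.span {x, y}"
    have P: "?P \<subseteq> U" using xy less.prems(1) by (intro cvec.span_minimal) auto
    have byx: "\<beta> y x \<noteq> 0" using less.prems(3)[OF xy(1,2)] xy(3) by simp
    have "?P \<inter> U' = {0}"
    proof (intro subset_antisym subsetI)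
      fix z assume z: "z \<in> ?P \<inter> U'"
      then obtain a b where ab: "z = cscale a x + cscale b y"
        unfolding cvec.span_insert cvec.span_singleton
        by (auto simp: cvec.span_singleton) (metis diff_add_cancel diff_eq_eq add.commute)
      have "\<beta> x z = 0" "\<beta> y z = 0" using z unfolding U'_def by auto
      then have "b = 0" "a = 0"
        unfolding ab using xy byx alt[OF xy(1)] alt[OF xy(2)] by (simp_all add: \<beta>)
      then show "z \<in> {0}" using ab by simp
    next
      fix z assume "z \<in> {0::nat \<Rightarrow> complex}"
      then show "z \<in> ?P \<inter> U'" using U' by (simp add: cvec.span_zero cvec.subspace_0)
    qed
    have "x \<noteq> cscale c y" for c using xy(3) alt[OF xy(2)] by (auto simp: \<beta>)
    then have "cvec.independent {x, y}"
      using xy(3) \<beta>(4)[of x 0 0]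
      by (intro cvec.independent_insertI) (auto simp: cvec.span_singleton cvec.dependent_single cvec.independent_empty)
    moreover have "x \<noteq> y" using alt[OF xy(1)] xy(3) by auto
    ultimately have dP: "cvec.dim ?P = 2" by (simp add: cvec.dim_eq_card_independent)
    have dsum: "cvec.dim (sum_space ?P U') = 2 + cvec.dim U'"
      using dim_sum_space[OF cvec.subspace_span fin_dim_span U' fU', of "{x, y}"]
      unfolding \<open>?P \<inter> U' = {0}\<close> dP by simp
    have "{z \<in> U. \<forall>i\<in>{1..2::nat}. (if i = 1 then \<beta> x else \<beta> y) z = 0} = U'"
      by (auto simp: U'_def numeral_2_eq_2 atLeastAtMostSuc_conv)
    then have "cvec.dim U \<le> 2 + cvec.dim U'"
      using dim_common_zeros[of "\<lambda>i. if i = 1 then \<beta> x else \<beta> y" U 2] less.prems(1,2) \<beta> by simp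
    then have sum: "sum_space ?P U' = U"
      using dsum P U'_sub U' less.prems(1,2)
      by (intro dim_eq_imp_eq subspace_sum_space sum_space_least) auto
    have dU: "cvec.dim U = 2 + cvec.dim U'" using dsum unfolding sum .
    have rad: "{z \<in> U'. \<forall>w\<in>U'. \<beta> z w = 0} = ?R"
    proof (intro subset_antisym subsetI)
      fix z assume z: "z \<in> {z \<in> U'. \<forall>w\<in>U'. \<beta> z w = 0}"
      have zU: "z \<in> U" using z U'_sub by auto
      have zx: "\<beta> z x = 0" "\<beta> z y = 0"
        using z less.prems(3)[OF zU xy(1)] less.prems(3)[OF zU xy(2)] unfolding U'_def by auto
      have S: "cvec.subspace {w. \<beta> z w = 0}" 
        unfolding cvec.subspace_def by (auto simp: \<beta>) (metis \<beta>(4) cvec.scale_zero_left mult_zero_left)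
      have "sum_space ?P U' \<subseteq> {w. \<beta> z w = 0}"
        using z zx S by (intro sum_space_least cvec.span_minimal) auto
      then show "z \<in> ?R" using zU sum by auto
    next
      fix z assume z: "z \<in> ?R"
      then have "\<beta> x z = 0" "\<beta> y z = 0" using less.prems(3) xy by (metis (mono_tags, lifting) mem_Collect_eq neg_equal_0_iff_equal)+
      then show "z \<in> {z \<in> U'. \<forall>w\<in>U'. \<beta> z w = 0}" using z U'_sub unfolding U'_def by auto
    qed
    have "even (cvec.dim U' + cvec.dim {z \<in> U'. \<forall>w\<in>U'. \<beta> z w = 0})"
      using dU U'_sub less.prems(3) by (intro less.hyps U' fU') auto
    then show ?thesis unfolding rad dU by simp
  qed
qed

text \<open>
  Modulo \<open>T\<close>, that is after a map with kernel \<open>T\<close>, the space \<open>f S + T\<close> becomes the image of \<open>S\<close>.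
\<close>

lemma dim_image_plus:
  assumes f: "clinear f" and S: "cvec.subspace S" "fin_dim S" and T: "cvec.subspace T" "fin_dim T"
  shows "cvec.dim (sum_space (f ` S) T) + cvec.dim {x \<in> S. f x \<in> T} = cvec.dim S + cvec.dim T"
proof -
  obtain g where g: "clinear g" "\<And>x. g x = 0 \<longleftrightarrow> x \<in> T"
    by (rule linear_with_kernel[OF T(1)]) (rule that)
  have gf: "clinear (g \<circ> f)" using f g(1) Vector_Spaces.linear_compose by blast
  have fS: "cvec.subspace (f ` S)" "fin_dim (f ` S)"
    using cpair.linear_subspace_image[OF f S(1)] fin_dim_image[OF f S(2)] by auto
  have "g ` sum_space (f ` S) T = (g \<circ> f) ` S"
  proof
    show "g ` sum_space (f ` S) T \<subseteq> (g \<circ> f) ` S"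
      unfolding sum_space_def using g(2)[THEN iffD2] cpair.linear_add[OF g(1)] by auto
    show "(g \<circ> f) ` S \<subseteq> g ` sum_space (f ` S) T"
      using sum_space_left[OF T(1), of "f ` S"] by (auto simp: image_subset_iff)
  qed
  moreover have "{x \<in> sum_space (f ` S) T. g x = 0} = T"
    using g(2) sum_space_right[OF fS(1)] by blast
  moreover have "{x \<in> S. (g \<circ> f) x = 0} = {x \<in> S. f x \<in> T}" using g(2) by simp
  ultimately show ?thesis
    using rank_nullity[OF gf S] rank_nullity[OF g(1) subspace_sum_space[OF fS(1) T(1)]
        fin_dim_sum_space[OF fS(2) T(2)]] by simp
qed

section \<open>Flags\<close>

lemma complete_flagsD:
  assumes "F \<in> complete_flags N"
  shows "\<And>i. i \<le> N \<Longrightarrow> cvec.subspace (F i)" "\<And>i. i \<le> N \<Longrightarrow> F i \<subseteq> coord_space N"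
    "\<And>i. i \<le> N \<Longrightarrow> cvec.dim (F i) = i" "\<And>i j. i \<le> j \<Longrightarrow> j \<le> N \<Longrightarrow> F i \<subseteq> F j"
    "\<And>i. i \<le> N \<Longrightarrow> fin_dim (F i)"
proof -
  have F: "\<forall>i\<le>N. cvec.subspace (F i) \<and> F i \<subseteq> coord_space N \<and> cvec.dim (F i) = i"
    "\<forall>i<N. F i \<subseteq> F (Suc i)" using assms unfolding complete_flags_def by auto
  show "F i \<subseteq> F j" if "i \<le> j" "j \<le> N" for i j
    using that by (induction j rule: dec_induct) (use F(2) in \<open>auto simp: subset_iff Suc_le_eq\<close>)
  show "\<And>i. i \<le> N \<Longrightarrow> fin_dim (F i)" using F(1) fin_dim_coord_space by blast
qed (use assms in \<open>auto simp: complete_flags_def\<close>)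

lemma perp_flagsD:
  assumes "F \<in> perp_flags N M"
  shows "F \<in> complete_flags N" "\<And>i. i \<le> N \<Longrightarrow> F (N - i) = perp N M (F i)"
  using assms unfolding perp_flags_def by auto

lemma flag_of_basis_complete:
  assumes "inj_on g {1..N}" "cvec.independent (g ` {1..N})" "\<And>i. i \<in> {1..N} \<Longrightarrow> g i \<in> coord_space N"
  shows "flag_of_basis N g \<in> complete_flags N"
  unfolding complete_flags_def
proof (intro CollectI conjI allI impI)
  fix i assume i: "i \<le> N"
  then have sub: "{1..i} \<subseteq> {1..N}" by auto
  have F: "flag_of_basis N g i = cvec.span (g ` {1..i})" using i by (simp add: flag_of_basis_def)
  show "cvec.subspace (flag_of_basis N g i)" unfolding F by simp
  show "flag_of_basis N g i \<subseteq> coord_space N"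
    unfolding F using assms(3) sub by (intro cvec.span_minimal) auto
  show "cvec.dim (flag_of_basis N g i) = i" unfolding F using dim_span_image[OF assms(1,2) sub] by simp
next
  fix i assume "i < N"
  moreover have "cvec.span (g ` {1..i}) \<subseteq> cvec.span (g ` {1..Suc i})" by (intro cvec.span_mono) auto
  ultimately show "flag_of_basis N g i \<subseteq> flag_of_basis N g (Suc i)" by (simp add: flag_of_basis_def)
qed (simp add: flag_of_basis_def)

section \<open>Involutions and relative position of a flag\<close>

locale involution =
  fixes N :: nat and H :: "nat \<Rightarrow> nat \<Rightarrow> complex"
  assumes h_h: "\<And>x. x \<in> coord_space N \<Longrightarrow> mat_vec N H (mat_vec N H x) = x"
begin

abbreviation h where "h \<equiv> mat_vec N H"
abbreviation E where "E \<equiv> eigenspace N H"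

lemma h_add: "h (x + y) = h x + h y" and h_scale: "h (cscale c x) = cscale c (h x)"
  using mat_vec_linear unfolding clinear_iff by auto

lemma h_minus: "h (- x) = - h x"
  using h_scale[of "-1" x] by (simp add: cscale_minus_one)

lemma h_diff: "h (x - y) = h x - h y"
  using h_add[of x "- y"] by (simp add: h_minus)

lemma in_E: "x \<in> E c \<longleftrightarrow> x \<in> coord_space N \<and> h x = cscale c x"
  unfolding eigenspace_def by auto

lemma subspace_E [simp]: "cvec.subspace (E c)"
  unfolding cvec.subspace_def in_E
  using cvec.subspace_0[OF subspace_coord_space] cvec.subspace_add[OF subspace_coord_space]
    cvec.subspace_scale[OF subspace_coord_space] cpair.linear_0[OF mat_vec_linear]
  by (auto simp: in_E h_add h_scale cvec.scale_right_distrib mult.commute)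

lemma E_sub: "E c \<subseteq> coord_space N"
  using in_E by auto

lemma E_int: "x \<in> E 1 \<Longrightarrow> x \<in> E (- 1) \<Longrightarrow> x = 0"
proof -
  assume "x \<in> E 1" "x \<in> E (- 1)"
  then have "h x = x" "h x = - x" by (simp_all add: in_E cscale_minus_one)
  then have "x i = - x i" for i by (metis fun_Compl_def)
  then show "x = 0" by (simp add: fun_eq_iff)
qed

lemma h_plus_scale_in_E: 
  assumes "x \<in> coord_space N" "c = 1 \<or> c = - 1"
  shows "h x + cscale c x \<in> E c"
proof -
  have "h (h x + cscale c x) = x + cscale c (h x)" using assms by (simp add: h_add h_scale h_h)
  also have "\<dots> = cscale c (h x + cscale c x)"
    using assms(2) by (auto simp: cvec.scale_right_distrib cscale_minus_one)
  finally show ?thesis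
    using assms unfolding in_E
    by (simp add: cvec.subspace_add cvec.subspace_scale)
qed

lemma proj_along_E:
  assumes "x \<in> coord_space N"
  shows "proj_along (E 1) (E (- 1)) x = cscale (1/2) (x + h x)"
  unfolding proj_along_def
proof (rule the_equality)
  let ?u = "cscale (1/2) (x + h x)"
  have 1: "?u \<in> E 1"
    using h_plus_scale_in_E[OF assms, of 1] cvec.subspace_scale[OF subspace_E]
    by (simp add: add.commute)
  have "x - ?u = cscale (- 1/2) (h x + cscale (- 1) x)"
    by (auto simp: cscale_def fun_eq_iff field_simps)
  then have 2: "x - ?u \<in> E (- 1)"
    using h_plus_scale_in_E[OF assms, of "- 1"] cvec.subspace_scale[OF subspace_E] by metis
  show "?u \<in> E 1 \<and> x - ?u \<in> E (- 1)" using 1 2 by blast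
  fix u assume u: "u \<in> E 1 \<and> x - u \<in> E (- 1)"
  have "u - ?u \<in> E 1" using u 1 by (simp add: cvec.subspace_diff)
  moreover have "u - ?u = (x - ?u) - (x - u)" by simp
  then have "u - ?u \<in> E (- 1)" using u 2 cvec.subspace_diff[OF subspace_E, of "x - ?u" "- 1" "x - u"] by simp
  ultimately show "u = ?u" using E_int by fastforce
qed

lemma decompose: "x \<in> coord_space N \<Longrightarrow> \<exists>y\<in>E 1. \<exists>z\<in>E (- 1). x = y + z"
proof -
  assume x: "x \<in> coord_space N"
  have "x = cscale (1/2) (h x + cscale 1 x) + cscale (- 1/2) (h x + cscale (- 1) x)"
    by (auto simp: cscale_def fun_eq_iff field_simps)
  then show ?thesis
    using h_plus_scale_in_E[OF x] cvec.subspace_scale[OF subspace_E] by metis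
qed

lemma sum_proj_eq:
  assumes "cvec.subspace S" "cvec.subspace T" "S \<subseteq> T" "T \<subseteq> coord_space N"
  shows "sum_space (proj_along (E 1) (E (- 1)) ` S) T = sum_space (h ` S) T"
proof -
  let ?p = "proj_along (E 1) (E (- 1))"
  have p: "?p x = cscale (1/2) (x + h x)" if "x \<in> S" for x
    using that assms by (intro proj_along_E) auto
  have sub: "cvec.subspace (sum_space (h ` S) T)"
    using cpair.linear_subspace_image[OF mat_vec_linear assms(1)] assms(2) by (rule subspace_sum_space)
  show ?thesis
  proof
    have "?p x \<in> sum_space (h ` S) T" if "x \<in> S" for x
    proof -
      have "h x + x \<in> sum_space (h ` S) T" using that assms(3) by (intro sum_spaceI) auto
      then show ?thesis unfolding p[OF that] using cvec.subspace_scale[OF sub] by (simp add: add.commute)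
    qed
    then show "sum_space (?p ` S) T \<subseteq> sum_space (h ` S) T"
      using sum_space_right[OF cpair.linear_subspace_image[OF mat_vec_linear assms(1)]]
      by (intro sum_space_least sub) auto
    show "sum_space (h ` S) T \<subseteq> sum_space (?p ` S) T"
    proof
      fix w assume "w \<in> sum_space (h ` S) T"
      then obtain x t where xt: "x \<in> S" "t \<in> T" "w = h x + t" unfolding sum_space_def by blast
      have "w = ?p (cscale 2 x) + (t - x)"
        using xt assms(1) by (subst p) (simp_all add: cvec.subspace_scale h_scale fun_eq_iff cscale_apply field_simps)
      moreover have "cscale 2 x \<in> S" "t - x \<in> T"
        using xt assms by (auto simp: cvec.subspace_scale cvec.subspace_diff)
      ultimately show "w \<in> sum_space (?p ` S) T" by (metis imageI sum_spaceI)
    qed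
  qed
qed

text \<open>
  Since \<open>h = 2\<pi> - 1\<close>, the projection \<open>\<pi>\<close> may be replaced by \<open>h\<close> in the third family of conditions.
\<close>

lemma clan_orbit_iff:
  "F \<in> clan_orbit N H \<gamma> \<longleftrightarrow> F \<in> complete_flags N \<and>
     (\<forall>i\<in>{1..N}. cvec.dim (F i \<inter> E 1) = clan_plus \<gamma> i) \<and>
     (\<forall>i\<in>{1..N}. cvec.dim (F i \<inter> E (- 1)) = clan_minus \<gamma> i) \<and>
     (\<forall>i\<in>{1..N}. \<forall>j\<in>{1..N}. i < j \<longrightarrow>
        cvec.dim (sum_space (h ` F i) (F j)) = j + clan_cross \<gamma> i j)"
proof (cases "F \<in> complete_flags N")
  case True
  have "sum_space (proj_along (E 1) (E (- 1)) ` F i) (F j) = sum_space (h ` F i) (F j)"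
    if "i \<in> {1..N}" "j \<in> {1..N}" "i < j" for i j
    using that complete_flagsD[OF True] by (intro sum_proj_eq) auto
  then show ?thesis using True unfolding clan_orbit_def Let_def by auto
qed (simp add: clan_orbit_def Let_def)

text \<open>
  The part of \<open>S\<close> that \<open>h\<close> maps into \<open>S\<close> is stable under \<open>h\<close>, so it contains the components of its
  elements in the two eigenspaces.
\<close>

lemma dim_stable_part:
  assumes S: "cvec.subspace S" "S \<subseteq> coord_space N"
  shows "cvec.dim {x \<in> S. h x \<in> S} = cvec.dim (S \<inter> E 1) + cvec.dim (S \<inter> E (- 1))"
proof -
  have fd: "fin_dim (S \<inter> E c)" for c using S fin_dim_coord_space[of "S \<inter> E c" N] by auto
  have sb: "cvec.subspace (S \<inter> E c)" for c using S by (simp add: cvec.subspace_inter)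
  have "{x \<in> S. h x \<in> S} = sum_space (S \<inter> E 1) (S \<inter> E (- 1))"
  proof (intro subset_antisym subsetI)
    fix x assume x: "x \<in> {x \<in> S. h x \<in> S}"
    have "x = cscale (1/2) (h x + cscale 1 x) + cscale (- 1/2) (h x + cscale (- 1) x)"
      by (auto simp: cscale_def fun_eq_iff field_simps)
    moreover have "h x + cscale c x \<in> S \<inter> E c" if "c = 1 \<or> c = - 1" for c
      using x S h_plus_scale_in_E[OF _ that, of x] by (auto simp: cvec.subspace_add cvec.subspace_scale)
    ultimately show "x \<in> sum_space (S \<inter> E 1) (S \<inter> E (- 1))"
      using sum_spaceI cvec.subspace_scale[OF sb] by metis
  next
    fix x assume "x \<in> sum_space (S \<inter> E 1) (S \<inter> E (- 1))"
    then obtain y z where "x = y + z" "y \<in> S" "z \<in> S" "h y = y" "h z = - z"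
      unfolding sum_space_def by (auto simp: in_E cscale_minus_one)
    then show "x \<in> {x \<in> S. h x \<in> S}"
      using S by (auto simp: cvec.subspace_add cvec.subspace_diff h_add)
  qed
  moreover have "(S \<inter> E 1) \<inter> (S \<inter> E (- 1)) = {0}"
    using E_int S by (auto simp: cvec.subspace_0)
  ultimately show ?thesis
    using dim_sum_space[OF sb[of 1] fd[of 1] sb[of "-1"] fd[of "-1"]] by simp
qed

lemma dim_E_sum: "cvec.dim (E 1) + cvec.dim (E (- 1)) = N"
proof -
  have "{x \<in> coord_space N. h x \<in> coord_space N} = coord_space N" by auto
  moreover have "coord_space N \<inter> E c = E c" for c using E_sub by blast
  ultimately show ?thesis using dim_stable_part[of "coord_space N"] by simp
qed

end

text \<open>
  For \<open>\<delta> = 1\<close> the eigenspaces of \<open>h\<close> are orthogonal to each other, for \<open>\<delta> = - 1\<close> they are isotropic.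
\<close>

locale form_involution = form_space N M \<epsilon> + involution N H
  for N M \<epsilon> H +
  fixes \<delta> :: complex
  assumes delta_sign: "\<delta> = 1 \<or> \<delta> = - 1"
    and h_form: "\<And>x y. x \<in> coord_space N \<Longrightarrow> y \<in> coord_space N \<Longrightarrow>
      bilin N M (mat_vec N H x) (mat_vec N H y) = \<delta> * bilin N M x y"
begin

lemma delta_sq: "\<delta> * \<delta> = 1" using delta_sign by auto

lemma h_adjoint:
  assumes "x \<in> V" "y \<in> V"
  shows "B (h x) y = \<delta> * B x (h y)"
  using h_form[of x "h y"] assms by (simp add: h_h)

lemma orth_E:
  assumes c: "c = 1 \<or> c = - 1"
  shows "orth (E (- \<delta> * c)) = E c"
proof (intro subset_antisym subsetI)
  fix y assume y: "y \<in> orth (E (- \<delta> * c))"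
  then have yV: "y \<in> V" by (simp add: perp_def)
  have "h y - cscale c y = 0"
  proof (rule nondegenerate_right)
    fix z assume z: "z \<in> V"
    have "B z (h y - cscale c y) = \<delta> * B (h z + cscale (- \<delta> * c) z) y"
      using h_adjoint[OF z yV] 
      by (simp add: bilin_simps right_diff_distrib mult.assoc[symmetric] delta_sq)
    also have "\<dots> = 0"
      using h_plus_scale_in_E[OF z, of "- \<delta> * c"] c delta_sign y by (auto simp: perp_def)
    finally show "B z (h y - cscale c y) = 0" .
  qed (use yV in \<open>simp add: cvec.subspace_diff cvec.subspace_scale\<close>)
  then show "y \<in> E c" using yV by (simp add: in_E)
next
  fix y assume y: "y \<in> E c"
  have "B x y = 0" if "x \<in> E (- \<delta> * c)" for x
  proof -
    have "\<delta> * B x y = (- \<delta> * c) * c * B x y"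
      using h_form[of x y] y that unfolding in_E by (simp add: bilin_simps mult_ac)
    then show ?thesis using c delta_sign by auto
  qed
  then show "y \<in> orth (E (- \<delta> * c))" using y E_sub by (auto simp: perp_def)
qed

text \<open>
  The reason is \<open>F\<^bsub>N-i\<^esub> \<inter> E c = (F\<^sub>i + E (- \<delta> c))\<^sup>\<bottom>\<close>.
\<close>

lemma dim_flag_E_mirror:
  assumes F: "F \<in> perp_flags N M" and i: "i \<le> N" and c: "c = 1 \<or> c = - 1"
  shows "cvec.dim (F (N - i) \<inter> E c) + i + cvec.dim (E (- \<delta> * c)) = N + cvec.dim (F i \<inter> E (- \<delta> * c))"
proof -
  note F' = complete_flagsD[OF perp_flagsD(1)[OF F]]
  have "F (N - i) \<inter> E c = orth (F i) \<inter> orth (E (- \<delta> * c))"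
    unfolding orth_E[OF c] perp_flagsD(2)[OF F i] ..
  also have "\<dots> = orth (sum_space (F i) (E (- \<delta> * c)))"
    using F' i by (simp add: perp_sum_space)
  finally have 1: "F (N - i) \<inter> E c = orth (sum_space (F i) (E (- \<delta> * c)))" .
  have "cvec.dim (sum_space (F i) (E (- \<delta> * c))) + cvec.dim (F i \<inter> E (- \<delta> * c)) = i + cvec.dim (E (- \<delta> * c))"
    using dim_sum_space[OF F'(1,5) subspace_E fin_dim_sub[OF E_sub], OF i i] F'(3)[OF i] by simp
  moreover have "cvec.dim (sum_space (F i) (E (- \<delta> * c))) + cvec.dim (orth (sum_space (F i) (E (- \<delta> * c)))) = N"
    using F' i E_sub by (intro dim_orth subspace_sum_space sum_space_least) auto
  ultimately show ?thesis using 1 by simp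
qed

text \<open>
  As \<open>h\<close> is self-adjoint up to sign, \<open>(h F\<^sub>i + F\<^sub>j)\<^sup>\<bottom>\<close> consists of the vectors of \<open>F\<^bsub>N-j\<^esub>\<close> that \<open>h\<close> maps
  into \<open>F\<^bsub>N-i\<^esub>\<close>. Its dimension is governed by \<open>h F\<^bsub>N-j\<^esub> + F\<^bsub>N-i\<^esub>\<close>.
\<close>

lemma dim_h_flag_mirror:
  assumes F: "F \<in> perp_flags N M" and ij: "i \<le> j" "j \<le> N"
  shows "cvec.dim (sum_space (h ` F (N - j)) (F (N - i))) + j = cvec.dim (sum_space (h ` F i) (F j)) + (N - i)"
proof -
  note F' = complete_flagsD[OF perp_flagsD(1)[OF F]]
  have i: "i \<le> N" using ij by simp
  have hF: "cvec.subspace (h ` F i)" "h ` F i \<subseteq> V"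
    using cpair.linear_subspace_image[OF mat_vec_linear F'(1)[OF i]] by auto
  have "orth (sum_space (h ` F i) (F j)) = orth (h ` F i) \<inter> F (N - j)"
    using perp_flagsD(2)[OF F ij(2)] hF F' ij by (simp add: perp_sum_space)
  also have "\<dots> = {x \<in> F (N - j). h x \<in> F (N - i)}"
  proof -
    have "x \<in> orth (h ` F i) \<longleftrightarrow> h x \<in> orth (F i)" if "x \<in> F (N - j)" for x
    proof -
      have xV: "x \<in> V" using that F'(2)[of "N - j"] by auto
      have "B (h y) x = 0 \<longleftrightarrow> B y (h x) = 0" if "y \<in> F i" for y
        using h_adjoint[of y x] that F'(2)[OF i] xV delta_sign by auto
      then show ?thesis using xV by (simp add: perp_def)
    qed
    then show ?thesis using perp_flagsD(2)[OF F i] by auto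
  qed
  finally have 1: "orth (sum_space (h ` F i) (F j)) = {x \<in> F (N - j). h x \<in> F (N - i)}" .
  have "cvec.dim (sum_space (h ` F (N - j)) (F (N - i))) + cvec.dim {x \<in> F (N - j). h x \<in> F (N - i)}
      = (N - j) + (N - i)"
    using dim_image_plus[OF mat_vec_linear F'(1,5,1,5), of "N - j" "N - i" N H] F'(3) by simp
  moreover have "cvec.dim (sum_space (h ` F i) (F j)) + cvec.dim (orth (sum_space (h ` F i) (F j))) = N"
    using F' ij hF by (intro dim_orth subspace_sum_space sum_space_least) auto
  ultimately show ?thesis unfolding 1 using ij by arith
qed

text \<open>
  The form \<open>B (h x) y\<close> is alternating. Its radical on \<open>F\<^sub>i\<close> consists of the vectors that \<open>h\<close> maps into
  \<open>F\<^sub>i\<^sup>\<bottom> = F\<^bsub>N-i\<^esub>\<close>, so its rank is the dimension of \<open>h F\<^sub>i\<close> modulo \<open>F\<^bsub>N-i\<^esub>\<close>.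
\<close>

lemma dim_h_flag_even:
  assumes F: "F \<in> perp_flags N M" and i: "i \<le> N - i" "i \<le> N" and skew: "\<epsilon> * \<delta> = - 1"
  shows "even (cvec.dim (sum_space (h ` F i) (F (N - i))) + (N - i))"
proof -
  note F' = complete_flagsD[OF perp_flagsD(1)[OF F]]
  have "even (cvec.dim (F i) + cvec.dim {x \<in> F i. \<forall>y\<in>F i. B (h x) y = 0})"
  proof (rule even_rank_skew_form[where \<beta> = "\<lambda>x y. B (h x) y"])
    fix x y assume xy: "x \<in> F i" "y \<in> F i"
    then have V: "x \<in> V" "y \<in> V" using F'(2) i by auto
    have "B (h x) y = \<delta> * (\<epsilon> * B (h y) x)"
      using h_adjoint[OF V] B_swap[of x "h y"] by simp
    then have "B (h x) y = (\<epsilon> * \<delta>) * B (h y) x" by simp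
    then show "B (h x) y = - B (h y) x" unfolding skew by simp
  qed (use F' i in \<open>auto simp: bilin_simps h_add h_scale\<close>)
  moreover have "{x \<in> F i. \<forall>y\<in>F i. B (h x) y = 0} = {x \<in> F i. h x \<in> F (N - i)}"
    using perp_flagsD(2)[OF F i(2)] B_swap_zero by (auto simp: perp_def)
  ultimately have 1: "even (i + cvec.dim {x \<in> F i. h x \<in> F (N - i)})"
    using F'(3)[OF i(2)] by metis
  have 2: "cvec.dim (sum_space (h ` F i) (F (N - i))) + cvec.dim {x \<in> F i. h x \<in> F (N - i)}
      = i + (N - i)"
    using dim_image_plus[OF mat_vec_linear F'(1,5,1,5), of i "N - i" N H] F'(3) i by simp
  have par: "even (i + r) \<Longrightarrow> s + r = i + m \<Longrightarrow> even (s + m)" for r s m :: nat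
    by presburger
  show ?thesis by (rule par[OF 1 2])
qed

end

section \<open>Clans as involutions\<close>

text \<open>
  The matching of equal numbers, extended by the identity on the positions of signs. Up to renaming
  numbers, a clan is this involution together with the signs on its fixed points.
\<close>

definition mate :: "clan_symbol list \<Rightarrow> nat \<Rightarrow> nat" where
  "mate \<gamma> i = (if i \<in> {1..length \<gamma>} \<and> is_num (entry \<gamma> i)
     then THE j. j \<in> {1..length \<gamma>} \<and> j \<noteq> i \<and> entry \<gamma> j = entry \<gamma> i else i)"

lemma count_list_entry: "count_list \<gamma> x = card {i \<in> {1..length \<gamma>}. entry \<gamma> i = x}"
proof -
  have "count_list \<gamma> x = length (filter (\<lambda>y. x = y) \<gamma>)"
    by (induction \<gamma>) auto
  also have "\<dots> = card {i. i < length \<gamma> \<and> x = \<gamma> ! i}"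
    by (rule length_filter_conv_card)
  also have "\<dots> = card (Suc ` {i. i < length \<gamma> \<and> x = \<gamma> ! i})"
    by (rule card_image[symmetric]) auto
  also have "Suc ` {i. i < length \<gamma> \<and> x = \<gamma> ! i} = {i \<in> {1..length \<gamma>}. entry \<gamma> i = x}"
  proof (intro subset_antisym subsetI)
    fix i assume "i \<in> {i \<in> {1..length \<gamma>}. entry \<gamma> i = x}"
    then have "i = Suc (i - 1)" "i - 1 < length \<gamma>" "x = \<gamma> ! (i - 1)" by (auto simp: entry_def)
    then show "i \<in> Suc ` {i. i < length \<gamma> \<and> x = \<gamma> ! i}" by blast
  qed (auto simp: entry_def)
  finally show ?thesis .
qed

locale clan =
  fixes a b :: nat and \<gamma> :: "clan_symbol list" and N :: nat
  assumes is_clan: "is_clan a b \<gamma>" and N_def: "N = a + b"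
begin

abbreviation c where "c \<equiv> entry \<gamma>"
abbreviation \<sigma> where "\<sigma> \<equiv> mate \<gamma>"

lemma length_clan [simp]: "length \<gamma> = N"
  using is_clan N_def by (simp add: is_clan_def)

lemma ex1_mate:
  assumes i: "i \<in> {1..N}" "is_num (c i)"
  shows "\<exists>!j. j \<in> {1..N} \<and> j \<noteq> i \<and> c j = c i"
proof -
  obtain k where k: "c i = Num k" using i(2) by (auto simp: is_num_def)
  have "Num k \<in> set \<gamma>" using k i(1) unfolding entry_def 
    by (metis Suc_diff_1 Suc_le_lessD atLeastAtMost_iff length_clan nth_mem One_nat_def)
  then have "card {i \<in> {1..N}. c i = Num k} = 2"
    using is_clan count_list_entry[of \<gamma> "Num k"] by (simp add: is_clan_def)
  then obtain x y where xy: "{i \<in> {1..N}. c i = Num k} = {x, y}" "x \<noteq> y"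
    by (auto simp: card_2_iff)
  moreover have "i \<in> {i \<in> {1..N}. c i = Num k}" using i k by simp
  ultimately obtain j where j: "{i \<in> {1..N}. c i = Num k} = {i, j}" "i \<noteq> j"
    by (cases "i = x") auto
  show ?thesis
  proof
    have "j \<in> {i \<in> {1..N}. c i = Num k}" unfolding j(1) by simp
    then show "j \<in> {1..N} \<and> j \<noteq> i \<and> c j = c i" using j(2) k by simp
    fix l assume "l \<in> {1..N} \<and> l \<noteq> i \<and> c l = c i"
    then have "l \<in> {i \<in> {1..N}. c i = Num k}" using k by simp
    then have "l \<in> {i, j}" unfolding j(1) .
    then show "l = j" using \<open>l \<in> {1..N} \<and> l \<noteq> i \<and> c l = c i\<close> by blast
  qed
qed

lemma mate_num:
  assumes "i \<in> {1..N}" "is_num (c i)"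
  shows "\<sigma> i \<in> {1..N}" "\<sigma> i \<noteq> i" "c (\<sigma> i) = c i"
    "\<And>j. j \<in> {1..N} \<Longrightarrow> c j = c i \<Longrightarrow> j = i \<or> j = \<sigma> i"
proof -
  have "\<sigma> i = (THE j. j \<in> {1..N} \<and> j \<noteq> i \<and> c j = c i)" using assms by (simp add: mate_def)
  then have *: "\<sigma> i \<in> {1..N} \<and> \<sigma> i \<noteq> i \<and> c (\<sigma> i) = c i"
    using theI'[OF ex1_mate[OF assms]] by simp
  then show "\<sigma> i \<in> {1..N}" "\<sigma> i \<noteq> i" "c (\<sigma> i) = c i" by auto
  show "j = i \<or> j = \<sigma> i" if "j \<in> {1..N}" "c j = c i" for j
    using ex1_mate[OF assms] * that by blast
qed

lemma mate_sign: "\<not> is_num (c i) \<Longrightarrow> \<sigma> i = i"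
  by (simp add: mate_def)

lemma mate_in [simp]: "i \<in> {1..N} \<Longrightarrow> \<sigma> i \<in> {1..N}"
  using mate_num(1) mate_sign by (cases "is_num (c i)") auto

lemma mate_bounds: "i \<in> {1..N} \<Longrightarrow> 1 \<le> \<sigma> i \<and> \<sigma> i \<le> N"
  using mate_in[of i] by simp

lemma entry_mate [simp]: "i \<in> {1..N} \<Longrightarrow> c (\<sigma> i) = c i"
  using mate_num(3) mate_sign by (cases "is_num (c i)") auto

lemma mate_eq_iff: "i \<in> {1..N} \<Longrightarrow> \<sigma> i = i \<longleftrightarrow> \<not> is_num (c i)"
  using mate_num(2) mate_sign by blast

lemma mate_mate [simp]:
  assumes "i \<in> {1..N}" shows "\<sigma> (\<sigma> i) = i"
proof (cases "is_num (c i)")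
  case True
  note m = mate_num[OF assms True]
  have n: "is_num (c (\<sigma> i))" using True m(3) by simp
  have "c i = c (\<sigma> i)" using m(3) by simp
  then show ?thesis using mate_num(4)[OF m(1) n assms] m(2) by metis
qed (simp add: mate_sign)

lemma mate_inj: "i \<in> {1..N} \<Longrightarrow> j \<in> {1..N} \<Longrightarrow> \<sigma> i = \<sigma> j \<Longrightarrow> i = j"
  using mate_mate by metis

lemma sign_cases: "\<not> is_num (c i) \<longleftrightarrow> c i = Plus \<or> c i = Minus"
  by (cases "c i") (auto simp: is_num_def)

lemma second_not_sign: "i \<in> {1..N} \<Longrightarrow> \<sigma> i < i \<Longrightarrow> c i \<noteq> Plus \<and> c i \<noteq> Minus"
  using sign_cases mate_eq_iff by fastforce

lemma equal_numbers_iff: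
  assumes "s \<in> {1..N}" "t \<in> {1..N}" "s \<noteq> t"
  shows "is_num (c s) \<and> c s = c t \<longleftrightarrow> t = \<sigma> s"
proof
  assume *: "is_num (c s) \<and> c s = c t"
  then have "is_num (c s)" "c t = c s" by metis+
  then have "t = s \<or> t = \<sigma> s" using mate_num(4)[OF assms(1) _ assms(2)] by blast
  then show "t = \<sigma> s" using assms(3) by blast
next
  assume *: "t = \<sigma> s"
  then have "is_num (c s)" using assms mate_sign[of s] by auto
  then show "is_num (c s) \<and> c s = c t" using * entry_mate[OF assms(1)] by simp
qed

lemma pair_count_eq:
  assumes "i \<le> N"
  shows "pair_count \<gamma> i = card {t \<in> {1..i}. \<sigma> t < t}"
proof -
  have "{(s, t). 1 \<le> s \<and> s < t \<and> t \<le> i \<and> is_num (c s) \<and> c s = c t}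
      = (\<lambda>t. (\<sigma> t, t)) ` {t \<in> {1..i}. \<sigma> t < t}" (is "?L = ?R")
  proof (intro subset_antisym subsetI)
    fix p assume "p \<in> ?L"
    then obtain s t where p: "p = (s, t)" "1 \<le> s" "s < t" "t \<le> i" "is_num (c s)" "c s = c t" by auto
    then have st: "s \<in> {1..N}" "t \<in> {1..N}" "s \<noteq> t" using assms by auto
    then have "t = \<sigma> s" using equal_numbers_iff p by blast
    then have "s = \<sigma> t" using st by simp
    then show "p \<in> ?R" using p by auto
  next
    fix p assume "p \<in> ?R"
    then obtain t where p: "p = (\<sigma> t, t)" "t \<in> {1..i}" "\<sigma> t < t" by auto
    then have "t \<in> {1..N}" using assms by auto
    moreover from this have "\<sigma> t \<in> {1..N}" by (rule mate_in)
    ultimately have "is_num (c (\<sigma> t)) \<and> c (\<sigma> t) = c t"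
      using p by (intro equal_numbers_iff[THEN iffD2]) auto
    then show "p \<in> ?L" using p \<open>\<sigma> t \<in> {1..N}\<close> by clarsimp
  qed
  then show ?thesis unfolding pair_count_def by (simp add: card_image inj_on_def)
qed

lemma sign_count_plus_pair_count:
  assumes "i \<le> N" "sg = Plus \<or> sg = Minus"
  shows "sign_count sg \<gamma> i + pair_count \<gamma> i = card {t \<in> {1..i}. c t = sg \<or> \<sigma> t < t}"
proof -
  have "{t \<in> {1..i}. c t = sg \<or> \<sigma> t < t} = {t \<in> {1..i}. c t = sg} \<union> {t \<in> {1..i}. \<sigma> t < t}" by auto
  moreover have "{t \<in> {1..i}. c t = sg} \<inter> {t \<in> {1..i}. \<sigma> t < t} = {}"
    using assms second_not_sign by fastforce
  ultimately show ?thesis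
    using pair_count_eq[OF assms(1)] by (simp add: sign_count_def card_Un_disjoint)
qed

lemma clan_plus_eq: "i \<le> N \<Longrightarrow> clan_plus \<gamma> i = card {t \<in> {1..i}. c t = Plus \<or> \<sigma> t < t}"
  and clan_minus_eq: "i \<le> N \<Longrightarrow> clan_minus \<gamma> i = card {t \<in> {1..i}. c t = Minus \<or> \<sigma> t < t}"
  using sign_count_plus_pair_count by (simp_all add: clan_plus_def clan_minus_def)

lemma card_Collect_Suc:
  "card {t \<in> {1..Suc i}. P t} = card {t \<in> {1..i}. P t} + (if P (Suc i) then 1 else 0)"
proof -
  have "{t \<in> {1..Suc i}. P t} = (if P (Suc i) then insert (Suc i) {t \<in> {1..i}. P t} else {t \<in> {1..i}. P t})"
    by (auto simp: le_Suc_eq)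
  then show ?thesis by simp
qed

text \<open>The number \<open>\<gamma>(i;j)\<close>, also for \<open>i = j\<close>.\<close>

definition crossings :: "nat \<Rightarrow> nat \<Rightarrow> nat" where
  "crossings i j = card {s \<in> {1..i}. j < \<sigma> s}"

lemma clan_cross_eq:
  assumes "i < j" "j \<le> N"
  shows "clan_cross \<gamma> i j = crossings i j"
proof -
  have "{(s, t). 1 \<le> s \<and> s \<le> i \<and> i < j \<and> j < t \<and> t \<le> N \<and> is_num (c s) \<and> c s = c t}
      = (\<lambda>s. (s, \<sigma> s)) ` {s \<in> {1..i}. j < \<sigma> s}" (is "?L = ?R")
  proof (intro subset_antisym subsetI)
    fix p assume "p \<in> ?L"
    then obtain s t where p: "p = (s, t)" "1 \<le> s" "s \<le> i" "j < t" "t \<le> N" "is_num (c s)" "c s = c t" by auto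
    have "t = \<sigma> s" by (rule equal_numbers_iff[THEN iffD1]) (use p assms in auto)
    then show "p \<in> ?R" using p by auto
  next
    fix p assume "p \<in> ?R"
    then obtain s where p: "p = (s, \<sigma> s)" "s \<in> {1..i}" "j < \<sigma> s" by auto
    then have "s \<in> {1..N}" using assms by auto
    moreover from this have "\<sigma> s \<in> {1..N}" by (rule mate_in)
    ultimately have "is_num (c s) \<and> c s = c (\<sigma> s)"
      using p assms by (intro equal_numbers_iff[THEN iffD2]) auto
    then show "p \<in> ?L" using p assms \<open>\<sigma> s \<in> {1..N}\<close> by simp
  qed
  then show ?thesis unfolding clan_cross_def crossings_def by (simp add: card_image inj_on_def)
qed

text \<open>
  Up to position \<open>i\<close> there are signs, both members of the pairs closed by then, and the first members of
  the pairs counted by \<open>crossings i i\<close>. Thus the dimensions of \<open>F\<^sub>i \<inter> E\<^sub>\<plusminus>\<close> also provide the missing number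
  \<open>\<gamma>(i;i)\<close>.
\<close>

lemma crossings_diag:
  assumes "i \<le> N"
  shows "crossings i i + clan_plus \<gamma> i + clan_minus \<gamma> i = i"
proof -
  let ?P = "{t \<in> {1..i}. c t = Plus \<or> \<sigma> t < t}" and ?M = "{t \<in> {1..i}. c t = Minus}"
  let ?F = "{t \<in> {1..i}. t < \<sigma> t \<and> \<sigma> t \<le> i}" and ?C = "{t \<in> {1..i}. i < \<sigma> t}"
  have inN: "t \<in> {1..N}" if "t \<in> {1..i}" for t using that assms by auto
  have U: "{1..i} = ?P \<union> ?M \<union> ?F \<union> ?C"
  proof (intro subset_antisym subsetI)
    fix t assume t: "t \<in> {1..i}"
    then show "t \<in> ?P \<union> ?M \<union> ?F \<union> ?C"
      using mate_eq_iff[OF inN[OF t]] sign_cases[of t] by (cases "\<sigma> t" t rule: linorder_cases) auto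
  qed auto
  have bij: "bij_betw \<sigma> {t \<in> {1..i}. \<sigma> t < t} ?F"
    by (rule bij_betw_byWitness[of _ \<sigma>]) (use mate_mate inN mate_bounds in force)+
  have m: "card {t \<in> {1..i}. c t = Minus \<or> \<sigma> t < t} = card ?M + card ?F"
  proof -
    have "{t \<in> {1..i}. c t = Minus \<or> \<sigma> t < t} = ?M \<union> {t \<in> {1..i}. \<sigma> t < t}" by auto
    moreover have "?M \<inter> {t \<in> {1..i}. \<sigma> t < t} = {}" using second_not_sign inN by blast
    ultimately show ?thesis using bij_betw_same_card[OF bij] by (simp add: card_Un_disjoint)
  qed
  have sgn: "c t = Plus \<Longrightarrow> \<sigma> t = t" "c t = Minus \<Longrightarrow> \<sigma> t = t" for t
    using mate_sign sign_cases by blast+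
  have "i = card (?P \<union> ?M \<union> ?F \<union> ?C)" using arg_cong[OF U, of card] by simp
  also have "\<dots> = card (?P \<union> ?M \<union> ?F) + card ?C"
    by (intro card_Un_disjoint) (auto dest: sgn)
  also have "card (?P \<union> ?M \<union> ?F) = card (?P \<union> ?M) + card ?F"
    by (intro card_Un_disjoint) (auto dest: sgn)
  also have "card (?P \<union> ?M) = card ?P + card ?M"
    by (intro card_Un_disjoint) (auto dest: sgn)
  finally show ?thesis
    using m clan_plus_eq[OF assms] clan_minus_eq[OF assms] unfolding crossings_def by simp
qed

lemma clan_plus_total: "clan_plus \<gamma> N = a" and clan_minus_total: "clan_minus \<gamma> N = b"
proof -
  have "{s \<in> {1..N}. N < \<sigma> s} = {}" using mate_bounds by (auto simp: not_less)
  then have "crossings N N = 0" by (simp add: crossings_def)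
  then have 1: "clan_plus \<gamma> N + clan_minus \<gamma> N = a + b" using crossings_diag[of N] N_def by simp
  have "int (count_list \<gamma> Plus) - int (count_list \<gamma> Minus) = int a - int b"
    using is_clan by (simp add: is_clan_def)
  then have "int (clan_plus \<gamma> N) - int (clan_minus \<gamma> N) = int a - int b"
    unfolding clan_plus_def clan_minus_def sign_count_def by (simp add: count_list_entry)
  then show "clan_plus \<gamma> N = a" "clan_minus \<gamma> N = b" using 1 by linarith+
qed

subsection \<open>Symmetric matchings\<close>

definition mirror_symmetric :: bool where
  "mirror_symmetric \<longleftrightarrow> (\<forall>i\<in>{1..N}. \<sigma> (N + 1 - i) = N + 1 - \<sigma> i)"

lemma numbers_symmetric_iff: "numbers_symmetric \<gamma> \<and> (\<forall>i\<in>{1..N}. \<not> is_num (c i) \<longrightarrow> \<not> is_num (c (N + 1 - i)))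
    \<longleftrightarrow> mirror_symmetric"
proof
  assume L: "numbers_symmetric \<gamma> \<and> (\<forall>i\<in>{1..N}. \<not> is_num (c i) \<longrightarrow> \<not> is_num (c (N + 1 - i)))"
  show mirror_symmetric unfolding mirror_symmetric_def
  proof
    fix i assume i: "i \<in> {1..N}"
    define k where "k = N + 1 - i"
    have k: "k \<in> {1..N}" "N + 1 - k = i" using i unfolding k_def by auto
    show "\<sigma> (N + 1 - i) = N + 1 - \<sigma> i"
    proof (cases "is_num (c i)")
      case False
      then show ?thesis using L i mate_sign by auto
    next
      case True
      from L have "\<forall>i\<in>{1..N}. is_num (c i) \<longrightarrow> is_num (c (N + 1 - i)) \<and>
          (\<forall>j\<in>{1..N}. c (N + 1 - i) = c j \<longrightarrow> c (N + 1 - j) = c i)"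
        unfolding numbers_symmetric_def Let_def length_clan by (rule conjunct1)
      from this[THEN bspec, OF i, THEN mp, OF True]
      have kn: "is_num (c k)" and *: "\<forall>j\<in>{1..N}. c k = c j \<longrightarrow> c (N + 1 - j) = c i"
        unfolding k_def by (rule conjunct1, rule conjunct2)
      have sk: "\<sigma> k \<in> {1..N}" by (rule mate_in[OF k(1)])
      have "c k = c (\<sigma> k)" using entry_mate[OF k(1)] by simp
      then have "c (N + 1 - \<sigma> k) = c i" using *[THEN bspec, OF sk] by blast
      moreover have "N + 1 - \<sigma> k \<in> {1..N}" using sk by auto
      ultimately have "N + 1 - \<sigma> k = i \<or> N + 1 - \<sigma> k = \<sigma> i"
        using mate_num(4)[OF i True] by blast
      moreover have "N + 1 - \<sigma> k \<noteq> i"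
        using mate_num(2)[OF k(1) kn] sk k i by auto
      ultimately show ?thesis using sk unfolding k_def[symmetric] by auto
    qed
  qed
next
  assume R: mirror_symmetric
  have t: "N + 1 - i \<in> {1..N}" if "i \<in> {1..N}" for i using that by auto
  have inv: "N + 1 - (N + 1 - i) = i" if "i \<in> {1..N}" for i using that by auto
  have num: "is_num (c (N + 1 - i)) \<longleftrightarrow> is_num (c i)" if i: "i \<in> {1..N}" for i
  proof -
    have "\<sigma> (N + 1 - i) = N + 1 - i \<longleftrightarrow> \<sigma> i = i"
      using R i mate_bounds[OF i] unfolding mirror_symmetric_def by auto
    then show ?thesis using mate_eq_iff[OF i] mate_eq_iff[OF t[OF i]] by blast
  qed
  have "numbers_symmetric \<gamma>"
    unfolding numbers_symmetric_def Let_def length_clan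
  proof (intro ballI impI conjI)
    fix i assume i: "i \<in> {1..N}" "is_num (c i)"
    then show n: "is_num (c (N + 1 - i))" using num by simp
    fix j assume j: "j \<in> {1..N}" "c (N + 1 - i) = c j"
    then have "j = N + 1 - i \<or> j = \<sigma> (N + 1 - i)"
      using mate_num(4)[OF t[OF i(1)] n] by simp
    then have "N + 1 - j = i \<or> N + 1 - j = \<sigma> i"
      using R i(1) inv[OF i(1)] inv[OF mate_in[OF i(1)]] unfolding mirror_symmetric_def by auto
    then show "c (N + 1 - j) = c i" using entry_mate[OF i(1)] by metis
  qed
  then show "numbers_symmetric \<gamma> \<and> (\<forall>i\<in>{1..N}. \<not> is_num (c i) \<longrightarrow> \<not> is_num (c (N + 1 - i)))"
    using num by blast
qed

text \<open>
  For \<open>j \<ge> s\<close> the difference \<open>\<gamma>(s;j) - \<gamma>(s-1;j)\<close> tells whether \<open>j < \<sigma> s\<close>, and the difference of the mirrored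
  numbers tells whether \<open>j < \<rho> s\<close> for the reflected involution \<open>\<rho> s = N + 1 - \<sigma> (N + 1 - s)\<close>. Hence
  \<open>max s (\<sigma> s) = max s (\<rho> s)\<close> for every \<open>s\<close>, and these numbers determine an involution.
\<close>

lemma mirror_symmetric_if_crossings:
  assumes cr: "\<And>i j. i \<le> j \<Longrightarrow> j \<le> N \<Longrightarrow> crossings i j = crossings (N - j) (N - i)"
  shows mirror_symmetric
proof -
  define \<rho> where "\<rho> s = N + 1 - \<sigma> (N + 1 - s)" for s
  have t: "N + 1 - i \<in> {1..N}" if "i \<in> {1..N}" for i using that by auto
  have \<rho>_in: "\<rho> i \<in> {1..N}" if "i \<in> {1..N}" for i
    using mate_bounds[OF t[OF that]] unfolding \<rho>_def by auto
  have \<rho>\<rho>: "\<rho> (\<rho> i) = i" if i: "i \<in> {1..N}" for i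
  proof -
    have "N + 1 - \<rho> i = \<sigma> (N + 1 - i)" using mate_bounds[OF t[OF i]] unfolding \<rho>_def by auto
    then have "\<rho> (\<rho> i) = N + 1 - (N + 1 - i)" unfolding \<rho>_def[of "\<rho> i"] using mate_mate[OF t[OF i]] by simp
    then show ?thesis using i by simp
  qed
  have step: "j < \<sigma> s \<longleftrightarrow> j < \<rho> s" if s: "s \<in> {1..N}" "s \<le> j" "j \<le> N" for s j
  proof -
    obtain k where k: "s = Suc k" using s by (cases s) auto
    define u where "u = \<sigma> (N + 1 - s)"
    have u: "u \<in> {1..N}" "\<sigma> u = N - k"
      using mate_in[OF t[OF s(1)]] mate_mate[OF t[OF s(1)]] k unfolding u_def by auto
    have "{x \<in> {1..N - j}. N - s < \<sigma> x} =
        {x \<in> {1..N - j}. N - k < \<sigma> x} \<union> (if u \<le> N - j then {u} else {})" (is "?L = ?R")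
    proof (intro subset_antisym subsetI)
      fix x assume x: "x \<in> ?L"
      then have "x = u" if "\<not> N - k < \<sigma> x" using mate_inj[of x u] u k that by auto
      then show "x \<in> ?R" using x by auto
    qed (use u s k in \<open>auto split: if_splits\<close>)
    then have "crossings (N - j) (N - s) = crossings (N - j) (N - k) + (if u \<le> N - j then 1 else 0)"
      unfolding crossings_def using u(2) by (auto simp: card_insert_if)
    moreover have "crossings s j = crossings k j + (if j < \<sigma> s then 1 else 0)"
      unfolding crossings_def k by (rule card_Collect_Suc)
    ultimately have "(if j < \<sigma> s then 1 else 0) = (if u \<le> N - j then 1 else (0::nat))"
      using cr[of s j] cr[of k j] s k by linarith
    moreover have "u \<le> N - j \<longleftrightarrow> j < \<rho> s" using u(1) s(3) unfolding \<rho>_def u_def by auto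
    ultimately show ?thesis by (auto split: if_splits)
  qed
  have up: "\<sigma> s = \<rho> s" if s: "s \<in> {1..N}" "s < \<sigma> s \<or> s < \<rho> s" for s
  proof (rule ccontr)
    assume ne: "\<sigma> s \<noteq> \<rho> s"
    define j where "j = max s (min (\<sigma> s) (\<rho> s))"
    have "1 \<le> \<sigma> s \<and> \<sigma> s \<le> N" "\<rho> s \<le> N" using mate_bounds[OF s(1)] \<rho>_in[OF s(1)] by auto
    then have j: "s \<le> j" "j \<le> N" using s(1) unfolding j_def by auto
    have "j < \<sigma> s \<longleftrightarrow> \<not> j < \<rho> s" using ne s(2) unfolding j_def by linarith
    then show False using step[OF s(1) j] by blast
  qed
  have eq: "\<sigma> s = \<rho> s" if s: "s \<in> {1..N}" for s
  proof (cases "s < \<sigma> s \<or> s < \<rho> s")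
    case True then show ?thesis using up s by blast
  next
    case False
    show ?thesis
    proof (rule ccontr)
      assume ne: "\<sigma> s \<noteq> \<rho> s"
      then consider "\<sigma> s < s" | "\<rho> s < s" using False by linarith
      then show False
      proof cases
        case 1
        then have "\<sigma> (\<sigma> s) = \<rho> (\<sigma> s)" using s mate_in[OF s] by (intro up) auto
        then have "\<rho> (\<rho> (\<sigma> s)) = \<rho> s" using s by simp
        then show False using \<rho>\<rho>[OF mate_in[OF s]] ne by simp
      next
        case 2
        then have "\<sigma> (\<rho> s) = \<rho> (\<rho> s)" using s \<rho>_in[OF s] \<rho>\<rho>[OF s] by (intro up) auto
        then have "\<sigma> (\<sigma> (\<rho> s)) = \<sigma> s" using \<rho>\<rho>[OF s] by simp
        then show False using mate_mate[OF \<rho>_in[OF s]] ne by simp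
      qed
    qed
  qed
  show ?thesis unfolding mirror_symmetric_def
  proof
    fix i assume i: "i \<in> {1..N}"
    show "\<sigma> (N + 1 - i) = N + 1 - \<sigma> i"
      using eq[OF i] mate_bounds[OF t[OF i]] unfolding \<rho>_def by auto
  qed
qed

text \<open>
  If \<open>k \<le> N - k\<close> is matched with its mirror position, then passing from \<open>\<gamma>(k-1;N-k+1)\<close> to \<open>\<gamma>(k;N-k)\<close>
  adds this pair only, which changes the parity.
\<close>

lemma no_mirror_pair_if_even_crossings:
  assumes ev: "\<And>i. i \<le> N - i \<Longrightarrow> even (crossings i (N - i))" and N: "even N"
  shows "no_mirror_pair \<gamma>"
proof (rule ccontr)
  assume "\<not> no_mirror_pair \<gamma>"
  then obtain i where i: "i \<in> {1..N}" "is_num (c i)" "c i = c (N + 1 - i)"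
    unfolding no_mirror_pair_def Let_def by auto
  have "N + 1 - i \<noteq> i" using N i(1) by (auto, presburger)
  moreover have "N + 1 - i \<in> {1..N}" using i(1) by auto
  ultimately have si: "\<sigma> i = N + 1 - i" using mate_num(4)[OF i(1,2) _ i(3)[symmetric]] by metis
  obtain k where k: "k \<in> {1..N}" "\<sigma> k = N + 1 - k" "k \<le> N - k"
  proof (cases "i \<le> N - i")
    case True then show thesis using that si i by blast
  next
    case False
    have "\<sigma> (N + 1 - i) = i" using si mate_mate[OF i(1)] by simp
    then show thesis using False i(1) \<open>N + 1 - i \<noteq> i\<close> by (intro that[of "N + 1 - i"]) auto
  qed
  obtain l where l: "k = Suc l" using k(1) by (cases k) auto
  have "{s \<in> {1..k}. N - k < \<sigma> s} = insert k {s \<in> {1..l}. N - l < \<sigma> s}"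
  proof (intro subset_antisym subsetI)
    fix s assume s: "s \<in> {s \<in> {1..k}. N - k < \<sigma> s}"
    show "s \<in> insert k {s \<in> {1..l}. N - l < \<sigma> s}"
    proof (cases "s = k")
      case False
      then have "\<sigma> s \<noteq> \<sigma> k" using mate_inj[of s k] s k by auto
      then show ?thesis using False s k l by auto
    qed simp
  qed (use k l in auto)
  then have "crossings k (N - k) = Suc (crossings l (N - l))"
    unfolding crossings_def using l by simp
  then show False using ev[of k] ev[of l] k l by auto
qed

end

section \<open>Symmetry of the clan of a self-orthogonal flag\<close>

locale clan_form = form_involution N M \<epsilon> H \<delta> + clan a b \<gamma> N
  for N M \<epsilon> H \<delta> a b \<gamma>
begin

context
  fixes F assumes Q: "F \<in> clan_orbit N H \<gamma>"
begin

lemma flag_complete: "F \<in> complete_flags N"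
  using Q clan_orbit_iff by blast

lemma dim_flag_plus: "i \<le> N \<Longrightarrow> cvec.dim (F i \<inter> E 1) = clan_plus \<gamma> i"
  and dim_flag_minus: "i \<le> N \<Longrightarrow> cvec.dim (F i \<inter> E (- 1)) = clan_minus \<gamma> i"
proof -
  assume i: "i \<le> N"
  have 0: "F 0 = {0}"
    using complete_flagsD[OF flag_complete, of 0] dim_eq_0_iff[of "F 0"] by simp
  then have "F 0 \<inter> E c = {0}" for c using cvec.subspace_0[OF subspace_E] by auto
  moreover have "clan_plus \<gamma> 0 = 0" "clan_minus \<gamma> 0 = 0"
    using clan_plus_eq[of 0] clan_minus_eq[of 0] by auto
  ultimately show "cvec.dim (F i \<inter> E 1) = clan_plus \<gamma> i" "cvec.dim (F i \<inter> E (- 1)) = clan_minus \<gamma> i"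
    using Q[unfolded clan_orbit_iff] i by (cases "i = 0"; simp)+
qed

lemma dim_h_flag:
  assumes "i \<le> j" "j \<le> N"
  shows "cvec.dim (sum_space (h ` F i) (F j)) = j + crossings i j"
proof -
  note F' = complete_flagsD[OF flag_complete]
  consider "i = j" | "i = 0" "i < j" | "i \<in> {1..N}" "i < j" using assms by fastforce
  then show ?thesis
  proof cases
    case 1
    have "cvec.dim (sum_space (h ` F j) (F j)) + cvec.dim {x \<in> F j. h x \<in> F j} = j + j"
      using dim_image_plus[OF mat_vec_linear F'(1,5,1,5), of j j N H] F'(3) assms by simp
    then show ?thesis
      using dim_stable_part[OF F'(1,2)[OF assms(2)]] crossings_diag[OF assms(2)]
        dim_flag_plus[OF assms(2)] dim_flag_minus[OF assms(2)] unfolding 1 by simp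
  next
    case 2
    have "F 0 = {0}" using F'[of 0] dim_eq_0_iff[of "F 0"] by simp
    then have "h ` F 0 = {0}" using cpair.linear_0[OF mat_vec_linear] by simp
    then have "sum_space (h ` F 0) (F j) = F j" by (auto simp: sum_space_def)
    then show ?thesis using 2 F'(3)[OF assms(2)] by (simp add: crossings_def)
  next
    case 3
    then show ?thesis
      using Q[unfolded clan_orbit_iff] clan_cross_eq[OF 3(2) assms(2)] assms by simp
  qed
qed

lemma even_crossings:
  assumes "F \<in> perp_flags N M" "\<epsilon> * \<delta> = - 1" "i \<le> N - i" "i \<le> N"
  shows "even (crossings i (N - i))"
proof -
  have "even ((N - i + crossings i (N - i)) + (N - i))"
    using dim_h_flag_even[OF assms(1,3,4,2)] dim_h_flag[of i "N - i"] assms(3) by (metis diff_le_self)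
  moreover have "even ((m + r) + m) \<Longrightarrow> even r" for m r :: nat by presburger
  ultimately show ?thesis by blast
qed

context
  assumes F: "F \<in> perp_flags N M"
begin

lemma flag_mirror_symmetric: mirror_symmetric
proof (rule mirror_symmetric_if_crossings)
  fix i j assume ij: "i \<le> j" "j \<le> N"
  show "crossings i j = crossings (N - j) (N - i)"
    using dim_h_flag_mirror[OF F ij] dim_h_flag[OF ij] dim_h_flag[of "N - j" "N - i"] ij by simp
qed

text \<open>
  In the equations for \<open>dim (F\<^bsub>N-i\<^esub> \<inter> E\<^sub>\<plusminus>)\<close> only the differences for successive \<open>i\<close> are used:
  they tell the sign at position \<open>i\<close> and at its mirror position.
\<close>

lemma flag_sign:
  assumes i: "i \<in> {1..N}" "\<not> is_num (c i)"
  shows "c (N + 1 - i) = (if \<delta> = 1 then c i else opposite (c i))"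
proof -
  define k where "k = N + 1 - i"
  have k: "k \<in> {1..N}" "N - (i - 1) = k" "N - i = k - 1" using i by (auto simp: k_def)
  have "\<sigma> k = k" using flag_mirror_symmetric mate_sign[OF i(2)] i(1)
    unfolding mirror_symmetric_def k_def by auto
  then have ck: "\<not> is_num (c k)" using mate_eq_iff[OF k(1)] by simp
  have incP: "clan_plus \<gamma> l = clan_plus \<gamma> (l - 1) + (if c l = Plus then 1 else 0)"
    and incM: "clan_minus \<gamma> l = clan_minus \<gamma> (l - 1) + (if c l = Minus then 1 else 0)"
    if l: "l \<in> {1..N}" "\<not> is_num (c l)" for l
  proof -
    obtain m where m: "l = Suc m" using l by (cases l) auto
    show "clan_plus \<gamma> l = clan_plus \<gamma> (l - 1) + (if c l = Plus then 1 else 0)"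
      using l clan_plus_eq[of l] clan_plus_eq[of m] mate_sign[OF l(2)]
        card_Collect_Suc[of m "\<lambda>t. c t = Plus \<or> \<sigma> t < t"] unfolding m by simp
    show "clan_minus \<gamma> l = clan_minus \<gamma> (l - 1) + (if c l = Minus then 1 else 0)"
      using l clan_minus_eq[of l] clan_minus_eq[of m] mate_sign[OF l(2)]
        card_Collect_Suc[of m "\<lambda>t. c t = Minus \<or> \<sigma> t < t"] unfolding m by simp
  qed
  have iN: "i \<le> N" "i - 1 \<le> N" and kN: "k \<le> N" "k - 1 \<le> N" using i k by auto
  show ?thesis
  proof (cases "\<delta> = 1")
    case True
    have "clan_plus \<gamma> (N - l) + l + cvec.dim (E (- 1)) = N + clan_minus \<gamma> l" if "l \<le> N" for l
      using dim_flag_E_mirror[OF F that, of 1] dim_flag_plus[of "N - l"] dim_flag_minus[OF that] True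
      by simp
    from this[OF iN(1)] this[OF iN(2)]
    have "(if c k = Plus then 1 else 0) + (if c i = Minus then 1 else 0) = (1 :: nat)"
      using incP[OF k(1) ck] incM[OF i] k i(1) by (simp split: if_splits)
    then show ?thesis using True i(2) ck sign_cases unfolding k_def[symmetric]
      by (auto split: if_splits)
  next
    case False
    then have d: "\<delta> = - 1" using delta_sign by simp
    have "clan_plus \<gamma> (N - l) + l + cvec.dim (E 1) = N + clan_plus \<gamma> l" if "l \<le> N" for l
      using dim_flag_E_mirror[OF F that, of 1] dim_flag_plus[of "N - l"] dim_flag_plus[OF that] d
      by simp
    from this[OF iN(1)] this[OF iN(2)]
    have "(if c k = Plus then 1 else 0) + (if c i = Plus then 1 else 0) = (1 :: nat)"
      using incP[OF k(1) ck] incP[OF i] k i(1) by (simp split: if_splits)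
    then show ?thesis using d i(2) ck sign_cases unfolding k_def[symmetric]
      by (auto split: if_splits)
  qed
qed

lemma numbers_symmetric_clan: "numbers_symmetric \<gamma>"
  using flag_mirror_symmetric numbers_symmetric_iff by blast

lemma symmetric_clan_of_flag: "\<delta> = 1 \<Longrightarrow> symmetric_clan \<gamma>"
  unfolding symmetric_clan_def Let_def length_clan
  using flag_sign numbers_symmetric_clan by simp

lemma skew_symmetric_clan_of_flag: "\<delta> = - 1 \<Longrightarrow> skew_symmetric_clan \<gamma>"
  unfolding skew_symmetric_clan_def Let_def length_clan
  using flag_sign numbers_symmetric_clan by simp

lemma no_mirror_pair_of_flag: "\<epsilon> * \<delta> = - 1 \<Longrightarrow> even N \<Longrightarrow> no_mirror_pair \<gamma>"
proof (rule no_mirror_pair_if_even_crossings)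
  fix i assume "\<epsilon> * \<delta> = - 1" "i \<le> N - i"
  moreover from this have "i \<le> N" by simp
  ultimately show "even (crossings i (N - i))" using even_crossings[OF F] by blast
qed

end

end

end

section \<open>Square roots of operators\<close>

lemma complex_quadratic_root:
  fixes p q r :: complex
  assumes "p \<noteq> 0 \<or> q \<noteq> 0"
  shows "\<exists>z. r + q * z + p * z * z = 0"
proof -
  have "degree [:r, q, p:] \<noteq> 0" using assms by auto
  then obtain z where "poly [:r, q, p:] z = 0"
    using fundamental_theorem_of_algebra[of "[:r, q, p:]"] by (auto simp: constant_degree)
  then show ?thesis by (intro exI[of _ z]) (simp add: algebra_simps)
qed

text \<open>
  Hensel lifting, one linear factor at a time: if \<open>r\<^sup>2 - X = m q\<close>, then
  \<open>(r + z m)\<^sup>2 - X = m (q + 2 r z + z\<^sup>2 m)\<close>, and \<open>z\<close> can be chosen such that the second factor vanishes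
  at a given \<open>l \<noteq> 0\<close>.
\<close>

lemma sqrt_of_X_mod:
  fixes m :: "complex poly"
  assumes "poly m 0 \<noteq> 0"
  shows "\<exists>r. m dvd r * r - [:0, 1:]"
  using assms
proof (induction "degree m" arbitrary: m)
  case 0
  then obtain k where k: "m = [:k:]" by (metis degree_eq_zeroE)
  then have "is_unit m" using 0 by (simp add: is_unit_const_poly_iff dvd_field_iff)
  then have "m dvd 0 * 0 - [:0, 1:]" by (rule unit_imp_dvd)
  then show ?case by blast
next
  case (Suc n)
  have "\<not> constant (poly m)" using Suc(2) by (simp add: constant_degree)
  then obtain l where l: "poly m l = 0" using fundamental_theorem_of_algebra by blast
  then obtain m' where m': "m = [:- l, 1:] * m'" using poly_eq_0_iff_dvd by (auto simp: dvd_def)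
  have "m' \<noteq> 0" using m' Suc(2) by auto
  then have "degree m = Suc (degree m')" unfolding m' by (subst degree_mult_eq) auto
  moreover have l0: "l \<noteq> 0" "poly m' 0 \<noteq> 0" using Suc(3) unfolding m' by auto
  ultimately obtain r where "m' dvd r * r - [:0, 1:]" using Suc(1)[of m'] Suc(2) by auto
  then obtain q where q: "r * r - [:0, 1:] = m' * q" by (auto simp: dvd_def)
  have "poly m' l \<noteq> 0 \<or> 2 * poly r l \<noteq> 0"
  proof (rule ccontr)
    assume "\<not> ?thesis"
    then show False using arg_cong[OF q, of "\<lambda>p. poly p l"] l0 by simp
  qed
  then obtain z where z: "poly q l + 2 * poly r l * z + poly m' l * z * z = 0"
    using complex_quadratic_root by blast
  let ?s = "q + smult (2 * z) r + smult (z * z) m'"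
  have "poly ?s l = 0" using z by (simp add: algebra_simps)
  then have "[:- l, 1:] dvd ?s" using poly_eq_0_iff_dvd by blast
  then have "[:- l, 1:] * m' dvd ?s * m'" by (intro mult_dvd_mono) auto
  also have "?s * m' = (r + smult z m') * (r + smult z m') - [:0, 1:]"
  proof -
    have "(r + smult z m') * (r + smult z m') - [:0, 1:]
        = (r * r - [:0, 1:]) + smult (2 * z) (r * m') + smult (z * z) (m' * m')"
      by (simp add: algebra_simps numeral_poly)
    then show ?thesis unfolding q by (simp add: algebra_simps)
  qed
  finally show ?case unfolding m' by blast
qed

definition polyop :: "((nat \<Rightarrow> complex) \<Rightarrow> nat \<Rightarrow> complex) \<Rightarrow> complex poly \<Rightarrow> (nat \<Rightarrow> complex) \<Rightarrow> nat \<Rightarrow> complex" where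
  "polyop A p = fold_coeffs (\<lambda>c g x. cscale c x + A (g x)) p (\<lambda>x. 0)"

context
  fixes A assumes A: "clinear A"
begin

lemma polyop_0 [simp]: "polyop A 0 x = 0"
  by (simp add: polyop_def)

lemma polyop_pCons: "polyop A (pCons k p) x = cscale k x + A (polyop A p x)"
proof (cases "k = 0 \<and> p = 0")
  case True
  then show ?thesis using cpair.linear_0[OF A] by simp
next
  case False
  then show ?thesis by (auto simp: polyop_def)
qed

lemma polyop_add: "polyop A (p + q) x = polyop A p x + polyop A q x"
proof (induction p q rule: poly_induct2)
  case 0
  show "polyop A (0 + 0) x = polyop A 0 x + polyop A 0 x" by simp
next
  case (pCons a p b q)
  have "polyop A (p + q) x = polyop A p x + polyop A q x" by (rule pCons)
  then show "polyop A (pCons a p + pCons b q) x = polyop A (pCons a p) x + polyop A (pCons b q) x"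
    by (simp add: polyop_pCons cpair.linear_add[OF A] cvec.scale_left_distrib)
qed

lemma polyop_smult: "polyop A (smult k p) x = cscale k (polyop A p x)"
proof (induction p)
  case 0
  show "polyop A (smult k 0) x = cscale k (polyop A 0 x)" by simp
next
  case (pCons a p)
  have "polyop A (smult k p) x = cscale k (polyop A p x)" by (rule pCons.IH)
  then show "polyop A (smult k (pCons a p)) x = cscale k (polyop A (pCons a p) x)"
    by (simp add: polyop_pCons cpair.linear_scale[OF A] cvec.scale_right_distrib)
qed

lemma polyop_diff: "polyop A (p - q) x = polyop A p x - polyop A q x"
  using polyop_add[of p "- q" x] polyop_smult[of "- 1" q x] by (simp add: cscale_minus_one)

lemma polyop_mult: "polyop A (p * q) x = polyop A p (polyop A q x)"
proof (induction p)
  case 0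
  show "polyop A (0 * q) x = polyop A 0 (polyop A q x)" by simp
next
  case (pCons a p)
  have "polyop A (p * q) x = polyop A p (polyop A q x)" by (rule pCons.IH)
  then show "polyop A (pCons a p * q) x = polyop A (pCons a p) (polyop A q x)"
    by (simp add: polyop_pCons polyop_add polyop_smult)
qed

lemma polyop_linear: "clinear (polyop A p)"
proof (induction p)
  case 0
  show "clinear (polyop A 0)" unfolding clinear_iff by simp
next
  case (pCons k p)
  then show ?case
    using A unfolding clinear_iff by (simp add: polyop_pCons cvec.scale_right_distrib mult.commute)
qed

lemma polyop_dvd: "m dvd p \<Longrightarrow> polyop A m x = 0 \<Longrightarrow> polyop A p x = 0"
  using polyop_mult[of _ m x] cpair.linear_0[OF polyop_linear] by (auto simp: dvd_def mult.commute)

lemma polyop_monom: "polyop A (monom k n) x = cscale k ((A ^^ n) x)"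
proof (induction n)
  case 0
  show "polyop A (monom k 0) x = cscale k ((A ^^ 0) x)"
    by (simp add: monom_0 polyop_pCons cpair.linear_0[OF A])
next
  case (Suc n)
  have "polyop A (monom k n) x = cscale k ((A ^^ n) x)" by (rule Suc.IH)
  then show "polyop A (monom k (Suc n)) x = cscale k ((A ^^ Suc n) x)"
    by (simp add: monom_Suc polyop_pCons cpair.linear_scale[OF A])
qed

lemma polyop_sum: "polyop A (sum p I) x = (\<Sum>i\<in>I. polyop A (p i) x)"
  by (rule Modules.additive.sum[of "\<lambda>p. polyop A p x"]) (simp add: Modules.additive_def polyop_add)

lemma polyop_in:
  assumes "\<And>x. x \<in> coord_space N \<Longrightarrow> A x \<in> coord_space N" "x \<in> coord_space N"
  shows "polyop A p x \<in> coord_space N"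
  using assms by (induction p) (simp_all add: polyop_pCons cvec.subspace_add cvec.subspace_scale cvec.subspace_0)

text \<open>
  The vectors \<open>x, A x, \<dots>, A\<^sup>N x\<close> are linearly dependent. If \<open>A\<close> is injective, then factors \<open>X\<close> of an
  annihilating polynomial can be cancelled.
\<close>

lemma annihilating_poly:
  assumes AV: "\<And>x. x \<in> coord_space N \<Longrightarrow> A x \<in> coord_space N" and x: "x \<in> coord_space N"
    and inj: "\<And>x. x \<in> coord_space N \<Longrightarrow> A x = 0 \<Longrightarrow> x = 0"
  shows "\<exists>m. poly m 0 \<noteq> 0 \<and> polyop A m x = 0"
proof -
  define \<Phi> where "\<Phi> k = (\<Sum>i\<in>{1..Suc N}. cscale (k i) ((A ^^ i) x))" for k :: "nat \<Rightarrow> complex"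
  have pow: "(A ^^ i) x \<in> coord_space N" for i by (induction i) (simp_all add: x AV)
  have lin: "clinear \<Phi>"
    unfolding clinear_iff \<Phi>_def
    by (simp add: cvec.scale_left_distrib sum.distrib cvec.scale_sum_right cscale_apply del: sum.cl_ivl_Suc)
  have "\<Phi> ` coord_space (Suc N) \<subseteq> coord_space N"
    unfolding \<Phi>_def using pow
    by (intro image_subsetI cvec.subspace_sum cvec.subspace_scale subspace_coord_space)
  then have "cvec.dim (\<Phi> ` coord_space (Suc N)) \<le> N" by (rule dim_le_coord)
  then have "cvec.dim {k \<in> coord_space (Suc N). \<Phi> k = 0} \<noteq> 0"
    using rank_nullity[OF lin subspace_coord_space fin_dim_coord_space[OF subset_refl], of "Suc N"] by simp
  then have "{k \<in> coord_space (Suc N). \<Phi> k = 0} \<noteq> {0}" using dim_zero_space by metis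
  moreover have "0 \<in> {k \<in> coord_space (Suc N). \<Phi> k = 0}"
    using cpair.linear_0[OF lin] cvec.subspace_0[OF subspace_coord_space] by blast
  ultimately obtain k where k: "k \<in> coord_space (Suc N)" "\<Phi> k = 0" "k \<noteq> 0" by blast
  define m where "m = (\<Sum>i\<in>{1..Suc N}. monom (k i) i)"
  have "polyop A m x = 0" using k(2) unfolding m_def \<Phi>_def by (simp only: polyop_sum polyop_monom)
  moreover have "m \<noteq> 0"
  proof
    assume "m = 0"
    have "k i = 0" for i
    proof (cases "i \<in> {1..Suc N}")
      case True
      have "coeff m i = (\<Sum>l\<in>{1..Suc N}. if l = i then k l else 0)"
        unfolding m_def coeff_sum by (intro sum.cong) auto
      also have "\<dots> = k i" using True by simp
      finally show ?thesis using \<open>m = 0\<close> by simp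
    qed (use k(1) in \<open>auto simp: coord_space_def\<close>)
    then show False using k(3) by auto
  qed
  ultimately show ?thesis
  proof (induction m)
    case (pCons e p)
    show ?case
    proof (cases "e = 0")
      case True
      have "polyop A (pCons e p) x = 0" by (rule pCons.prems(1))
      then have "A (polyop A p x) = 0" using True by (simp add: polyop_pCons)
      then have "polyop A p x = 0" using inj polyop_in[OF AV x] by blast
      moreover have "p \<noteq> 0" using pCons.prems(2) True by auto
      ultimately show ?thesis by (rule pCons.IH)
    next
      case False
      then show ?thesis using pCons.prems by (intro exI[of _ "pCons e p"]) simp
    qed
  qed simp
qed

lemma operator_sqrt:
  assumes AV: "\<And>x. x \<in> coord_space N \<Longrightarrow> A x \<in> coord_space N"
    and inj: "\<And>x. x \<in> coord_space N \<Longrightarrow> A x = 0 \<Longrightarrow> x = 0"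
  shows "\<exists>r. \<forall>x\<in>coord_space N. polyop A r (polyop A r x) = A x"
proof -
  have "\<forall>k\<in>{1..N}. \<exists>m. poly m 0 \<noteq> 0 \<and> polyop A m (unit_vec k) = 0"
    by (intro ballI annihilating_poly[OF AV unit_vec_in_coord_space inj])
  then obtain m where m: "\<And>k. k \<in> {1..N} \<Longrightarrow> poly (m k) 0 \<noteq> 0 \<and> polyop A (m k) (unit_vec k) = 0"
    by metis
  define M where "M = (\<Prod>k\<in>{1..N}. m k)"
  have "poly M 0 \<noteq> 0" unfolding M_def poly_prod using m by simp
  then obtain r where r: "M dvd r * r - [:0, 1:]" using sqrt_of_X_mod by blast
  have "polyop A (r * r - [:0, 1:]) x = 0" if x: "x \<in> coord_space N" for x
  proof (rule cpair.linear_eq_0_on_span[OF polyop_linear, where b = "unit_vec ` {1..N}"])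
    fix y assume "y \<in> unit_vec ` {1..N}"
    then obtain k where k: "k \<in> {1..N}" "y = unit_vec k" by blast
    then have "m k dvd r * r - [:0, 1:]"
      using r unfolding M_def by (meson dvd_prodI dvd_trans finite_atLeastAtMost)
    then show "polyop A (r * r - [:0, 1:]) y = 0" using polyop_dvd m k by blast
  qed (use x span_unit_vec in simp)
  then show ?thesis
    by (auto simp: polyop_diff polyop_mult polyop_pCons cpair.linear_0[OF A])
qed

end

section \<open>Self-orthogonal flags with a given symmetric clan\<close>

lemma (in form_space) bilin_eq_on_span:
  assumes "clinear f" "clinear g" "clinear f'" "clinear g'"
    and eq: "\<And>x y. x \<in> S \<Longrightarrow> y \<in> S \<Longrightarrow> B (f x) (g y) = B (f' x) (g' y)"
    and xy: "x \<in> cvec.span S" "y \<in> cvec.span S"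
  shows "B (f x) (g y) = B (f' x) (g' y)"
proof -
  have lin: "\<phi> (u + v) = \<phi> u + \<phi> v" "\<phi> (cscale k u) = cscale k (\<phi> u)" "\<phi> 0 = 0"
    if "clinear \<phi>" for \<phi> k u v using that cpair.linear_0 unfolding clinear_iff by auto
  have *: "B (f u) (g y) = B (f' u) (g' y)" if u: "u \<in> S" for u
  proof -
    have "cvec.subspace {y. B (f u) (g y) = B (f' u) (g' y)}"
      unfolding cvec.subspace_def using lin[OF assms(2)] lin[OF assms(4)] by (auto simp: bilin_simps)
    then have "cvec.span S \<subseteq> {y. B (f u) (g y) = B (f' u) (g' y)}"
      using eq[OF u] by (intro cvec.span_minimal) auto
    then show ?thesis using xy(2) by blast
  qed
  have "cvec.subspace {x. B (f x) (g y) = B (f' x) (g' y)}"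
    unfolding cvec.subspace_def using lin[OF assms(1)] lin[OF assms(3)] by (auto simp: bilin_simps)
  then have "cvec.span S \<subseteq> {x. B (f x) (g y) = B (f' x) (g' y)}"
    using * by (intro cvec.span_minimal) auto
  then show ?thesis using xy(1) by blast
qed

lemma (in form_space) dual_basis:
  assumes inj: "inj_on u {1..N}" and ind: "cvec.independent (u ` {1..N})" and sp: "cvec.span (u ` {1..N}) = V"
  shows "\<exists>w. \<forall>i\<in>{1..N}. w i \<in> V \<and> (\<forall>j\<in>{1..N}. B (w i) (u j) = (if j = i then 1 else 0))"
proof -
  have "\<exists>w. w \<in> V \<and> (\<forall>j\<in>{1..N}. B w (u j) = (if j = i then 1 else 0))" if i: "i \<in> {1..N}" for i
  proof -
    let ?S = "cvec.span (u ` ({1..N} - {i}))"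
    have S: "?S \<subseteq> V" using sp cvec.span_mono[of "u ` ({1..N} - {i})" "u ` {1..N}"] by auto
    have "cvec.dim ?S = N - 1" using dim_span_image[OF inj ind, of "{1..N} - {i}"] i by simp
    then have "cvec.dim (orth ?S) \<noteq> 0" using dim_orth[OF cvec.subspace_span S] i by auto
    then have "orth ?S \<noteq> {0}" using dim_zero_space by metis
    then obtain w where w: "w \<in> orth ?S" "w \<noteq> 0" using cvec.subspace_0[OF subspace_perp] by blast
    then have wV: "w \<in> V" by (simp add: perp_def)
    have z: "B w (u j) = 0" if "j \<in> {1..N}" "j \<noteq> i" for j
    proof -
      have "u j \<in> ?S" using that by (intro cvec.span_base) auto
      then show ?thesis using w(1) B_swap_zero by (auto simp: perp_def)
    qed
    have nz: "B w (u i) \<noteq> 0"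
    proof
      assume "B w (u i) = 0"
      then have "\<forall>x\<in>u ` {1..N}. B x w = 0" using z B_swap_zero by (metis imageE)
      then have "w \<in> orth V" unfolding sp[symmetric] perp_span using wV by (simp add: perp_def)
      then show False using nondegenerate_right[OF wV] w(2) by (auto simp: perp_def)
    qed
    show ?thesis
    proof (intro exI conjI ballI)
      show "cscale (1 / B w (u i)) w \<in> V" using wV by (simp add: cvec.subspace_scale)
      fix j assume "j \<in> {1..N}"
      then show "B (cscale (1 / B w (u i)) w) (u j) = (if j = i then 1 else 0)"
        using z nz by (simp add: bilin_simps)
    qed
  qed
  then show ?thesis by metis
qed

text \<open>
  Polynomials in \<open>A\<close> inherit self-adjointness, and they commute with whatever commutes with \<open>A\<close>. This is why
  the square root is taken among them.
\<close>

lemma (in form_involution) self_adjoint_sqrt: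
  assumes A: "clinear A" and AV: "\<And>x. x \<in> V \<Longrightarrow> A x \<in> V"
    and self: "\<And>x y. x \<in> V \<Longrightarrow> y \<in> V \<Longrightarrow> B (A x) y = B x (A y)"
    and comm: "\<And>x. x \<in> V \<Longrightarrow> A (h x) = h (A x)"
    and inj: "\<And>x. x \<in> V \<Longrightarrow> A x = 0 \<Longrightarrow> x = 0"
  shows "\<exists>K. clinear K \<and> (\<forall>x\<in>V. K x \<in> V \<and> (K x = 0 \<longrightarrow> x = 0) \<and> h (K x) = K (h x)) \<and>
    (\<forall>x\<in>V. \<forall>y\<in>V. B (K x) (K y) = B (A x) y)"
proof -
  obtain r where r: "\<And>x. x \<in> V \<Longrightarrow> polyop A r (polyop A r x) = A x"
    using operator_sqrt[OF A AV inj] by blast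
  define K where "K = polyop A r"
  have K: "clinear K" unfolding K_def by (rule polyop_linear[OF A])
  have KV: "K x \<in> V" if "x \<in> V" for x unfolding K_def by (rule polyop_in[OF A AV that])
  have Kh: "h (K x) = K (h x)" if x: "x \<in> V" for x
  proof -
    have "h (polyop A p x) = polyop A p (h x)" for p
    proof (induction p)
      case 0
      show "h (polyop A 0 x) = polyop A 0 (h x)"
        by (simp add: polyop_0[OF A] cpair.linear_0[OF mat_vec_linear])
    next
      case (pCons k p)
      have "h (polyop A p x) = polyop A p (h x)" by (rule pCons.IH)
      then have "h (A (polyop A p x)) = A (polyop A p (h x))"
        using comm[OF polyop_in[OF A AV x], of p] by simp
      then show "h (polyop A (pCons k p) x) = polyop A (pCons k p) (h x)"
        by (simp add: polyop_pCons[OF A] h_add h_scale)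
    qed
    then show ?thesis unfolding K_def .
  qed
  have Kself: "B (K x) y = B x (K y)" if x: "x \<in> V" and y: "y \<in> V" for x y
  proof -
    have "B (polyop A p x) y = B x (polyop A p y)" for p
      using y
    proof (induction p arbitrary: y)
      case (pCons k p)
      have *: "polyop A p (A y) = A (polyop A p y)" for y
        using polyop_mult[OF A, of p "[:0,1:]" y] polyop_mult[OF A, of "[:0,1:]" p y]
        by (simp add: polyop_pCons[OF A] polyop_0[OF A] mult.commute cpair.linear_0[OF A])
      have "B (A (polyop A p x)) y = B x (A (polyop A p y))"
        using self[OF polyop_in[OF A AV x] pCons.prems] pCons.IH[OF AV[OF pCons.prems]] * by simp
      then show "B (polyop A (pCons k p) x) y = B x (polyop A (pCons k p) y)"
        by (simp add: polyop_pCons[OF A] bilin_simps)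
    next
      case 0
      show "B (polyop A 0 x) y = B x (polyop A 0 y)" by (simp add: polyop_0[OF A])
    qed
    then show ?thesis unfolding K_def .
  qed
  have Kinj: "x = 0" if "x \<in> V" "K x = 0" for x
    using inj[OF that(1)] r[OF that(1)] that(2) cpair.linear_0[OF K] unfolding K_def by simp
  have "B (K x) (K y) = B (A x) y" if "x \<in> V" "y \<in> V" for x y
    using Kself[OF KV[OF that(1)] that(2)] r[OF that(1)] unfolding K_def by simp
  then show ?thesis using K KV Kinj Kh by blast
qed

context clan_form
begin

definition mate_sign_factor :: "nat \<Rightarrow> complex" ("\<eta>") where
  "\<eta> i = (if c i = Minus then - 1 else 1)"

lemma eta_sq: "\<eta> i * \<eta> i = 1" by (simp add: mate_sign_factor_def)

lemma eta_mate: "i \<in> {1..N} \<Longrightarrow> \<eta> (\<sigma> i) = \<eta> i"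
  using entry_mate[of i] by (simp add: mate_sign_factor_def)

text \<open>
  A basis of \<open>E\<^sub>+\<close> indexed by the \<open>+\<close> signs and pairs, and one of \<open>E\<^sub>-\<close> indexed by the \<open>-\<close> signs and
  pairs, combine to a basis of \<open>V\<close> which \<open>h\<close> permutes by \<open>\<sigma>\<close> up to sign: the two positions of a pair
  carry \<open>x + y\<close> and \<open>x - y\<close>.
\<close>

lemma basis_permuted_by_mate:
  assumes dimE: "cvec.dim (E 1) = a"
  shows "\<exists>u. inj_on u {1..N} \<and> cvec.independent (u ` {1..N}) \<and> cvec.span (u ` {1..N}) = V \<and>
    (\<forall>i\<in>{1..N}. h (u i) = cscale (\<eta> i) (u (\<sigma> i)))"
proof -
  let ?P = "\<lambda>sg. {t \<in> {1..N}. c t = sg \<or> t < \<sigma> t}" and ?R = "\<lambda>sg. {t \<in> {1..N}. c t = sg \<or> \<sigma> t < t}"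
  have basis: "\<exists>f. f ` ?P sg \<subseteq> E k \<and> cvec.span (f ` ?P sg) = E k"
    if k: "card (?R sg) = cvec.dim (E k)" and sg: "sg = Plus \<or> sg = Minus" for sg k
  proof -
    have fixed: "\<sigma> t = t" if "c t = sg" for t using that sg mate_sign sign_cases by blast
    have "bij_betw \<sigma> (?P sg) (?R sg)"
    proof (rule bij_betw_byWitness[of _ \<sigma>])
      show "\<sigma> ` ?P sg \<subseteq> ?R sg"
        using mate_bounds by fastforce
      show "\<sigma> ` ?R sg \<subseteq> ?P sg"
        using mate_bounds by fastforce
    qed auto
    from bij_betw_same_card[OF this] k
    have card: "card (?P sg) = cvec.dim (E k)" by (rule trans)
    obtain C where C: "finite C" "cvec.span C = E k" "card C = cvec.dim (E k)"
      using subspace_basis[OF subspace_E fin_dim_sub[OF E_sub], of k] by metis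
    then obtain f where "bij_betw f (?P sg) C"
      using finite_same_card_bij[of "?P sg" C] card by auto
    then have "f ` ?P sg = C" by (simp add: bij_betw_def)
    then show ?thesis using C(2) cvec.span_superset[of C] by (intro exI[of _ f]) simp
  qed
  have "cvec.dim (E (- 1)) = b" using dim_E_sum dimE N_def by simp
  then obtain f g where
    f: "f ` ?P Plus \<subseteq> E 1" "cvec.span (f ` ?P Plus) = E 1" and
    g: "g ` ?P Minus \<subseteq> E (- 1)" "cvec.span (g ` ?P Minus) = E (- 1)"
    using basis[of Plus 1] basis[of Minus "- 1"] dimE clan_plus_eq[of N] clan_minus_eq[of N]
      clan_plus_total clan_minus_total by auto
  have hf: "h (f t) = f t" if "t \<in> {1..N}" "c t = Plus \<or> t < \<sigma> t" for t
    using f(1) that by (auto simp: in_E)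
  have hg: "h (g t) = - g t" if "t \<in> {1..N}" "c t = Minus \<or> t < \<sigma> t" for t
    using g(1) that by (auto simp: in_E cscale_minus_one)
  have fV: "f t \<in> V" if "t \<in> {1..N}" "c t = Plus \<or> t < \<sigma> t" for t
    using f(1) that by (auto simp: in_E)
  have gV: "g t \<in> V" if "t \<in> {1..N}" "c t = Minus \<or> t < \<sigma> t" for t
    using g(1) that by (auto simp: in_E)
  define u where "u i = (if c i = Plus then f i else if c i = Minus then g i
    else if i < \<sigma> i then f i + g i else f (\<sigma> i) - g (\<sigma> i))" for i
  have kinds: "c i = Plus \<or> c i = Minus \<or> (i < \<sigma> i \<and> c i \<noteq> Plus \<and> c i \<noteq> Minus) \<or>
      (\<sigma> i < i \<and> c i \<noteq> Plus \<and> c i \<noteq> Minus)" if "i \<in> {1..N}" for i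
    using that mate_eq_iff[OF that] sign_cases[of i] by (metis linorder_neqE_nat)
  have uV: "u i \<in> V" if i: "i \<in> {1..N}" for i
    using kinds[OF i] i mate_in[OF i] mate_mate[OF i] fV gV unfolding u_def
    by (auto intro!: cvec.subspace_add cvec.subspace_diff)
  have hu: "h (u i) = cscale (\<eta> i) (u (\<sigma> i))" if i: "i \<in> {1..N}" for i
  proof -
    consider "c i = Plus" | "c i = Minus" | "i < \<sigma> i" "c i \<noteq> Plus" "c i \<noteq> Minus" | "\<sigma> i < i" "c i \<noteq> Plus" "c i \<noteq> Minus"
      using kinds[OF i] by blast
    then show ?thesis
    proof cases
      case 1
      then have "\<sigma> i = i" using mate_sign sign_cases by blast
      then show ?thesis using 1 hf[OF i] unfolding u_def mate_sign_factor_def by simp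
    next
      case 2
      then have "\<sigma> i = i" using mate_sign sign_cases by blast
      then show ?thesis using 2 hg[OF i] unfolding u_def mate_sign_factor_def by (simp add: cscale_minus_one)
    next
      case 3
      then show ?thesis using hf[OF i] hg[OF i] entry_mate[OF i] mate_mate[OF i]
        unfolding u_def mate_sign_factor_def by (simp add: h_add)
    next
      case 4
      then show ?thesis using hf[OF mate_in[OF i]] hg[OF mate_in[OF i]] entry_mate[OF i] mate_mate[OF i]
        unfolding u_def mate_sign_factor_def by (simp add: h_diff)
    qed
  qed
  let ?U = "cvec.span (u ` {1..N})"
  have sp: "?U = V"
  proof
    show "?U \<subseteq> V" using uV by (intro cvec.span_minimal) auto
    have ub: "u t \<in> ?U" if "t \<in> {1..N}" for t using that by (intro cvec.span_base) auto
    have pair: "f t \<in> ?U \<and> g t \<in> ?U" if t: "t \<in> {1..N}" "t < \<sigma> t" for t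
    proof -
      have ns: "c t \<noteq> Plus" "c t \<noteq> Minus" using t mate_sign sign_cases by fastforce+
      then have "u t = f t + g t" "u (\<sigma> t) = f t - g t"
        using t entry_mate[OF t(1)] mate_mate[OF t(1)] unfolding u_def by auto
      then have "f t = cscale (1/2) (u t + u (\<sigma> t))" "g t = cscale (1/2) (u t - u (\<sigma> t))"
        by (auto simp: fun_eq_iff cscale_apply)
      then show ?thesis
        using ub[OF t(1)] ub[OF mate_in[OF t(1)]] by (metis cvec.span_add cvec.span_diff cvec.span_scale)
    qed
    have "f ` ?P Plus \<subseteq> ?U"
    proof (rule image_subsetI)
      fix t assume t: "t \<in> ?P Plus"
      then show "f t \<in> ?U"
        using pair ub[of t] by (cases "c t = Plus") (auto simp: u_def)
    qed
    then have 1: "E 1 \<subseteq> ?U"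
      unfolding f(2)[symmetric] by (intro cvec.span_minimal) auto
    have "g ` ?P Minus \<subseteq> ?U"
    proof (rule image_subsetI)
      fix t assume t: "t \<in> ?P Minus"
      then show "g t \<in> ?U"
        using pair ub[of t] by (cases "c t = Minus") (auto simp: u_def)
    qed
    then have 2: "E (- 1) \<subseteq> ?U"
      unfolding g(2)[symmetric] by (intro cvec.span_minimal) auto
    show "V \<subseteq> ?U"
    proof
      fix x assume "x \<in> V"
      then obtain y z where "y \<in> E 1" "z \<in> E (- 1)" "x = y + z" using decompose by blast
      then show "x \<in> ?U" using 1 2 by (auto intro: cvec.span_add)
    qed
  qed
  moreover have "inj_on u {1..N}" "cvec.independent (u ` {1..N})"
    using independent_image_if_span[of "{1..N}" V u] sp by simp_all
  ultimately show ?thesis using hu by blast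
qed

text \<open>
  The numbers \<open>d i\<close> prescribe a second form with \<open>B' (u i) (u j) = d i\<close> if \<open>j\<close> mirrors \<open>i\<close> and \<open>0\<close>
  otherwise. It is \<open>B' x y = B (A x) y\<close>; the second condition on \<open>d\<close> makes \<open>A\<close> self-adjoint, and the third one
  makes \<open>A\<close> commute with \<open>h\<close>. With a square root \<open>K\<close> of \<open>A\<close>, the vectors \<open>v i = K (u i)\<close> have the desired
  relations to both \<open>h\<close> and \<open>B\<close>.
\<close>

lemma adapted_basis:
  assumes dimE: "cvec.dim (E 1) = a" and sym: mirror_symmetric
    and d: "\<And>i. i \<in> {1..N} \<Longrightarrow> d i \<noteq> 0" "\<And>i. i \<in> {1..N} \<Longrightarrow> d (N + 1 - i) = \<epsilon> * d i"
      "\<And>i. i \<in> {1..N} \<Longrightarrow> \<eta> i * d (\<sigma> i) = \<delta> * \<eta> (N + 1 - i) * d i"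
  shows "\<exists>v. inj_on v {1..N} \<and> cvec.independent (v ` {1..N}) \<and> cvec.span (v ` {1..N}) = V \<and>
    (\<forall>i\<in>{1..N}. h (v i) = cscale (\<eta> i) (v (\<sigma> i))) \<and>
    (\<forall>i\<in>{1..N}. \<forall>j\<in>{1..N}. j \<noteq> N + 1 - i \<longrightarrow> B (v i) (v j) = 0)"
proof -
  obtain u where u: "inj_on u {1..N}" "cvec.independent (u ` {1..N})" "cvec.span (u ` {1..N}) = V"
    and hu: "\<And>i. i \<in> {1..N} \<Longrightarrow> h (u i) = cscale (\<eta> i) (u (\<sigma> i))"
    using basis_permuted_by_mate[OF dimE] by blast
  obtain w where wV: "\<And>i. i \<in> {1..N} \<Longrightarrow> w i \<in> V"
    and w: "\<And>i j. i \<in> {1..N} \<Longrightarrow> j \<in> {1..N} \<Longrightarrow> B (w i) (u j) = (if j = i then 1 else 0)"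
    using dual_basis[OF u] by metis
  have t: "N + 1 - i \<in> {1..N}" if "i \<in> {1..N}" for i using that by auto
  have tt: "j = N + 1 - i \<longleftrightarrow> i = N + 1 - j" if "i \<in> {1..N}" "j \<in> {1..N}" for i j using that by auto
  obtain A where A: "clinear A"
    "\<And>x. x \<in> u ` {1..N} \<Longrightarrow> A x = (let i = inv_into {1..N} u x in cscale (d i) (w (N + 1 - i)))"
    using cpair.linear_independent_extend[OF u(2), of "\<lambda>x. let i = inv_into {1..N} u x in cscale (d i) (w (N + 1 - i))"]
    by metis
  have Au: "A (u i) = cscale (d i) (w (N + 1 - i))" if "i \<in> {1..N}" for i
    using A(2)[of "u i"] that inv_into_f_f[OF u(1) that] by (simp add: Let_def)
  have BA: "B (A (u i)) (u j) = (if j = N + 1 - i then d i else 0)" if "i \<in> {1..N}" "j \<in> {1..N}" for i j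
    using that w[OF t[OF that(1)] that(2)] by (simp add: Au bilin_simps)
  have uV: "u i \<in> V" if "i \<in> {1..N}" for i using u(3) cvec.span_base[of "u i" "u ` {1..N}"] that by auto
  have AV: "A x \<in> V" if "x \<in> V" for x
  proof -
    have "A ` V = cvec.span (A ` u ` {1..N})" using cpair.linear_span_image[OF A(1)] u(3) by metis
    also have "\<dots> \<subseteq> V" using Au wV t by (intro cvec.span_minimal) (auto intro!: cvec.subspace_scale)
    finally show ?thesis using that by blast
  qed
  have idl: "clinear (\<lambda>x. x)" by (simp add: clinear_iff)
  have self: "B (A x) y = B x (A y)" if "x \<in> V" "y \<in> V" for x y
  proof (rule bilin_eq_on_span[OF A(1) idl idl A(1), where S = "u ` {1..N}"])
    fix x y assume "x \<in> u ` {1..N}" "y \<in> u ` {1..N}"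
    then obtain i j where ij: "i \<in> {1..N}" "x = u i" "j \<in> {1..N}" "y = u j" by blast
    have "B (u i) (A (u j)) = \<epsilon> * (if i = N + 1 - j then d j else 0)"
      using B_swap[of "u i" "A (u j)"] BA[OF ij(3,1)] by simp
    also have "\<dots> = (if j = N + 1 - i then d i else 0)"
      using tt[OF ij(1,3)] d(2)[OF ij(3)] by auto
    finally show "B (A x) y = B x (A y)" using BA[OF ij(1,3)] ij by simp
  qed (use that u(3) in auto)
  have comm: "A (h x) = h (A x)" if x: "x \<in> V" for x
  proof -
    have "B (A (h x)) y = B (h (A x)) y" if y: "y \<in> V" for y
    proof (rule bilin_eq_on_span[where S = "u ` {1..N}" and f = "\<lambda>x. A (h x)" and f' = "\<lambda>x. h (A x)", OF _ idl _ idl])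
      show "clinear (\<lambda>x. A (h x))" "clinear (\<lambda>x. h (A x))"
        using A(1) unfolding clinear_iff by (simp_all add: h_add h_scale)
      fix x y assume "x \<in> u ` {1..N}" "y \<in> u ` {1..N}"
      then obtain i j where ij: "i \<in> {1..N}" "x = u i" "j \<in> {1..N}" "y = u j" by blast
      have s: "\<sigma> (N + 1 - i) = N + 1 - \<sigma> i" using sym ij(1) unfolding mirror_symmetric_def by blast
      have "B (A (h (u i))) (u j) = \<eta> i * B (A (u (\<sigma> i))) (u j)"
        using hu[OF ij(1)] cpair.linear_scale[OF A(1)] by (simp add: bilin_simps)
      also have "\<dots> = (if j = N + 1 - \<sigma> i then \<eta> i * d (\<sigma> i) else 0)"
        using BA[OF mate_in[OF ij(1)] ij(3)] by simp
      finally have 1: "B (A (h (u i))) (u j) = (if j = N + 1 - \<sigma> i then \<eta> i * d (\<sigma> i) else 0)" .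
      have "B (h (A (u i))) (u j) = \<delta> * B (A (u i)) (h (u j))"
        using h_adjoint[OF AV uV] uV ij by blast
      also have "\<dots> = \<delta> * \<eta> j * B (A (u i)) (u (\<sigma> j))"
        using hu[OF ij(3)] by (simp add: bilin_simps)
      also have "\<dots> = (if \<sigma> j = N + 1 - i then \<delta> * \<eta> j * d i else 0)"
        using BA[OF ij(1) mate_in[OF ij(3)]] by simp
      finally have 2: "B (h (A (u i))) (u j) = (if \<sigma> j = N + 1 - i then \<delta> * \<eta> j * d i else 0)" .
      have eq: "\<sigma> j = N + 1 - i \<longleftrightarrow> j = N + 1 - \<sigma> i"
        using s mate_mate[OF ij(3)] mate_mate[OF t[OF ij(1)]] by metis
      have "\<eta> i * d (\<sigma> i) = \<delta> * \<eta> j * d i" if j: "j = N + 1 - \<sigma> i"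
      proof -
        have "\<eta> j = \<eta> (N + 1 - i)" using eta_mate[OF t[OF ij(1)]] s j by simp
        then show ?thesis using d(3)[OF ij(1)] by simp
      qed
      then show "B (A (h x)) y = B (h (A x)) y" using 1 2 eq ij by simp
    qed (use x y u(3) in auto)
    then have "A (h x) - h (A x) = 0"
      using x AV by (intro nondegenerate) (auto simp: bilin_simps cvec.subspace_diff)
    then show ?thesis by simp
  qed
  have inj: "x = 0" if x: "x \<in> V" "A x = 0" for x
  proof -
    have Bw: "B (w k) x = 0" if k: "k \<in> {1..N}" for k
    proof -
      have "B x (A (u (N + 1 - k))) = 0" using self[OF x(1) uV[OF t[OF k]]] x(2) by simp
      moreover have "N + 1 - (N + 1 - k) = k" using k by auto
      ultimately have "B x (w k) = 0" using Au[OF t[OF k]] d(1)[OF t[OF k]] by (simp add: bilin_simps)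
      then show ?thesis using B_swap_zero by blast
    qed
    have "x = (\<Sum>k\<in>{1..N}. cscale (B (w k) x) (u k))"
    proof (rule cpair.linear_eq_on[OF idl, where B = "u ` {1..N}"])
      show "clinear (\<lambda>x. \<Sum>k\<in>{1..N}. cscale (B (w k) x) (u k))"
        unfolding clinear_iff
        by (simp add: bilin_simps cvec.scale_left_distrib sum.distrib cvec.scale_sum_right)
      fix y assume "y \<in> u ` {1..N}"
      then obtain j where j: "j \<in> {1..N}" "y = u j" by blast
      have "(\<Sum>k\<in>{1..N}. cscale (B (w k) y) (u k)) = (\<Sum>k\<in>{1..N}. if k = j then u k else 0)"
        using w j by (intro sum.cong) auto
      also have "\<dots> = u j" using j(1) by simp
      finally show "y = (\<Sum>k\<in>{1..N}. cscale (B (w k) y) (u k))" using j by simp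
    qed (use x u(3) in simp)
    also have "\<dots> = 0" using Bw by (intro sum.neutral) auto
    finally show ?thesis .
  qed
  obtain K where K: "clinear K" and KV: "\<And>x. x \<in> V \<Longrightarrow> K x \<in> V"
    and Kinj: "\<And>x. x \<in> V \<Longrightarrow> K x = 0 \<Longrightarrow> x = 0" and Kh: "\<And>x. x \<in> V \<Longrightarrow> h (K x) = K (h x)"
    and BK: "\<And>x y. x \<in> V \<Longrightarrow> y \<in> V \<Longrightarrow> B (K x) (K y) = B (A x) y"
    using self_adjoint_sqrt[OF A(1) AV self comm inj] by blast
  define v where "v i = K (u i)" for i
  have sp: "cvec.span (v ` {1..N}) = V"
  proof -
    have "cvec.span (v ` {1..N}) = K ` V"
      using cpair.linear_span_image[OF K, of "u ` {1..N}"] u(3) by (simp add: v_def image_image)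
    moreover have "K ` V = V"
      using KV dim_injective_image[OF K subspace_coord_space fin_dim_sub[OF subset_refl] Kinj]
        cpair.linear_subspace_image[OF K subspace_coord_space]
      by (intro dim_eq_imp_eq fin_dim_sub) auto
    ultimately show ?thesis by simp
  qed
  have "inj_on v {1..N}" "cvec.independent (v ` {1..N})"
    using independent_image_if_span[of "{1..N}" V v] sp by simp_all
  moreover have "h (v i) = cscale (\<eta> i) (v (\<sigma> i))" if "i \<in> {1..N}" for i
    using Kh[OF uV[OF that]] hu[OF that] cpair.linear_scale[OF K] by (simp add: v_def)
  moreover have "B (v i) (v j) = 0" if "i \<in> {1..N}" "j \<in> {1..N}" "j \<noteq> N + 1 - i" for i j
  proof -
    show ?thesis using BK[OF uV[OF that(1)] uV[OF that(2)]] BA[OF that(1,2)] that(3) by (simp add: v_def)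
  qed
  ultimately show ?thesis using sp by blast
qed

text \<open>
  The third family of dimensions counts basis vectors. So does the sum of the first two, which is the
  dimension of the part of \<open>F\<^sub>i\<close> that \<open>h\<close> maps into \<open>F\<^sub>i\<close>; hence lower bounds for each of them suffice.
  A sign at position \<open>i\<close>, or the second member of a pair, adds \<open>h (v i) \<plusminus> v i\<close> to \<open>F\<^sub>i \<inter> E\<^sub>\<plusminus>\<close>.
\<close>

lemma flag_of_adapted_basis:
  assumes v: "inj_on v {1..N}" "cvec.independent (v ` {1..N})" "cvec.span (v ` {1..N}) = V"
    and hv: "\<And>i. i \<in> {1..N} \<Longrightarrow> h (v i) = cscale (\<eta> i) (v (\<sigma> i))"
  shows "flag_of_basis N v \<in> clan_orbit N H \<gamma>"
proof -
  let ?F = "flag_of_basis N v"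
  have F: "?F i = cvec.span (v ` {1..i})" if "i \<le> N" for i using that by (simp add: flag_of_basis_def)
  have vV: "v i \<in> V" if "i \<in> {1..N}" for i using v(3) cvec.span_base[of "v i" "v ` {1..N}"] that by auto
  have dimF: "cvec.dim (cvec.span (v ` J)) = card J" if "J \<subseteq> {1..N}" for J
    by (rule dim_span_image[OF v(1,2) that])
  have complete: "?F \<in> complete_flags N" by (rule flag_of_basis_complete[OF v(1,2) vV])
  have cross: "cvec.dim (sum_space (h ` ?F i) (?F j)) = j + crossings i j" if ij: "i \<le> j" "j \<le> N" for i j
  proof -
    have sub: "{1..i} \<subseteq> {1..N}" "\<sigma> ` {1..i} \<subseteq> {1..N}" using ij mate_in by (auto simp: subset_iff)
    have "h ` ?F i = cvec.span (h ` v ` {1..i})" using F ij cpair.linear_span_image[OF mat_vec_linear] by simp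
    also have "\<dots> = cvec.span (v ` \<sigma> ` {1..i})"
    proof (rule cvec.span_eq[THEN iffD2], rule conjI)
      show "h ` v ` {1..i} \<subseteq> cvec.span (v ` \<sigma> ` {1..i})"
      proof safe
        fix t assume t: "t \<in> {1..i}"
        then have "t \<in> {1..N}" using sub(1) by blast
        then show "h (v t) \<in> cvec.span (v ` \<sigma> ` {1..i})"
          unfolding hv[OF \<open>t \<in> {1..N}\<close>] using t by (intro cvec.span_scale cvec.span_base imageI)
      qed
      show "v ` \<sigma> ` {1..i} \<subseteq> cvec.span (h ` v ` {1..i})"
      proof safe
        fix t assume t: "t \<in> {1..i}"
        then have "v (\<sigma> t) = cscale (\<eta> t) (h (v t))" using hv[of t] sub(1) eta_sq[of t] by auto
        then show "v (\<sigma> t) \<in> cvec.span (h ` v ` {1..i})"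
          using t by (simp add: cvec.span_scale cvec.span_base)
      qed
    qed
    finally have "sum_space (h ` ?F i) (?F j) = cvec.span (v ` (\<sigma> ` {1..i} \<union> {1..j}))"
      using F ij by (simp add: sum_space_span image_Un)
    then have "cvec.dim (sum_space (h ` ?F i) (?F j)) = card (\<sigma> ` {1..i} \<union> {1..j})"
      using dimF sub ij by simp
    also have "\<sigma> ` {1..i} \<union> {1..j} = {1..j} \<union> \<sigma> ` {s \<in> {1..i}. j < \<sigma> s}"
      using sub(2) by force
    also have "card \<dots> = j + card (\<sigma> ` {s \<in> {1..i}. j < \<sigma> s})"
      by (subst card_Un_disjoint) auto
    also have "card (\<sigma> ` {s \<in> {1..i}. j < \<sigma> s}) = crossings i j"
      unfolding crossings_def
    proof (rule card_image, rule inj_onI)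
      fix x y assume "x \<in> {s \<in> {1..i}. j < \<sigma> s}" "y \<in> {s \<in> {1..i}. j < \<sigma> s}" "\<sigma> x = \<sigma> y"
      then show "x = y" using mate_inj[of x y] sub(1) by auto
    qed
    finally show ?thesis .
  qed
  note F' = complete_flagsD[OF complete]
  have lower: "card {t \<in> {1..i}. c t = sg \<or> \<sigma> t < t} \<le> cvec.dim (?F i \<inter> E k)"
    if k: "(k = 1 \<and> sg = Plus) \<or> (k = - 1 \<and> sg = Minus)" and "i \<le> N" for i k sg
    using \<open>i \<le> N\<close>
  proof (induction i)
    case (Suc i)
    let ?v = "v (Suc i)"
    have iN: "i \<le> N" "Suc i \<in> {1..N}" using Suc.prems by auto
    have sub: "cvec.subspace (?F j \<inter> E k)" "fin_dim (?F j \<inter> E k)" if "j \<le> N" for j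
      using F'(1,2)[OF that] by (auto intro: cvec.subspace_inter fin_dim_sub)
    have incl: "?F i \<inter> E k \<subseteq> ?F (Suc i) \<inter> E k" using F'(4)[of i "Suc i"] Suc.prems by auto
    have le: "cvec.dim (?F i \<inter> E k) \<le> cvec.dim (?F (Suc i) \<inter> E k)" by (rule dim_mono[OF incl sub[OF Suc.prems]])
    have less: "\<not> cvec.dim (?F (Suc i) \<inter> E k) \<le> cvec.dim (?F i \<inter> E k)" if new: "c (Suc i) = sg \<or> \<sigma> (Suc i) < Suc i"
    proof
      assume "cvec.dim (?F (Suc i) \<inter> E k) \<le> cvec.dim (?F i \<inter> E k)"
      then have eq: "?F i \<inter> E k = ?F (Suc i) \<inter> E k"
        by (rule dim_eq_imp_eq[OF incl sub(1)[OF iN(1)] sub[OF Suc.prems]])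
      obtain y l where yl: "h ?v + cscale k ?v = y + cscale l ?v" "y \<in> ?F i" "l \<noteq> 0"
      proof (cases "c (Suc i) = sg")
        case True
        then have "\<sigma> (Suc i) = Suc i" using k mate_sign sign_cases by blast
        then have "h ?v = cscale k ?v" using hv[OF iN(2)] True k by (auto simp: mate_sign_factor_def)
        then have "h ?v + cscale k ?v = 0 + cscale (2 * k) ?v" by (auto simp: fun_eq_iff cscale_apply)
        from that[OF this cvec.subspace_0[OF F'(1)[OF iN(1)]]] k show thesis by auto
      next
        case False
        then have s: "\<sigma> (Suc i) < Suc i" using new by blast
        then have "h ?v = v (\<sigma> (Suc i))"
          using hv[OF iN(2)] second_not_sign[OF iN(2)] by (simp add: mate_sign_factor_def)
        moreover have "v (\<sigma> (Suc i)) \<in> ?F i"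
          unfolding F[OF iN(1)] using s mate_bounds[OF iN(2)] by (intro cvec.span_base imageI) simp
        ultimately show thesis using that[of "v (\<sigma> (Suc i))" k] k by auto
      qed
      have "?v \<in> ?F (Suc i)" unfolding F[OF Suc.prems] by (intro cvec.span_base imageI) simp
      then have "h ?v + cscale k ?v \<in> ?F (Suc i)"
        unfolding yl(1) using yl(2) F'(4)[of i "Suc i"] F'(1)[OF Suc.prems] Suc.prems
        by (auto intro!: cvec.subspace_add cvec.subspace_scale)
      then have "h ?v + cscale k ?v \<in> ?F i" using eq h_plus_scale_in_E[OF vV[OF iN(2)], of k] k by auto
      from cvec.subspace_diff[OF F'(1)[OF iN(1)] this yl(2)] have "cscale l ?v \<in> ?F i" unfolding yl(1) by simp
      then have "?v \<in> ?F i" using yl(3) cvec.subspace_scale[OF F'(1)[OF iN(1)], of "cscale l ?v" "1 / l"] by simp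
      then have "v ` {1..Suc i} \<subseteq> ?F i"
        unfolding F[OF iN(1)] by (auto simp: atLeastAtMostSuc_conv intro: cvec.span_base)
      then have "?F (Suc i) \<subseteq> ?F i" unfolding F[OF Suc.prems] by (rule cvec.span_minimal[OF _ F'(1)[OF iN(1)]])
      from dim_mono[OF this F'(1)[OF iN(1)] F'(5)[OF iN(1)]]
      show False unfolding F'(3)[OF iN(1)] F'(3)[OF Suc.prems] by simp
    qed
    have "card {t \<in> {1..i}. c t = sg \<or> \<sigma> t < t} \<le> cvec.dim (?F i \<inter> E k)" using Suc.IH iN(1) by blast
    then show ?case using le less card_Collect_Suc[of i "\<lambda>t. c t = sg \<or> \<sigma> t < t"] by (auto split: if_splits)
  qed simp
  have dims: "cvec.dim (?F i \<inter> E 1) = clan_plus \<gamma> i \<and> cvec.dim (?F i \<inter> E (- 1)) = clan_minus \<gamma> i"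
    if i: "i \<le> N" for i
  proof -
    have "cvec.dim (sum_space (h ` ?F i) (?F i)) + cvec.dim {x \<in> ?F i. h x \<in> ?F i} = i + i"
      using dim_image_plus[OF mat_vec_linear F'(1,5,1,5), of i i N H] F'(3) i by simp
    then have "cvec.dim (?F i \<inter> E 1) + cvec.dim (?F i \<inter> E (- 1)) = clan_plus \<gamma> i + clan_minus \<gamma> i"
      using cross[OF order_refl i] dim_stable_part[OF F'(1,2)[OF i]] crossings_diag[OF i] by simp
    then show ?thesis
      using lower[of 1 Plus, OF _ i] lower[of "- 1" Minus, OF _ i] clan_plus_eq[OF i] clan_minus_eq[OF i] by simp
  qed
  show ?thesis
    unfolding clan_orbit_iff using complete dims cross clan_cross_eq by auto
qed

lemma flag_of_adapted_basis_perp: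
  assumes v: "inj_on v {1..N}" "cvec.independent (v ` {1..N})" "cvec.span (v ` {1..N}) = V"
    and F: "flag_of_basis N v \<in> complete_flags N"
    and Bv: "\<And>i j. i \<in> {1..N} \<Longrightarrow> j \<in> {1..N} \<Longrightarrow> j \<noteq> N + 1 - i \<Longrightarrow> B (v i) (v j) = 0"
  shows "flag_of_basis N v \<in> perp_flags N M"
proof -
  let ?F = "flag_of_basis N v"
  note F' = complete_flagsD[OF F]
  have FE: "?F i = cvec.span (v ` {1..i})" if "i \<le> N" for i using that by (simp add: flag_of_basis_def)
  have vV: "v i \<in> V" if "i \<in> {1..N}" for i using v(3) cvec.span_base[of "v i" "v ` {1..N}"] that by auto
  have "?F (N - i) = orth (?F i)" if i: "i \<le> N" for i
  proof (rule dim_eq_imp_eq)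
    have "v k \<in> orth (v ` {1..i})" if "k \<in> {1..N - i}" for k
      using that i vV Bv by (auto simp: perp_def)
    then have "cvec.span (v ` {1..N - i}) \<subseteq> orth (v ` {1..i})"
      by (intro cvec.span_minimal subspace_perp image_subsetI)
    then show "?F (N - i) \<subseteq> orth (?F i)"
      unfolding FE[OF i] perp_span using FE[of "N - i"] by simp
    show "cvec.dim (orth (?F i)) \<le> cvec.dim (?F (N - i))"
      using dim_orth[OF F'(1,2)[OF i]] F'(3)[OF i] F'(3)[of "N - i"] by simp
  qed (use F' i in \<open>auto simp: fin_dim_sub perp_subset_coord_space\<close>)
  then show ?thesis using F unfolding perp_flags_def by blast
qed

theorem exists_flag:
  assumes "cvec.dim (E 1) = a" mirror_symmetric
    "\<And>i. i \<in> {1..N} \<Longrightarrow> d i \<noteq> 0" "\<And>i. i \<in> {1..N} \<Longrightarrow> d (N + 1 - i) = \<epsilon> * d i"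
    "\<And>i. i \<in> {1..N} \<Longrightarrow> \<eta> i * d (\<sigma> i) = \<delta> * \<eta> (N + 1 - i) * d i"
  shows "clan_orbit N H \<gamma> \<inter> perp_flags N M \<noteq> {}"
proof -
  obtain v where v: "inj_on v {1..N}" "cvec.independent (v ` {1..N})" "cvec.span (v ` {1..N}) = V"
    "\<And>i. i \<in> {1..N} \<Longrightarrow> h (v i) = cscale (\<eta> i) (v (\<sigma> i))"
    "\<And>i j. i \<in> {1..N} \<Longrightarrow> j \<in> {1..N} \<Longrightarrow> j \<noteq> N + 1 - i \<Longrightarrow> B (v i) (v j) = 0"
    using adapted_basis[OF assms] by blast
  have "flag_of_basis N v \<in> clan_orbit N H \<gamma>" by (rule flag_of_adapted_basis[OF v(1-4)])
  moreover from this have "flag_of_basis N v \<in> perp_flags N M"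
    using flag_of_adapted_basis_perp[OF v(1-3) _ v(5)] flag_complete by blast
  ultimately show ?thesis by blast
qed

end

section \<open>Reflections\<close>

locale symmetric_form = form_space N M 1 for N M
begin

lemma B_sym: "B x y = B y x"
  using B_swap[of y x] by simp

definition refl :: "(nat \<Rightarrow> complex) \<Rightarrow> (nat \<Rightarrow> complex) \<Rightarrow> nat \<Rightarrow> complex" where
  "refl v x = x - cscale (2 * B x v / B v v) v"

definition nonisotropic :: "(nat \<Rightarrow> complex) set" where
  "nonisotropic = {v \<in> V. B v v \<noteq> 0}"

definition refl_flag :: "(nat \<Rightarrow> complex) \<Rightarrow> (nat \<Rightarrow> (nat \<Rightarrow> complex) set) \<Rightarrow> nat \<Rightarrow> (nat \<Rightarrow> complex) set" where
  "refl_flag v F = (\<lambda>i\<in>{0..N}. refl v ` F i)"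

lemma refl_add: "refl v (x + y) = refl v x + refl v y"
  unfolding refl_def by (simp add: bilin_simps cscale_apply fun_eq_iff add_divide_distrib algebra_simps)

lemma refl_scale: "refl v (cscale k x) = cscale k (refl v x)"
  unfolding refl_def by (simp add: bilin_simps cscale_apply fun_eq_iff algebra_simps)

lemma refl_linear: "clinear (refl v)"
  unfolding clinear_iff by (simp add: refl_add refl_scale)

context
  fixes v assumes v: "v \<in> nonisotropic"
begin

lemma v_in: "v \<in> V" and v_ne: "B v v \<noteq> 0"
  using v by (auto simp: nonisotropic_def)

lemma refl_in: "x \<in> V \<Longrightarrow> refl v x \<in> V"
  unfolding refl_def using v_in by (simp add: cvec.subspace_diff cvec.subspace_scale)

lemma B_refl_v: "B (refl v x) v = - B x v"
  unfolding refl_def using v_ne by (simp add: bilin_simps)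

lemma refl_refl: "refl v (refl v x) = x"
proof -
  have "refl v (refl v x) = refl v x - cscale (2 * B (refl v x) v / B v v) v"
    by (simp only: refl_def[of v "refl v x"])
  also have "\<dots> = x" unfolding B_refl_v by (simp add: refl_def cscale_def fun_eq_iff)
  finally show ?thesis .
qed

lemma B_refl: "B (refl v x) (refl v y) = B x y"
proof -
  have "B (refl v x) (refl v y) = B (refl v x) y - (2 * B y v / B v v) * B (refl v x) v"
    by (simp add: refl_def[of v y] bilin_simps)
  also have "\<dots> = B (refl v x) y + (2 * B y v / B v v) * B x v" by (simp add: B_refl_v)
  also have "B (refl v x) y = B x y - (2 * B x v / B v v) * B y v"
    using B_sym[of v y] by (simp add: refl_def bilin_simps)
  finally show ?thesis by simp
qed

lemma refl_image_iff: "x \<in> refl v ` S \<longleftrightarrow> refl v x \<in> S"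
  using refl_refl by (metis image_iff)

lemma refl_subspace: "cvec.subspace S \<Longrightarrow> cvec.subspace (refl v ` S)"
  by (rule cpair.linear_subspace_image[OF refl_linear])

lemma refl_image_sub: "S \<subseteq> V \<Longrightarrow> refl v ` S \<subseteq> V"
  using refl_in by blast

lemma dim_refl: "cvec.subspace S \<Longrightarrow> S \<subseteq> V \<Longrightarrow> cvec.dim (refl v ` S) = cvec.dim S"
  using refl_refl cpair.linear_0[OF refl_linear]
  by (intro dim_injective_image refl_linear fin_dim_sub) metis+

lemma orth_refl: "orth (refl v ` S) = refl v ` orth S"
proof (intro subset_antisym subsetI)
  fix y assume y: "y \<in> orth (refl v ` S)"
  have "B x (refl v y) = 0" if "x \<in> S" for x
    using B_refl[of "refl v x" y] y that by (auto simp: perp_def refl_refl)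
  then show "y \<in> refl v ` orth S" unfolding refl_image_iff using y refl_in by (auto simp: perp_def)
next
  fix y assume "y \<in> refl v ` orth S"
  then show "y \<in> orth (refl v ` S)" using refl_in B_refl by (auto simp: perp_def)
qed

lemma refl_fixed: "B x v = 0 \<Longrightarrow> refl v x = x"
  by (simp add: refl_def)

lemma refl_flag_apply: "i \<le> N \<Longrightarrow> refl_flag v F i = refl v ` F i"
  by (simp add: refl_flag_def)

lemma refl_flag_complete:
  assumes "F \<in> complete_flags N" shows "refl_flag v F \<in> complete_flags N"
  using assms unfolding complete_flags_def
  by (auto simp: refl_flag_apply dim_refl refl_subspace refl_image_sub intro!: image_mono)
    (auto simp: refl_flag_def)

lemma refl_flag_perp:
  assumes "F \<in> perp_flags N M" shows "refl_flag v F \<in> perp_flags N M"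
  using assms refl_flag_complete unfolding perp_flags_def by (auto simp: refl_flag_apply orth_refl)

text \<open>
  Here \<open>U\<close> and \<open>E'\<close> are maximal isotropic. The hyperplane \<open>W = U \<inter> v\<^sup>\<bottom>\<close> of \<open>U\<close> is contained in the
  reflected space \<open>U'\<close>, and every isotropic vector of \<open>W\<^sup>\<bottom>\<close> lies in \<open>U\<close> or \<open>U'\<close>. By dimension,
  \<open>E' \<inter> W\<^sup>\<bottom>\<close> has one dimension more than \<open>E' \<inter> W\<close>. So it is contained in one of \<open>U\<close> and \<open>U'\<close>, and
  the other one meets it in \<open>E' \<inter> W\<close>.
\<close>

lemma refl_changes_parity:
  assumes U: "cvec.subspace U" "orth U = U" and E: "cvec.subspace E'" "orth E' = E'"
  shows "odd (cvec.dim (U \<inter> E') + cvec.dim (refl v ` U \<inter> E'))"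
proof -
  have UV: "U \<subseteq> V" "E' \<subseteq> V" using U(2) E(2) perp_subset_coord_space by blast+
  let ?U' = "refl v ` U"
  define W where "W = {u \<in> U. B u v = 0}"
  have W: "cvec.subspace W" "W \<subseteq> U" "W \<subseteq> V"
    using U(1) UV(1) unfolding W_def cvec.subspace_def by (auto simp: bilin_simps)
  have iso: "B x y = 0" if "x \<in> U" "y \<in> U" for x y using that U(2) by (auto simp: perp_def)
  have vU: "v \<notin> U" using iso v_ne by blast
  have orthW: "v \<in> orth W" "U \<subseteq> orth W" "?U' \<subseteq> orth W"
  proof -
    show "v \<in> orth W" "U \<subseteq> orth W" using v_in iso UV by (auto simp: W_def perp_def)
    have "B w (refl v x) = 0" if "w \<in> W" "x \<in> U" for w x
      using B_refl[of w x] refl_fixed[of w] iso[of w x] that by (simp add: W_def)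
    then show "?U' \<subseteq> orth W" using refl_in UV(1) by (auto simp: perp_def)
  qed
  have int: "U \<inter> ?U' = W"
  proof (intro subset_antisym subsetI)
    fix x assume x: "x \<in> U \<inter> ?U'"
    define k where "k = 2 * B x v / B v v"
    have "cscale k v = x - refl v x" by (simp add: refl_def k_def)
    then have "cscale k v \<in> U" using x U(1) refl_image_iff by (simp add: cvec.subspace_diff)
    then have "k = 0" using vU cvec.subspace_scale[OF U(1), of "cscale k v" "1 / k"] by (cases "k = 0") auto
    then show "x \<in> W" using x v_ne by (simp add: k_def W_def)
  next
    fix x assume "x \<in> W"
    then show "x \<in> U \<inter> ?U'" using refl_fixed[of x] by (auto simp: W_def refl_image_iff)
  qed
  have "cvec.dim U \<le> 1 + cvec.dim W"
    using dim_common_zeros[of "\<lambda>i z. B z v" U 1] U(1) UV(1) by (simp add: bilin_simps fin_dim_sub W_def)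
  moreover have "U \<noteq> W" using int orthW(1) vU U(2) by (auto simp: W_def perp_def v_in)
  then have "\<not> cvec.dim U \<le> cvec.dim W" using dim_eq_imp_eq[OF W(2,1) U(1) fin_dim_sub[OF UV(1)]] by blast
  ultimately have dW: "cvec.dim U = 1 + cvec.dim W" by simp
  have half: "cvec.dim U + cvec.dim U = N" "cvec.dim E' + cvec.dim E' = N"
    using dim_orth[OF U(1) UV(1)] dim_orth[OF E(1) UV(2)] U(2) E(2) by simp_all
  have sumW: "sum_space U (cvec.span {v}) = orth W"
  proof (rule dim_eq_imp_eq)
    show "sum_space U (cvec.span {v}) \<subseteq> orth W"
      using orthW by (intro sum_space_least cvec.span_minimal) auto
    have "v \<in> sum_space U (cvec.span {v})" "U \<subseteq> sum_space U (cvec.span {v})"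
      using sum_space_right[OF U(1), of "cvec.span {v}"] sum_space_left[OF cvec.subspace_span]
      by (auto intro: cvec.span_base)
    then have "\<not> cvec.dim (sum_space U (cvec.span {v})) \<le> cvec.dim U"
      using dim_eq_imp_eq[of U "sum_space U (cvec.span {v})"] U(1) vU
        fin_dim_sum_space[OF fin_dim_sub[OF UV(1)] fin_dim_span, of "{v}"] by (auto simp: subspace_sum_space)
    moreover have "cvec.dim W + cvec.dim (orth W) = N" by (rule dim_orth[OF W(1,3)])
    ultimately show "cvec.dim (orth W) \<le> cvec.dim (sum_space U (cvec.span {v}))" using dW half by simp
  qed (use U(1) in \<open>auto simp: fin_dim_sub perp_subset_coord_space subspace_sum_space\<close>)
  define T where "T = E' \<inter> orth W"
  have T: "cvec.subspace T" using E(1) by (simp add: T_def cvec.subspace_inter)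
  have cover: "x \<in> U \<or> x \<in> ?U'" if x: "x \<in> T" for x
  proof -
    obtain u k where uk: "u \<in> U" "x = u + cscale k v"
      using x sumW unfolding T_def sum_space_def cvec.span_singleton by blast
    have "0 = B x x" using x E(2) by (auto simp: T_def perp_def)
    also have "\<dots> = k * (2 * B u v + k * B v v)"
      unfolding uk(2) using iso[OF uk(1,1)] B_sym[of v u] by (simp add: bilin_simps algebra_simps)
    finally consider "k = 0" | "2 * B u v + k * B v v = 0" by fastforce
    then show ?thesis
    proof cases
      case 2
      then have "k * B v v = - (2 * B u v)" by (simp add: eq_neg_iff_add_eq_0 add.commute)
      then have "k = - (2 * B u v / B v v)" using v_ne by (simp add: field_simps)
      then have "x = refl v u" unfolding uk(2) refl_def by (simp add: cvec.scale_minus_left)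
      then show ?thesis using uk(1) by blast
    qed (use uk in simp)
  qed
  have "cvec.dim (sum_space E' W) + cvec.dim (E' \<inter> W) = cvec.dim E' + cvec.dim W"
    by (intro dim_sum_space E W fin_dim_sub UV)
  moreover have "cvec.dim (sum_space E' W) + cvec.dim (orth (sum_space E' W)) = N"
    using E(1) W UV by (intro dim_orth subspace_sum_space sum_space_least) auto
  moreover have "orth (sum_space E' W) = T" using perp_sum_space[OF E(1) W(1)] E(2) by (simp add: T_def)
  ultimately have dT: "cvec.dim T = 1 + cvec.dim (E' \<inter> W)" using dW half by simp
  \<comment> \<open>A vector space is not the union of two proper subspaces.\<close>
  have "T \<subseteq> U \<or> T \<subseteq> ?U'"
  proof (rule ccontr)
    assume "\<not> ?thesis"
    then obtain x y where xy: "x \<in> T" "x \<notin> U" "y \<in> T" "y \<notin> ?U'" by blast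
    then have "x \<in> ?U'" "y \<in> U" "x + y \<in> U \<or> x + y \<in> ?U'"
      using cover T by (blast intro: cvec.subspace_add)+
    then show False
      using xy U(1) refl_subspace[OF U(1)] cvec.subspace_diff[of U "x + y" y] cvec.subspace_diff[of ?U' "x + y" x]
      by auto
  qed
  then consider "U \<inter> E' = T" "?U' \<inter> E' = E' \<inter> W" | "U \<inter> E' = E' \<inter> W" "?U' \<inter> E' = T"
    using orthW int unfolding T_def by blast
  then show ?thesis by cases (simp_all add: dT)
qed

end

text \<open>
  If \<open>B w w' \<noteq> 0\<close>, then the reflection in \<open>w - w'\<close> maps \<open>w\<close> to \<open>w'\<close>. Otherwise some isotropic \<open>z\<close> is
  orthogonal to neither of them, and two reflections lead from \<open>w\<close> via \<open>z\<close> to \<open>w'\<close>.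
\<close>

lemma refl_difference:
  assumes "w \<in> V" "w' \<in> V" "B w w = 0" "B w' w' = 0" "B w w' \<noteq> 0"
  shows "w - w' \<in> nonisotropic" "refl (w - w') w = w'"
proof -
  have *: "B (w - w') (w - w') = - 2 * B w w'" using assms B_sym[of w' w] by (simp add: bilin_simps)
  then show "w - w' \<in> nonisotropic" using assms by (simp add: nonisotropic_def cvec.subspace_diff)
  have n: "B w (w - w') = - B w w'" using assms by (simp add: bilin_diff_right)
  have "2 * B w (w - w') / B (w - w') (w - w') = 1"
    unfolding * n using assms by simp
  then show "refl (w - w') w = w'" by (simp add: refl_def)
qed

lemma isotropic_transitive:
  assumes S: "cvec.subspace S" "S \<subseteq> V"
    and w: "w \<in> orth S" "w \<notin> S" "B w w = 0" and w': "w' \<in> orth S" "w' \<notin> S" "B w' w' = 0"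
  shows "\<exists>vs. set vs \<subseteq> nonisotropic \<inter> orth S \<and> foldr refl vs w = w'"
proof (cases "B w w' = 0")
  case False
  then show ?thesis
    using refl_difference[of w w'] w w'
    by (intro exI[of _ "[w - w']"]) (auto simp: perp_def bilin_simps cvec.subspace_diff)
next
  case True
  have ex: "\<exists>z\<in>orth S. B y z \<noteq> 0" if y: "y \<in> orth S" "y \<notin> S" for y
  proof (rule ccontr)
    assume "\<not> ?thesis"
    then have "y \<in> orth (orth S)" using y(1) B_sym by (auto simp: perp_def)
    then show False using orth_orth[OF S] y(2) by simp
  qed
  obtain z1 z2 where z: "z1 \<in> orth S" "B w z1 \<noteq> 0" "z2 \<in> orth S" "B w' z2 \<noteq> 0"
    using ex w w' by metis
  have "\<exists>z\<in>orth S. B w z \<noteq> 0 \<and> B w' z \<noteq> 0"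
  proof (cases "B w' z1 = 0")
    case False then show ?thesis using z by blast
  next
    case w'z1: True
    show ?thesis
    proof (cases "B w z2 = 0")
      case False then show ?thesis using z by blast
    next
      case True
      have "z1 + z2 \<in> orth S" using z cvec.subspace_add[OF subspace_perp] by blast
      then show ?thesis using z True w'z1 by (intro bexI[of _ "z1 + z2"]) (auto simp: bilin_simps)
    qed
  qed
  then obtain z0 where z0: "z0 \<in> orth S" "B w z0 \<noteq> 0" "B w' z0 \<noteq> 0" by blast
  define z where "z = z0 + cscale (- B z0 z0 / (2 * B w z0)) w"
  have zS: "z \<in> orth S"
    unfolding z_def using z0 w cvec.subspace_add[OF subspace_perp] cvec.subspace_scale[OF subspace_perp] by blast
  have "B w z \<noteq> 0" "B w' z \<noteq> 0" "B z z = 0"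
    unfolding z_def using z0 w(3) True B_sym[of z0 w] B_sym[of w' w]
    by (simp_all add: bilin_simps field_simps)
  moreover have V: "w \<in> V" "w' \<in> V" "z \<in> V" using w w' zS by (auto simp: perp_def)
  ultimately have "w - z \<in> nonisotropic" "refl (w - z) w = z" "z - w' \<in> nonisotropic" "refl (z - w') z = w'"
    using refl_difference[of w z] refl_difference[of z w'] w w' B_sym[of z w'] by auto
  moreover have "w - z \<in> orth S" "z - w' \<in> orth S"
    using w w' zS cvec.subspace_diff[OF subspace_perp] by blast+
  ultimately show ?thesis by (intro exI[of _ "[z - w', w - z]"]) simp
qed

lemma foldr_refl_linear: "clinear (foldr refl vs)"
proof (induction vs)
  case Nil
  then show ?case by (simp add: clinear_iff)
next
  case (Cons v vs)
  then show ?case unfolding clinear_iff by (simp add: refl_add refl_scale)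
qed

lemma foldr_refl_flag_perp:
  "set vs \<subseteq> nonisotropic \<Longrightarrow> F \<in> perp_flags N M \<Longrightarrow> foldr refl_flag vs F \<in> perp_flags N M"
  by (induction vs) (auto intro: refl_flag_perp)

lemma foldr_refl_flag_apply:
  "set vs \<subseteq> nonisotropic \<Longrightarrow> i \<le> N \<Longrightarrow> foldr refl_flag vs F i = foldr refl vs ` F i"
  by (induction vs) (auto simp: refl_flag_apply image_comp)

lemma span_insert_eq:
  assumes "cvec.subspace S" "cvec.subspace T" "S \<subseteq> T" "T \<subseteq> V" "w \<in> T" "w \<notin> S" "cvec.dim T = Suc (cvec.dim S)"
  shows "cvec.span (insert w S) = T"
proof (rule dim_eq_imp_eq)
  show "cvec.span (insert w S) \<subseteq> T" using assms by (intro cvec.span_minimal) auto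
  then have V: "cvec.span (insert w S) \<subseteq> V" using assms by blast
  have "S \<subseteq> cvec.span (insert w S)" "w \<in> cvec.span (insert w S)"
    by (auto intro: cvec.span_base)
  then have "\<not> cvec.dim (cvec.span (insert w S)) \<le> cvec.dim S"
    using dim_eq_imp_eq[OF _ assms(1) cvec.subspace_span fin_dim_sub[OF V]] assms(6) by blast
  then show "cvec.dim T \<le> cvec.dim (cvec.span (insert w S))" using assms(7) by simp
qed (use assms fin_dim_sub in auto)

text \<open>
  Reflections act transitively on self-orthogonal flags of an even-dimensional space: if two flags
  agree up to \<open>F\<^sub>k\<close>, then reflections in vectors orthogonal to \<open>F\<^sub>k\<close> make them agree up to \<open>F\<^bsub>k+1\<^esub>\<close>.
\<close>

lemma refl_flag_transitive:
  assumes F: "F \<in> perp_flags N M" and F': "F' \<in> perp_flags N M" and N: "N = 2 * n"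
  shows "\<exists>vs. set vs \<subseteq> nonisotropic \<and> foldr refl_flag vs F = F'"
proof -
  note P = perp_flagsD and C = complete_flagsD[OF perp_flagsD(1)]
  have "\<exists>vs. set vs \<subseteq> nonisotropic \<and> (\<forall>j\<le>k. foldr refl_flag vs F j = F' j)" if "k \<le> n" for k
    using that
  proof (induction k)
    case 0
    have "F 0 = {0}" "F' 0 = {0}"
      using C[OF F, of 0] C[OF F', of 0] dim_eq_0_iff fin_dim_sub by simp_all
    then show ?case by (intro exI[of _ "[]"]) simp
  next
    case (Suc k)
    then obtain vs where vs: "set vs \<subseteq> nonisotropic" "\<And>j. j \<le> k \<Longrightarrow> foldr refl_flag vs F j = F' j"
      by fastforce
    define G where "G = foldr refl_flag vs F"
    have G: "G \<in> perp_flags N M" unfolding G_def by (rule foldr_refl_flag_perp[OF vs(1) F])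
    have Gk: "G j = F' j" if "j \<le> k" for j using vs(2)[OF that] by (simp add: G_def)
    have kN: "k \<le> N" "Suc k \<le> N" "Suc k \<le> N - Suc k" "Suc k \<le> N - k" using Suc.prems N by auto
    have pick: "\<exists>w. w \<in> K (Suc k) \<and> w \<in> orth (K k) \<and> w \<notin> K k \<and> B w w = 0"
      if K: "K \<in> perp_flags N M" for K
    proof -
      have "\<not> K (Suc k) \<subseteq> K k"
        using dim_mono[OF _ C(1)[OF K kN(1)] fin_dim_sub[OF C(2)[OF K kN(1)]], of "K (Suc k)"]
          C(3)[OF K kN(1)] C(3)[OF K kN(2)] by auto
      then obtain w where w: "w \<in> K (Suc k)" "w \<notin> K k" by blast
      have "w \<in> orth (K k)" using w(1) C(4)[OF K kN(4)] P(2)[OF K kN(1)] by auto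
      moreover have "w \<in> orth (K (Suc k))" using w(1) C(4)[OF K kN(3)] P(2)[OF K kN(2)] by auto
      ultimately show ?thesis using w by (auto simp: perp_def)
    qed
    obtain w where w: "w \<in> G (Suc k)" "w \<in> orth (G k)" "w \<notin> G k" "B w w = 0" using pick[OF G] by blast
    obtain w' where w': "w' \<in> F' (Suc k)" "w' \<in> orth (G k)" "w' \<notin> G k" "B w' w' = 0"
      using pick[OF F'] Gk[of k] by auto
    obtain us where us: "set us \<subseteq> nonisotropic \<inter> orth (G k)" "foldr refl us w = w'"
      using isotropic_transitive[OF C(1,2)[OF G kN(1)] w(2-4) w'(2-4)] by blast
    have usn: "set us \<subseteq> nonisotropic" using us(1) by blast
    have fixed: "foldr refl us x = x" if x: "x \<in> G k" for x
      using us(1)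
    proof (induction us)
      case (Cons v us)
      then have "B x v = 0" "v \<in> nonisotropic" using x by (auto simp: perp_def)
      then show ?case using Cons refl_fixed by simp
    qed simp
    have fixes_sub: "foldr refl us ` T = T" if "T \<subseteq> G k" for T using fixed that by force
    have top: "foldr refl us ` G (Suc k) = F' (Suc k)"
    proof -
      have "G (Suc k) = cvec.span (insert w (G k))"
        using C[OF G kN(1)] C[OF G kN(2)] C(4)[OF G, of k "Suc k"] kN w by (intro span_insert_eq[symmetric]) auto
      then have "foldr refl us ` G (Suc k) = cvec.span (insert w' (G k))"
        using cpair.linear_span_image[OF foldr_refl_linear[of us], of "insert w (G k)"] us(2) fixes_sub[of "G k"] by simp
      also have "\<dots> = cvec.span (insert w' (F' k))" using Gk by simp
      also have "\<dots> = F' (Suc k)"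
        using C[OF F' kN(1)] C[OF F' kN(2)] C(4)[OF F', of k "Suc k"] kN w' Gk by (intro span_insert_eq) auto
      finally show ?thesis .
    qed
    have "foldr refl_flag (us @ vs) F j = F' j" if j: "j \<le> Suc k" for j
    proof -
      have jN: "j \<le> N" using j kN by simp
      have "foldr refl_flag (us @ vs) F j = foldr refl us ` G j"
        using foldr_refl_flag_apply[OF usn jN, of G] by (simp add: G_def)
      also have "\<dots> = F' j"
      proof (cases "j = Suc k")
        case False
        then have jk: "j \<le> k" using j by simp
        then show ?thesis using fixes_sub[OF C(4)[OF G jk kN(1)]] Gk by simp
      qed (use top in simp)
      finally show ?thesis .
    qed
    moreover have "set (us @ vs) \<subseteq> nonisotropic" using usn vs(1) by simp
    ultimately show ?case by blast
  qed
  then obtain vs where vs: "set vs \<subseteq> nonisotropic" "\<And>j. j \<le> n \<Longrightarrow> foldr refl_flag vs F j = F' j" by blast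
  have G: "foldr refl_flag vs F \<in> perp_flags N M" by (rule foldr_refl_flag_perp[OF vs(1) F])
  have "foldr refl_flag vs F j = F' j" for j
  proof -
    consider "j \<le> n" | "n < j" "j \<le> N" | "N < j" by linarith
    then show ?thesis
    proof cases
      case 2
      then have "N - j \<le> N" "N - (N - j) = j" "N - j \<le> n" using N by auto
      then show ?thesis using P(2)[OF G, of "N - j"] P(2)[OF F', of "N - j"] vs(2)[of "N - j"] by simp
    next
      case 3
      then show ?thesis using P(1)[OF G] P(1)[OF F'] by (simp add: complete_flags_def extensional_def)
    qed (use vs in simp)
  qed
  then show ?thesis using vs(1) by blast
qed

end

locale symmetric_involution = symmetric_form N M + form_involution N M 1 H 1 for N M H
begin

lemma refl_flag_clan_orbit:
  assumes v: "v \<in> nonisotropic" "v \<in> E k" and F: "F \<in> clan_orbit N H \<gamma>"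
  shows "refl_flag v F \<in> clan_orbit N H \<gamma>"
proof -
  have comm: "h (refl v x) = refl v (h x)" if x: "x \<in> V" for x
  proof -
    have vV: "v \<in> V" and hv: "h v = cscale k v" using v(2) by (auto simp: in_E)
    have "h (refl v x) = h x - cscale (2 * B x v / B v v * k) v"
      unfolding refl_def by (simp add: h_diff h_scale hv)
    moreover have "B (h x) v = k * B x v" using h_adjoint[OF x vV] by (simp add: hv bilin_simps)
    ultimately show ?thesis by (simp add: refl_def algebra_simps)
  qed
  have cF: "F \<in> complete_flags N" using F clan_orbit_iff by blast
  note F' = complete_flagsD[OF cF]
  have E: "refl v ` F i \<inter> E l = refl v ` (F i \<inter> E l)" if i: "i \<le> N" for i l
  proof -
    have "refl v x \<in> E l" if "x \<in> E l" for x
      using that comm[of x] refl_in[OF v(1)] by (auto simp: in_E refl_scale)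
    then show ?thesis using refl_refl[OF v(1)] by (force simp: refl_image_iff[OF v(1)])
  qed
  have S: "sum_space (h ` refl v ` F i) (refl v ` F j) = refl v ` sum_space (h ` F i) (F j)"
    if ij: "i \<le> N" "j \<le> N" for i j
  proof -
    have "h ` refl v ` F i = refl v ` h ` F i"
      using comm F'(2)[OF ij(1)] by (auto simp: image_comp intro!: image_cong)
    moreover have "sum_space (refl v ` S) (refl v ` T) = refl v ` sum_space S T" for S T
    proof (intro subset_antisym subsetI)
      fix x assume "x \<in> sum_space (refl v ` S) (refl v ` T)"
      then obtain s t where "s \<in> S" "t \<in> T" "x = refl v s + refl v t"
        unfolding sum_space_def by blast
      then show "x \<in> refl v ` sum_space S T" using sum_spaceI[of s S t T] by (simp add: refl_add[symmetric])
    next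
      fix x assume "x \<in> refl v ` sum_space S T"
      then obtain s t where "s \<in> S" "t \<in> T" "x = refl v s + refl v t"
        unfolding sum_space_def by (auto simp: refl_add)
      then show "x \<in> sum_space (refl v ` S) (refl v ` T)" by (simp add: sum_spaceI)
    qed
    ultimately show ?thesis by simp
  qed
  have "cvec.dim (refl v ` (F i \<inter> E l)) = cvec.dim (F i \<inter> E l)" if "i \<le> N" for i l
    using F'(1,2)[OF that] by (intro dim_refl[OF v(1)] cvec.subspace_inter) auto
  moreover have "cvec.dim (refl v ` sum_space (h ` F i) (F j)) = cvec.dim (sum_space (h ` F i) (F j))"
    if "i \<le> N" "j \<le> N" for i j
    using F'(1,2) that cpair.linear_subspace_image[OF mat_vec_linear F'(1)[OF that(1)]]
    by (intro dim_refl[OF v(1)] subspace_sum_space sum_space_least) auto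
  ultimately show ?thesis
    using F refl_flag_complete[OF v(1) cF] unfolding clan_orbit_iff
    by (simp add: refl_flag_apply[OF v(1)] E S)
qed

end

section \<open>Which clans occur\<close>

context clan_form
begin

text \<open>
  The factors \<open>d\<close> can be read off from the position of \<open>i\<close> in its pair (\<open>i < \<sigma> i\<close> or \<open>\<sigma> i < i\<close>), which is
  exchanged by both \<open>\<sigma>\<close> and the mirror map, and from the half in which the pair is centred
  (\<open>i + \<sigma> i < N + 1\<close> or \<open>> N + 1\<close>), which is exchanged by the mirror map only;
  only mirror pairs are centred in the middle. On signs, \<open>+\<close> and \<open>-\<close> play the roles of first and second position.
\<close>

theorem orbit_meets_iff:
  assumes dimE: "cvec.dim (E 1) = a" and even: "\<epsilon> * \<delta> = - 1 \<Longrightarrow> even N"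
  shows "clan_orbit N H \<gamma> \<inter> perp_flags N M \<noteq> {} \<longleftrightarrow>
    (if \<delta> = 1 then symmetric_clan \<gamma> else skew_symmetric_clan \<gamma>) \<and> (\<epsilon> * \<delta> = - 1 \<longrightarrow> no_mirror_pair \<gamma>)"
    (is "_ \<longleftrightarrow> ?sym \<and> ?pairs")
proof
  assume R: "?sym \<and> ?pairs"
  let ?flip = "\<lambda>s. if \<delta> = 1 then s else opposite s"
  have sg: "\<forall>i\<in>{1..N}. \<not> is_num (c i) \<longrightarrow> c (N + 1 - i) = ?flip (c i)" and ns: "numbers_symmetric \<gamma>"
    using conjunct1[OF R] unfolding symmetric_clan_def skew_symmetric_clan_def Let_def length_clan
    by (auto split: if_splits)
  have "\<not> is_num (?flip s)" if "\<not> is_num s" for s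
    using that by (cases s) (auto simp: is_num_def)
  then have sym: mirror_symmetric using sg ns numbers_symmetric_iff by simp
  define first where "first i = (if c i = Plus \<or> i < \<sigma> i then 1 else - 1 :: complex)" for i
  define half where "half i = (if i + \<sigma> i < N + 1 then 1 else - 1 :: complex)" for i
  define d where "d i = (if \<delta> = 1 then 1 else first i) * (if \<epsilon> * \<delta> = - 1 then half i else 1)" for i
  show "clan_orbit N H \<gamma> \<inter> perp_flags N M \<noteq> {}"
  proof (rule exists_flag[OF dimE sym, where d = d])
    fix i assume i: "i \<in> {1..N}"
    show "d i \<noteq> 0" by (simp add: d_def first_def half_def)
    have s: "\<sigma> (N + 1 - i) = N + 1 - \<sigma> i" using sym i unfolding mirror_symmetric_def by blast
    have t: "N + 1 - i \<in> {1..N}" using i by auto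
    have num: "is_num (c (N + 1 - i)) \<longleftrightarrow> is_num (c i)"
      using s mate_eq_iff[OF i] mate_eq_iff[OF t] mate_bounds[OF i] i by auto
    have half: "half (N + 1 - i) = - half i" "half (\<sigma> i) = half i" if ed: "\<epsilon> * \<delta> = - 1"
    proof -
      have "i + \<sigma> i \<noteq> N + 1"
      proof
        assume *: "i + \<sigma> i = N + 1"
        then have "N + 1 - i = \<sigma> i" by simp
        moreover have "\<forall>i\<in>{1..N}. is_num (c i) \<longrightarrow> c i \<noteq> c (N + 1 - i)"
          using R ed unfolding no_mirror_pair_def Let_def length_clan by blast
        ultimately have "\<not> is_num (c i)" using entry_mate[OF i] i by metis
        then have "i + i = N + 1" using * mate_sign by simp
        then show False using even[OF ed] by presburger
      qed
      moreover have "(N + 1 - i) + \<sigma> (N + 1 - i) + (i + \<sigma> i) = 2 * (N + 1)"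
        using mate_bounds[OF i] i unfolding s by auto
      ultimately show "half (N + 1 - i) = - half i" unfolding half_def by auto
      show "half (\<sigma> i) = half i" unfolding half_def mate_mate[OF i] by (simp add: add.commute)
    qed
    have "\<eta> i = 1 \<and> \<eta> (N + 1 - i) = 1 \<and> first (N + 1 - i) = - first i \<and> first (\<sigma> i) = - first i"
      if n: "is_num (c i)"
    proof -
      have "c k \<noteq> Plus \<and> c k \<noteq> Minus" if "k \<in> {i, N + 1 - i, \<sigma> i}" for k
        using that n num entry_mate[OF i] sign_cases by (metis insertE singletonD)
      moreover have "N + 1 - i < \<sigma> (N + 1 - i) \<longleftrightarrow> \<not> i < \<sigma> i"
        using mate_bounds[OF i] i mate_num(2)[OF i n] unfolding s by auto
      ultimately show ?thesis
        using mate_mate[OF i] mate_num(2)[OF i n] unfolding first_def mate_sign_factor_def by simp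
    qed
    moreover have "\<sigma> i = i \<and> (\<delta> = 1 \<longrightarrow> \<eta> (N + 1 - i) = \<eta> i) \<and>
        (\<delta> \<noteq> 1 \<longrightarrow> \<eta> (N + 1 - i) = - \<eta> i \<and> first (N + 1 - i) = - first i)" if n: "\<not> is_num (c i)"
    proof -
      have "c (N + 1 - i) = ?flip (c i)" using sg i n by blast
      moreover have "\<sigma> i = i" "\<sigma> (N + 1 - i) = N + 1 - i" using n num mate_sign by auto
      ultimately show ?thesis
        using n sign_cases[of i] unfolding first_def mate_sign_factor_def by auto
    qed
    ultimately show "d (N + 1 - i) = \<epsilon> * d i" "\<eta> i * d (\<sigma> i) = \<delta> * \<eta> (N + 1 - i) * d i"
      unfolding d_def using half eps_sign delta_sign by (cases "is_num (c i)"; auto)+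
  qed
next
  assume "clan_orbit N H \<gamma> \<inter> perp_flags N M \<noteq> {}"
  then obtain F where "F \<in> clan_orbit N H \<gamma>" "F \<in> perp_flags N M" by blast
  then show "?sym \<and> ?pairs"
    using symmetric_clan_of_flag skew_symmetric_clan_of_flag no_mirror_pair_of_flag even delta_sign by auto
qed

end

section \<open>Components of the variety of self-orthogonal flags\<close>

lemma flag_of_ordered_basis: "g \<in> ordered_bases N \<Longrightarrow> flag_of_basis N g \<in> complete_flags N"
  by (rule flag_of_basis_complete) (auto simp: ordered_bases_def)

lemma topspace_flag_topology: "topspace (flag_topology N) = complete_flags N"
proof -
  have "{v \<in> ordered_bases N. flag_of_basis N v \<in> complete_flags N} = ordered_bases N"
    using flag_of_ordered_basis by blast
  then have "openin (flag_topology N) (complete_flags N)" unfolding openin_flag_topology by simp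
  then show ?thesis
    using openin_flag_topology by (metis openin_subset openin_topspace subset_antisym)
qed

lemma continuous_flag_of_basis:
  "continuous_map (top_of_set (ordered_bases N)) (flag_topology N) (flag_of_basis N)"
  unfolding continuous_map_def topspace_flag_topology
  using flag_of_ordered_basis by (auto simp: openin_flag_topology)

context symmetric_form
begin

lemma adapted_ordered_basis:
  assumes F: "F \<in> complete_flags N"
  shows "\<exists>g\<in>ordered_bases N. flag_of_basis N g = F"
proof -
  note F' = complete_flagsD[OF F]
  have "\<exists>x. x \<in> F (Suc i) \<and> x \<notin> F i" if i: "i < N" for i
  proof (rule ccontr)
    assume "\<not> ?thesis"
    then have "cvec.dim (F (Suc i)) \<le> cvec.dim (F i)" using F'[of i] i by (intro dim_mono fin_dim_sub) auto
    then show False using F'(3)[of i] F'(3)[of "Suc i"] i by simp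
  qed
  then obtain f where f: "\<And>i. i < N \<Longrightarrow> f i \<in> F (Suc i) \<and> f i \<notin> F i" by metis
  define g where "g i = (if i \<in> {1..N} then f (i - 1) else 0)" for i
  have g: "g (Suc i) \<in> F (Suc i)" "g (Suc i) \<notin> F i" if "i < N" for i using f[OF that] that by (auto simp: g_def)
  have sp: "cvec.span (g ` {1..i}) = F i" if "i \<le> N" for i
    using that
  proof (induction i)
    case 0
    show "cvec.span (g ` {1..0}) = F 0" using F'[of 0] dim_eq_0_iff[of "F 0"] fin_dim_sub by simp
  next
    case (Suc i)
    have IH: "cvec.span (g ` {1..i}) = F i" using Suc by simp
    have "cvec.span (g ` {1..Suc i}) = cvec.span (insert (g (Suc i)) (g ` {1..i}))"
      by (simp add: atLeastAtMostSuc_conv)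
    also have "\<dots> = cvec.span (insert (g (Suc i)) (F i))"
    proof (rule cvec.span_eq[THEN iffD2], rule conjI)
      have "F i \<subseteq> cvec.span (insert (g (Suc i)) (g ` {1..i}))"
        unfolding IH[symmetric] by (intro cvec.span_mono) auto
      then show "insert (g (Suc i)) (F i) \<subseteq> cvec.span (insert (g (Suc i)) (g ` {1..i}))"
        using cvec.span_base by auto
      have "g ` {1..i} \<subseteq> F i" unfolding IH[symmetric] by (rule cvec.span_superset)
      then show "insert (g (Suc i)) (g ` {1..i}) \<subseteq> cvec.span (insert (g (Suc i)) (F i))"
        using cvec.span_base by (meson cvec.span_superset insert_mono order_trans)
    qed
    also have "\<dots> = F (Suc i)"
      using F'[of i] F'[of "Suc i"] F'(4)[of i "Suc i"] g[of i] Suc.prems by (intro span_insert_eq) auto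
    finally show "cvec.span (g ` {1..Suc i}) = F (Suc i)" .
  qed
  have "cvec.span (g ` {1..N}) = V"
    using sp[OF order_refl] F'[of N] dim_eq_imp_eq[of "F N" V] by (simp add: fin_dim_sub)
  then have "inj_on g {1..N}" "cvec.independent (g ` {1..N})"
    using independent_image_if_span[of "{1..N}" V g] by simp_all
  moreover have "g i \<in> V" if i: "i \<in> {1..N}" for i
  proof -
    obtain k where "i = Suc k" using i by (cases i) auto
    then show ?thesis using g(1)[of k] F'(2)[of i] i by auto
  qed
  ultimately have "g \<in> ordered_bases N" by (auto simp: ordered_bases_def g_def)
  moreover have "flag_of_basis N g = F"
  proof
    fix i show "flag_of_basis N g i = F i"
      using sp[of i] F by (cases "i \<le> N") (auto simp: flag_of_basis_def complete_flags_def extensional_def)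
  qed
  ultimately show ?thesis by blast
qed

abbreviation perp_top where "perp_top \<equiv> subtopology (flag_topology N) (perp_flags N M)"

definition joined :: "(nat \<Rightarrow> (nat \<Rightarrow> complex) set) \<Rightarrow> (nat \<Rightarrow> (nat \<Rightarrow> complex) set) \<Rightarrow> bool" where
  "joined F G \<longleftrightarrow> (\<exists>C. connectedin perp_top C \<and> F \<in> C \<and> G \<in> C)"

lemma joined_trans:
  assumes "joined F G" "joined G K"
  shows "joined F K"
proof -
  obtain C D where "connectedin perp_top C" "F \<in> C" "G \<in> C"
    "connectedin perp_top D" "G \<in> D" "K \<in> D"
    using assms unfolding joined_def by blast
  moreover from this have "connectedin perp_top (C \<union> D)"
    by (intro connectedin_Un) auto
  ultimately show ?thesis unfolding joined_def by blast
qed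

lemma joined_component:
  assumes "X \<in> perp_flag_components N M" "F \<in> X" "joined F G"
  shows "G \<in> X"
proof -
  obtain C where C: "connectedin perp_top C" "F \<in> C" "G \<in> C"
    using assms(3) by (auto simp: joined_def)
  then have "\<not> disjnt X C" using assms(2) by (auto simp: disjnt_def)
  then have "C \<subseteq> X"
    using connected_components_of_maximal[OF assms(1)[unfolded perp_flag_components_def] C(1)] by blast
  then show ?thesis using C by blast
qed

text \<open>
  On the complex line through \<open>v\<close> and \<open>w\<close> the quadratic function \<open>z \<mapsto> B (u z) (u z)\<close> has finitely many
  zeros. Their complement is connected, and the reflections in the vectors \<open>u z\<close> with \<open>z\<close> in it move
  \<open>refl_flag v F\<close> to \<open>refl_flag w F\<close>.
\<close>

lemma joined_reflections:
  assumes v: "v \<in> nonisotropic" and w: "w \<in> nonisotropic" and F: "F \<in> perp_flags N M"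
  shows "joined (refl_flag v F) (refl_flag w F)"
proof -
  define u where "u z = v + cscale z (w - v)" for z
  define Z where "Z = {z. B (u z) (u z) \<noteq> 0}"
  have u01: "u 0 = v" "u 1 = w" by (simp_all add: u_def)
  have uV: "u z \<in> V" for z
    using v w unfolding u_def by (auto simp: nonisotropic_def cvec.subspace_add cvec.subspace_scale cvec.subspace_diff)
  have un: "u z \<in> nonisotropic" if "z \<in> Z" for z using that uV by (simp add: Z_def nonisotropic_def)
  have quad: "B (v + cscale z d) (v + cscale z d) = poly [:B v v, 2 * B v d, B d d:] z" for z d
    using B_sym[of d v] by (simp add: bilin_simps algebra_simps)
  have "- Z = {z. poly [:B v v, 2 * B v (w - v), B (w - v) (w - v):] z = 0}"
    unfolding Z_def u_def quad by blast
  moreover have "[:B v v, 2 * B v (w - v), B (w - v) (w - v):] \<noteq> 0" using v by (simp add: nonisotropic_def)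
  ultimately have "finite (- Z)" using poly_roots_finite by metis
  then have "path_connected (- (- Z))" by (intro path_connected_complement_countable) (auto simp: countable_finite)
  then have Z: "connected Z" by (simp add: path_connected_imp_connected)
  obtain g where g: "g \<in> ordered_bases N" "flag_of_basis N g = F"
    using adapted_ordered_basis[of F] F unfolding perp_flags_def by blast
  define P where "P z i = (if i \<in> {1..N} then refl (u z) (g i) else 0)" for z i
  have gV: "g i \<in> V" if "i \<in> {1..N}" for i using g that by (auto simp: ordered_bases_def)
  have flagP: "flag_of_basis N (P z) = refl_flag (u z) F" if z: "z \<in> Z" for z
  proof
    fix i
    have "P z ` {1..i} = refl (u z) ` g ` {1..i}" if "i \<le> N"
      unfolding image_image using that by (intro image_cong) (auto simp: P_def)
    then show "flag_of_basis N (P z) i = refl_flag (u z) F i"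
      using cpair.linear_span_image[OF refl_linear, of "u z" "g ` {1..i}"] g(2)
      by (auto simp: flag_of_basis_def refl_flag_def)
  qed
  have Pbase: "P z \<in> ordered_bases N" if z: "z \<in> Z" for z
  proof -
    have inj: "inj_on (refl (u z)) S" for S using refl_refl[OF un[OF z]] by (metis inj_onI)
    have g': "inj_on g {1..N}" "cvec.independent (g ` {1..N})" using g by (auto simp: ordered_bases_def)
    have "inj_on (\<lambda>i. refl (u z) (g i)) {1..N}"
      using comp_inj_on[OF g'(1) inj] by (simp add: comp_def)
    moreover have "cvec.independent (refl (u z) ` g ` {1..N})"
      by (rule cpair.linear_independent_injective_image[OF refl_linear g'(2) inj])
    moreover have "inj_on (P z) {1..N} \<longleftrightarrow> inj_on (\<lambda>i. refl (u z) (g i)) {1..N}"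
      by (intro inj_on_cong) (simp add: P_def)
    moreover have "P z ` {1..N} = refl (u z) ` g ` {1..N}"
      unfolding image_image by (intro image_cong) (auto simp: P_def)
    ultimately show ?thesis
      unfolding ordered_bases_def using refl_in[OF un[OF z]] gV by (auto simp: P_def)
  qed
  have contu: "continuous_on Z (\<lambda>z. B x (u z))" for x
    unfolding u_def by (simp add: bilin_add_right bilin_scale_right continuous_intros)
  have contq: "continuous_on Z (\<lambda>z. B (u z) (u z))"
    unfolding u_def by (simp add: bilin_add_right bilin_scale_right bilin_add_left bilin_scale_left continuous_intros)
  have "continuous_on Z P"
  proof (intro continuous_on_coordinatewise_then_product)
    fix i j
    show "continuous_on Z (\<lambda>z. P z i j)"
    proof (cases "i \<in> {1..N}")
      case True
      have "continuous_on Z (\<lambda>z. g i j - 2 * B (g i) (u z) / B (u z) (u z) * (v j + z * (w j - v j)))"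
        by (intro continuous_intros contu contq) (simp add: Z_def)
      then show ?thesis using True by (simp add: P_def refl_def u_def cscale_apply)
    next
      case False
      then have "P z i j = 0" for z by (auto simp: P_def)
      then show ?thesis by simp
    qed
  qed
  then have "continuous_map (top_of_set Z) (top_of_set (ordered_bases N)) P"
    using Pbase by (auto simp: continuous_map_in_subtopology)
  then have "continuous_map (top_of_set Z) (flag_topology N) (flag_of_basis N \<circ> P)"
    by (rule continuous_map_compose[OF _ continuous_flag_of_basis])
  moreover have perp: "(flag_of_basis N \<circ> P) z \<in> perp_flags N M" if "z \<in> Z" for z
    using flagP[OF that] refl_flag_perp[OF un[OF that] F] by simp
  ultimately have "continuous_map (top_of_set Z) perp_top (flag_of_basis N \<circ> P)"
    by (auto simp: continuous_map_in_subtopology)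
  moreover have "connectedin (top_of_set Z) Z" using Z by (simp add: connectedin_subtopology)
  ultimately have "connectedin perp_top ((flag_of_basis N \<circ> P) ` Z)"
    by (rule connectedin_continuous_map_image)
  moreover have "0 \<in> Z" "1 \<in> Z" using u01 v w by (simp_all add: Z_def nonisotropic_def)
  then have "refl_flag v F \<in> (flag_of_basis N \<circ> P) ` Z" "refl_flag w F \<in> (flag_of_basis N \<circ> P) ` Z"
    using flagP u01 by (metis comp_apply imageI)+
  ultimately show ?thesis unfolding joined_def by blast
qed

end

context symmetric_involution
begin

lemma refl_conjugate:
  assumes e: "e \<in> nonisotropic" and v: "v \<in> nonisotropic"
  shows "refl e v \<in> nonisotropic" "refl e (refl v x) = refl (refl e v) (refl e x)"
proof -
  show "refl e v \<in> nonisotropic"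
    using v refl_in[OF e] B_refl[OF e] by (simp add: nonisotropic_def)
  show "refl e (refl v x) = refl (refl e v) (refl e x)"
  proof -
    have "refl e (refl v x) = refl e x - cscale (2 * B x v / B v v) (refl e v)"
      unfolding refl_def[of v x] using cpair.linear_diff[OF refl_linear] by (simp add: refl_scale)
    then show ?thesis unfolding refl_def[of "refl e v"] B_refl[OF e] .
  qed
qed

text \<open>
  A chain of reflections can be traded for reflections in one vector \<open>e\<close> that preserves the orbit: the
  outermost reflection is deformed into the one in \<open>e\<close>, which is then moved inwards by conjugation.
\<close>

lemma reflection_chain_joined:
  assumes e: "e \<in> nonisotropic" "e \<in> E k"
    and vs: "set vs \<subseteq> nonisotropic" and F: "F \<in> clan_orbit N H \<gamma> \<inter> perp_flags N M"
  shows "\<exists>G\<in>clan_orbit N H \<gamma> \<inter> perp_flags N M. joined (foldr refl_flag vs F) G"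
  using vs F
proof (induction "length vs" arbitrary: vs F)
  case 0
  then have "F \<in> perp_flags N M" by blast
  moreover have "connectedin perp_top {F}"
    using calculation by (simp add: connectedin_sing topspace_flag_topology perp_flags_def)
  ultimately have "joined F F" unfolding joined_def by blast
  then show ?case using 0 by auto
next
  case (Suc n)
  then obtain v ws where vs: "vs = v # ws" "length ws = n" by (cases vs) auto
  have n: "v \<in> nonisotropic" "set ws \<subseteq> nonisotropic" using Suc.prems vs by auto
  have P: "foldr refl_flag ws F \<in> perp_flags N M" using foldr_refl_flag_perp[OF n(2)] Suc.prems by blast
  have conj: "refl_flag e (foldr refl_flag xs F) = foldr refl_flag (map (refl e) xs) (refl_flag e F)"
    if "set xs \<subseteq> nonisotropic" for xs
    using that
  proof (induction xs)
    case (Cons x xs)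
    have "refl_flag e (refl_flag x K) = refl_flag (refl e x) (refl_flag e K)" for K
      using refl_conjugate[OF e(1), of x] Cons.prems
      by (auto simp: refl_flag_def image_image fun_eq_iff)
    then show ?case using Cons by simp
  qed simp
  have "set (map (refl e) ws) \<subseteq> nonisotropic" using refl_conjugate(1)[OF e(1)] n(2) by auto
  moreover have "refl_flag e F \<in> clan_orbit N H \<gamma> \<inter> perp_flags N M"
    using refl_flag_clan_orbit[OF e] refl_flag_perp[OF e(1)] Suc.prems by blast
  moreover have "n = length (map (refl e) ws)" using vs(2) by simp
  ultimately obtain G where G: "G \<in> clan_orbit N H \<gamma> \<inter> perp_flags N M"
    "joined (foldr refl_flag (map (refl e) ws) (refl_flag e F)) G"
    using Suc.hyps(1) by blast
  have "joined (refl_flag v (foldr refl_flag ws F)) (refl_flag e (foldr refl_flag ws F))"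
    by (rule joined_reflections[OF n(1) e(1) P])
  then show ?case using G conj[OF n(2)] joined_trans vs(1) by auto
qed

lemma orbit_meets_every_component:
  assumes e: "e \<in> nonisotropic" "e \<in> E k" and N: "N = 2 * n"
    and F: "F \<in> clan_orbit N H \<gamma> \<inter> perp_flags N M" and X: "X \<in> perp_flag_components N M"
  shows "clan_orbit N H \<gamma> \<inter> X \<noteq> {}"
proof -
  have XP: "X \<subseteq> perp_flags N M" and "X \<noteq> {}"
    using connected_components_of_subset nonempty_connected_components_of X
    unfolding perp_flag_components_def by fastforce+
  then obtain F' where F': "F' \<in> X" "F' \<in> perp_flags N M" by blast
  obtain vs where "set vs \<subseteq> nonisotropic" "foldr refl_flag vs F = F'"
    using refl_flag_transitive[OF _ F'(2) N] F by blast
  then obtain G where "G \<in> clan_orbit N H \<gamma>" "joined F' G"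
    using reflection_chain_joined[OF e _ F] by blast
  then show ?thesis using joined_component[OF X F'(1)] by blast
qed

end

section \<open>The six symmetric pairs\<close>

lemma mat_vec_I3:
  assumes "N = p + q + r"
  shows "mat_vec N (I3_mat p q r) x = (\<lambda>i. if i \<in> {1..N} then (if p < i \<and> i \<le> p + q then - x i else x i) else 0)"
proof
  fix i
  show "mat_vec N (I3_mat p q r) x i = (if i \<in> {1..N} then (if p < i \<and> i \<le> p + q then - x i else x i) else 0)"
  proof (cases "i \<in> {1..N}")
    case True
    have "(\<Sum>j\<in>{1..N}. I3_mat p q r i j * x j) = (\<Sum>j\<in>{1..N}. if j = i then (if p < i \<and> i \<le> p + q then - x i else x i) else 0)"
      using True assms by (intro sum.cong) (auto simp: I3_mat_def)
    then show ?thesis using True by (simp add: mat_vec_def)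
  qed (auto simp: mat_vec_def)
qed

lemma involution_I3:
  assumes "N = p + q + r"
  shows "involution N (I3_mat p q r)"
  by unfold_locales (auto simp: mat_vec_I3[OF assms] coord_space_def fun_eq_iff)

lemma eigenspace_I3:
  assumes "N = p + q + r"
  shows "eigenspace N (I3_mat p q r) 1 = cvec.span (unit_vec ` ({1..N} - {p + 1..p + q}))"
proof -
  have "x \<in> eigenspace N (I3_mat p q r) 1 \<longleftrightarrow>
      x \<in> coord_space N \<and> (\<forall>i. i \<notin> {1..N} - {p + 1..p + q} \<longrightarrow> x i = 0)" for x
  proof (cases "x \<in> coord_space N")
    case True
    then have z: "x i = 0" if "i \<notin> {1..N}" for i using that by (simp add: coord_space_def)
    have "mat_vec N (I3_mat p q r) x = x \<longleftrightarrow> (\<forall>i\<in>{p + 1..p + q}. x i = 0)"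
      unfolding mat_vec_I3[OF assms] fun_eq_iff using z assms by auto
    also have "\<dots> \<longleftrightarrow> (\<forall>i. i \<notin> {1..N} - {p + 1..p + q} \<longrightarrow> x i = 0)" using z by auto
    finally show ?thesis using True by (simp add: eigenspace_def)
  qed (simp add: eigenspace_def)
  then show ?thesis by (subst span_unit_vec_index[where N = N]) auto
qed

lemma dim_eigenspace_I3:
  assumes "N = p + q + r"
  shows "cvec.dim (eigenspace N (I3_mat p q r) 1) = p + r"
proof -
  have "card ({1..N} - {p + 1..p + q}) = card {1..N} - card {p + 1..p + q}"
    using assms by (intro card_Diff_subset) auto
  then show ?thesis using assms unfolding eigenspace_I3[OF assms] dim_span_unit_vec by simp
qed

lemma form_space_antidiagonal:
  assumes "\<And>i j. i \<in> {1..N} \<Longrightarrow> j \<in> {1..N} \<Longrightarrow> M j i = \<epsilon> * M i j" "\<epsilon> = 1 \<or> \<epsilon> = - 1"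
    and partner: "\<And>i. i \<in> {1..N} \<Longrightarrow> \<exists>j\<in>{1..N}. M i j \<noteq> 0 \<and> (\<forall>k\<in>{1..N}. k \<noteq> i \<longrightarrow> M k j = 0)"
  shows "form_space N M \<epsilon>"
proof
  fix x assume x: "x \<in> coord_space N" "\<And>y. y \<in> coord_space N \<Longrightarrow> bilin N M x y = 0"
  have "x i = 0" for i
  proof (cases "i \<in> {1..N}")
    case True
    then obtain j where j: "j \<in> {1..N}" "M i j \<noteq> 0" "\<forall>k\<in>{1..N}. k \<noteq> i \<longrightarrow> M k j = 0"
      using partner by blast
    have "bilin N M x (unit_vec j) = (\<Sum>k\<in>{1..N}. \<Sum>l\<in>{1..N}. if l = j then x k * M k j else 0)"
      unfolding bilin_def by (intro sum.cong) (auto simp: unit_vec_def)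
    also have "\<dots> = (\<Sum>k\<in>{1..N}. if k = i then x i * M i j else 0)"
      using j by (intro sum.cong) auto
    also have "\<dots> = x i * M i j" using True by simp
    finally show ?thesis using x(2)[of "unit_vec j"] j by simp
  qed (use x(1) in \<open>simp add: coord_space_def\<close>)
  then show "x = 0" by (simp add: fun_eq_iff)
qed (fact assms)+

lemma form_involution_I3:
  assumes "form_space N M \<epsilon>" "N = p + q + r" "\<delta> = 1 \<or> \<delta> = - 1"
    and M: "\<And>i j. i \<in> {1..N} \<Longrightarrow> j \<in> {1..N} \<Longrightarrow>
      (if (p < i \<and> i \<le> p + q) = (p < j \<and> j \<le> p + q) then 1 else - 1) * M i j = \<delta> * M i j"
  shows "form_involution N M \<epsilon> (I3_mat p q r) \<delta>"
proof -
  interpret form_space N M \<epsilon> by fact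
  interpret involution N "I3_mat p q r" using involution_I3[OF assms(2)] .
  show ?thesis
  proof
    fix x y
    let ?s = "\<lambda>i. if p < i \<and> i \<le> p + q then - 1 else 1 :: complex"
    have "bilin N M (mat_vec N (I3_mat p q r) x) (mat_vec N (I3_mat p q r) y)
        = (\<Sum>i\<in>{1..N}. \<Sum>j\<in>{1..N}. x i * (?s i * ?s j * M i j) * y j)"
      unfolding bilin_def mat_vec_I3[OF assms(2)] by (intro sum.cong) auto
    also have "\<dots> = (\<Sum>i\<in>{1..N}. \<Sum>j\<in>{1..N}. \<delta> * (x i * M i j * y j))"
    proof (intro sum.cong refl)
      fix i j assume "i \<in> {1..N}" "j \<in> {1..N}"
      then have *: "?s i * ?s j * M i j = \<delta> * M i j" using M[of i j] by (auto split: if_splits)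
      show "x i * (?s i * ?s j * M i j) * y j = \<delta> * (x i * M i j * y j)" unfolding * by simp
    qed
    also have "\<dots> = \<delta> * bilin N M x y" unfolding bilin_def by (simp add: sum_distrib_left)
    finally show "bilin N M (mat_vec N (I3_mat p q r) x) (mat_vec N (I3_mat p q r) y) = \<delta> * bilin N M x y" .
  qed (use assms in auto)
qed

lemma form_space_J: "form_space N (J_mat N) 1"
proof (rule form_space_antidiagonal)
  fix i assume "i \<in> {1..N}"
  then show "\<exists>j\<in>{1..N}. J_mat N i j \<noteq> 0 \<and> (\<forall>k\<in>{1..N}. k \<noteq> i \<longrightarrow> J_mat N k j = 0)"
    by (intro bexI[of _ "N + 1 - i"]) (auto simp: J_mat_def)
qed (auto simp: J_mat_def)

lemma J_skew_eq:
  assumes "i \<in> {1..2 * n}" "j \<in> {1..2 * n}"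
  shows "J_skew n i j = (if i + j = 2 * n + 1 then (if i \<le> n then 1 else - 1) else 0)"
  using assms unfolding J_skew_def J_mat_def by auto

lemma form_space_J_skew: "form_space (2 * n) (J_skew n) (- 1)"
proof (rule form_space_antidiagonal)
  fix i assume i: "i \<in> {1..2 * n}"
  show "\<exists>j\<in>{1..2 * n}. J_skew n i j \<noteq> 0 \<and> (\<forall>k\<in>{1..2 * n}. k \<noteq> i \<longrightarrow> J_skew n k j = 0)"
  proof (intro bexI[of _ "2 * n + 1 - i"] conjI ballI impI)
    show j: "2 * n + 1 - i \<in> {1..2 * n}" using i by auto
    show "J_skew n i (2 * n + 1 - i) \<noteq> 0" using J_skew_eq[OF i j] i by auto
    fix k assume "k \<in> {1..2 * n}" "k \<noteq> i"
    then show "J_skew n k (2 * n + 1 - i) = 0" using J_skew_eq[OF _ j, of k] i by auto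
  qed
next
  fix i j assume "i \<in> {1..2 * n}" "j \<in> {1..2 * n}"
  then show "J_skew n j i = - 1 * J_skew n i j" using J_skew_eq[of i n j] J_skew_eq[of j n i] by auto
qed auto

lemma form_space_id: "form_space N id_mat 1"
proof (rule form_space_antidiagonal)
  fix i assume "i \<in> {1..N}"
  then show "\<exists>j\<in>{1..N}. id_mat i j \<noteq> 0 \<and> (\<forall>k\<in>{1..N}. k \<noteq> i \<longrightarrow> id_mat k j = 0)"
    by (intro bexI[of _ i]) (auto simp: id_mat_def)
qed (auto simp: id_mat_def)

lemma bilin_unit_vec:
  assumes "i \<in> {1..N}" "j \<in> {1..N}"
  shows "bilin N M (unit_vec i) (unit_vec j) = M i j"
proof -
  have "bilin N M (unit_vec i) (unit_vec j) = (\<Sum>k\<in>{1..N}. \<Sum>l\<in>{1..N}. if l = j then (if k = i then M k l else 0) else 0)"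
    unfolding bilin_def by (intro sum.cong) (auto simp: unit_vec_def)
  then show ?thesis using assms by simp
qed

text \<open>
  The span is isotropic because \<open>i + j = 2 n + 1\<close> is impossible for \<open>i, j \<le> n\<close>, and it has half the dimension.
\<close>

lemma perp_first_half:
  "perp (2 * n) (J_mat (2 * n)) (cvec.span (unit_vec ` {1..n})) = cvec.span (unit_vec ` {1..n})"
proof -
  interpret form_space "2 * n" "J_mat (2 * n)" 1 by (rule form_space_J)
  let ?S = "cvec.span (unit_vec ` {1..n})"
  have SV: "?S \<subseteq> V" by (intro cvec.span_minimal) auto
  have "unit_vec ` {1..n} \<subseteq> orth (unit_vec ` {1..n})"
    by (auto simp: perp_def bilin_unit_vec J_mat_def)
  then have "?S \<subseteq> orth ?S" unfolding perp_span by (intro cvec.span_minimal subspace_perp)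
  then show ?thesis
    using dim_orth[OF cvec.subspace_span SV] dim_span_unit_vec[of "{1..n}"]
    by (intro sym[OF dim_eq_imp_eq]) (auto simp: fin_dim_sub perp_subset_coord_space)
qed

lemma clan_pair_1:
  assumes "is_clan (2 * p) (2 * q + 1) \<gamma>"
  shows "clan_orbit (2 * (p + q) + 1) (I3_mat p (2 * q + 1) p) \<gamma>
      \<inter> perp_flags (2 * (p + q) + 1) (J_mat (2 * (p + q) + 1)) \<noteq> {} \<longleftrightarrow> symmetric_clan \<gamma>"
proof -
  let ?N = "2 * (p + q) + 1"
  have N: "?N = p + (2 * q + 1) + p" by simp
  interpret form_involution ?N "J_mat ?N" 1 "I3_mat p (2 * q + 1) p" 1
    by (rule form_involution_I3[OF form_space_J N]) (auto simp: J_mat_def)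
  interpret clan_form ?N "J_mat ?N" 1 "I3_mat p (2 * q + 1) p" 1 "2 * p" "2 * q + 1" \<gamma>
    by unfold_locales (use assms in auto)
  show ?thesis
    using orbit_meets_iff dim_eigenspace_I3[OF N] by simp
qed

lemma clan_pair_2:
  assumes "is_clan (2 * p) (2 * q) \<gamma>"
  shows "clan_orbit (2 * (p + q)) (I3_mat p (2 * q) p) \<gamma> \<inter> perp_flags (2 * (p + q)) (J_skew (p + q)) \<noteq> {}
      \<longleftrightarrow> symmetric_clan \<gamma> \<and> no_mirror_pair \<gamma>"
proof -
  let ?N = "2 * (p + q)"
  have N: "?N = p + 2 * q + p" by simp
  interpret form_involution ?N "J_skew (p + q)" "- 1" "I3_mat p (2 * q) p" 1
    by (rule form_involution_I3[OF form_space_J_skew N]) (auto simp: J_skew_eq)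
  interpret clan_form ?N "J_skew (p + q)" "- 1" "I3_mat p (2 * q) p" 1 "2 * p" "2 * q" \<gamma>
    by unfold_locales (use assms in auto)
  show ?thesis
    using orbit_meets_iff dim_eigenspace_I3[OF N] by simp
qed

lemma clan_pair_3:
  assumes "is_clan n n \<gamma>"
  shows "clan_orbit (2 * n) (I2_mat n n) \<gamma> \<inter> perp_flags (2 * n) (J_skew n) \<noteq> {}
      \<longleftrightarrow> skew_symmetric_clan \<gamma>"
proof -
  have N: "2 * n = n + n + 0" by simp
  interpret form_involution "2 * n" "J_skew n" "- 1" "I2_mat n n" "- 1"
    unfolding I2_mat_def
    by (rule form_involution_I3[OF form_space_J_skew N]) (auto simp: J_skew_eq)
  interpret clan_form "2 * n" "J_skew n" "- 1" "I2_mat n n" "- 1" n n \<gamma>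
    by unfold_locales (use assms in auto)
  show ?thesis
    using orbit_meets_iff dim_eigenspace_I3[OF N] by (simp add: I2_mat_def)
qed

lemma clan_pair_4:
  assumes "is_clan (2 * p) (2 * q) \<gamma>"
  shows "clan_orbit (2 * (p + q)) (I3_mat p (2 * q) p) \<gamma> \<inter> even_perp_flags (p + q) (J_mat (2 * (p + q))) \<noteq> {}
      \<longleftrightarrow> symmetric_clan \<gamma>"
proof -
  define n where "n = p + q"
  let ?N = "2 * n" and ?E' = "cvec.span (unit_vec ` {1..n})"
  have N: "?N = p + 2 * q + p" by (simp add: n_def)
  interpret symmetric_form ?N "J_mat ?N" using form_space_J by (simp add: symmetric_form_def)
  interpret form_involution ?N "J_mat ?N" 1 "I3_mat p (2 * q) p" 1
    by (rule form_involution_I3[OF form_space_J N]) (auto simp: J_mat_def n_def)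
  interpret symmetric_involution ?N "J_mat ?N" "I3_mat p (2 * q) p" by unfold_locales
  interpret clan_form ?N "J_mat ?N" 1 "I3_mat p (2 * q) p" 1 "2 * p" "2 * q" \<gamma>
    by unfold_locales (use assms n_def in auto)
  have iff: "clan_orbit ?N (I3_mat p (2 * q) p) \<gamma> \<inter> perp_flags ?N (J_mat ?N) \<noteq> {} \<longleftrightarrow> symmetric_clan \<gamma>"
    using orbit_meets_iff dim_eigenspace_I3[OF N] by simp
  have "clan_orbit ?N (I3_mat p (2 * q) p) \<gamma> \<inter> even_perp_flags n (J_mat ?N) \<noteq> {}"
    if sym: "symmetric_clan \<gamma>"
  proof -
    obtain F where F: "F \<in> clan_orbit ?N (I3_mat p (2 * q) p) \<gamma>" "F \<in> perp_flags ?N (J_mat ?N)"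
      using iff sym by blast
    note F' = complete_flagsD[OF perp_flagsD(1)[OF F(2)]]
    show ?thesis
    proof (cases "n = 0")
      case True
      have "cvec.dim (F n \<inter> ?E') \<le> cvec.dim (F n)" by (rule dim_mono[OF Int_lower1 F'(1,5)]) simp_all
      then have "cvec.dim (F n \<inter> ?E') \<le> n" using F'(3)[of n] by simp
      then have "F \<in> even_perp_flags n (J_mat ?N)"
        using F(2) True by (simp add: even_perp_flags_def)
      then show ?thesis using F(1) by blast
    next
      case False
      define e where "e = unit_vec 1 + unit_vec ?N"
      have one: "1 \<in> {1..?N}" "?N \<in> {1..?N}" using False by auto
      have eV: "e \<in> V" unfolding e_def using one by (intro cvec.subspace_add) auto
      have "B e e = 2"
        unfolding e_def using one False by (simp add: bilin_simps bilin_unit_vec J_mat_def)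
      then have e: "e \<in> nonisotropic" using eV by (simp add: nonisotropic_def)
      have "e \<in> E (if p = 0 then - 1 else 1)"
        using eV False N unfolding in_E mat_vec_I3[OF N]
        by (auto simp: fun_eq_iff cscale_apply e_def unit_vec_def)
      note G = refl_flag_clan_orbit[OF e this F(1)] refl_flag_perp[OF e F(2)]
      have half: "?N - n = n" by simp
      have parity: "odd (x + y) \<Longrightarrow> x mod 2 = m mod 2 \<or> y mod 2 = m mod 2" for x y m :: nat by presburger
      have "odd (cvec.dim (F n \<inter> ?E') + cvec.dim (refl e ` F n \<inter> ?E'))"
        using F'(1)[of n] perp_flagsD(2)[OF F(2), of n] half
        by (intro refl_changes_parity[OF e] perp_first_half) auto
      then have "cvec.dim (F n \<inter> ?E') mod 2 = n mod 2 \<or> cvec.dim (refl_flag e F n \<inter> ?E') mod 2 = n mod 2"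
        using refl_flag_apply[OF e, of n F] parity[of "cvec.dim (F n \<inter> ?E')" _ n] by simp
      then have "F \<in> even_perp_flags n (J_mat ?N) \<or> refl_flag e F \<in> even_perp_flags n (J_mat ?N)"
        using F(2) G(2) by (auto simp: even_perp_flags_def)
      then show ?thesis using F(1) G(1) by blast
    qed
  qed
  moreover have "even_perp_flags n (J_mat ?N) \<subseteq> perp_flags ?N (J_mat ?N)" by (auto simp: even_perp_flags_def)
  ultimately show ?thesis using iff unfolding n_def by blast
qed

lemma clan_pair_5:
  assumes "is_clan n n \<gamma>"
  shows "clan_orbit (2 * n) (I2_mat n n) \<gamma> \<inter> even_perp_flags n (J_mat (2 * n)) \<noteq> {}
      \<longleftrightarrow> skew_symmetric_clan \<gamma> \<and> no_mirror_pair \<gamma> \<and> even (clan_minus \<gamma> n)"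
proof -
  have N: "2 * n = n + n + 0" by simp
  interpret form_involution "2 * n" "J_mat (2 * n)" 1 "I2_mat n n" "- 1"
    unfolding I2_mat_def
    by (rule form_involution_I3[OF form_space_J N]) (auto simp: J_mat_def)
  interpret clan_form "2 * n" "J_mat (2 * n)" 1 "I2_mat n n" "- 1" n n \<gamma>
    by unfold_locales (use assms in auto)
  have iff: "clan_orbit (2 * n) (I2_mat n n) \<gamma> \<inter> perp_flags (2 * n) (J_mat (2 * n)) \<noteq> {}
      \<longleftrightarrow> skew_symmetric_clan \<gamma> \<and> no_mirror_pair \<gamma>"
    using orbit_meets_iff dim_eigenspace_I3[OF N] by (simp add: I2_mat_def)
  have "{1..2 * n} - {n + 1..n + n} = {1..n}" by auto
  then have E1: "E 1 = cvec.span (unit_vec ` {1..n})"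
    using eigenspace_I3[OF N] by (simp add: I2_mat_def)
  have "F \<in> even_perp_flags n (J_mat (2 * n)) \<longleftrightarrow> even (clan_minus \<gamma> n)"
    if F: "F \<in> clan_orbit (2 * n) (I2_mat n n) \<gamma>" "F \<in> perp_flags (2 * n) (J_mat (2 * n))" for F
  proof -
    have d: "cvec.dim (F n \<inter> cvec.span (unit_vec ` {1..n})) = clan_plus \<gamma> n"
      using dim_flag_plus[OF F(1), of n] E1 by simp
    have "even (crossings n n)" using even_crossings[OF F, of n] by simp
    then have "clan_plus \<gamma> n mod 2 = n mod 2 \<longleftrightarrow> even (clan_minus \<gamma> n)"
      using crossings_diag[of n] by presburger
    then show ?thesis using F(2) d by (simp add: even_perp_flags_def)
  qed
  moreover have "even_perp_flags n (J_mat (2 * n)) \<subseteq> perp_flags (2 * n) (J_mat (2 * n))"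
    by (auto simp: even_perp_flags_def)
  ultimately show ?thesis using iff by blast
qed

lemma clan_pair_6:
  assumes q: "1 \<le> q" and X: "X \<in> perp_flag_components (2 * (p + q)) id_mat"
    and "is_clan (2 * p + 1) (2 * q - 1) \<gamma>"
  shows "clan_orbit (2 * (p + q)) (I2_mat (2 * p + 1) (2 * q - 1)) \<gamma> \<inter> X \<noteq> {} \<longleftrightarrow> symmetric_clan \<gamma>"
proof -
  let ?N = "2 * (p + q)" and ?H = "I2_mat (2 * p + 1) (2 * q - 1)"
  have N: "?N = (2 * p + 1) + (2 * q - 1) + 0" using q by simp
  interpret symmetric_form ?N id_mat using form_space_id by (simp add: symmetric_form_def)
  interpret form_involution ?N id_mat 1 ?H 1
    unfolding I2_mat_def by (rule form_involution_I3[OF form_space_id N]) (auto simp: id_mat_def)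
  interpret symmetric_involution ?N id_mat ?H by unfold_locales
  interpret clan_form ?N id_mat 1 ?H 1 "2 * p + 1" "2 * q - 1" \<gamma>
    by unfold_locales (use assms in auto)
  have iff: "clan_orbit ?N ?H \<gamma> \<inter> perp_flags ?N id_mat \<noteq> {} \<longleftrightarrow> symmetric_clan \<gamma>"
    using orbit_meets_iff dim_eigenspace_I3[OF N] by (simp add: I2_mat_def)
  have one: "1 \<in> {1..?N}" using q by auto
  have "B (unit_vec 1) (unit_vec 1) = 1" unfolding bilin_unit_vec[OF one one] by (simp add: id_mat_def)
  moreover have "unit_vec 1 \<in> V" by (rule unit_vec_in_coord_space[OF one])
  ultimately have "unit_vec 1 \<in> nonisotropic" unfolding nonisotropic_def by simp
  moreover have "unit_vec 1 \<in> E 1"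
    unfolding I2_mat_def eigenspace_I3[OF N] using one by (intro cvec.span_base imageI) auto
  ultimately have "clan_orbit ?N ?H \<gamma> \<inter> X \<noteq> {}" if "symmetric_clan \<gamma>"
    using orbit_meets_every_component[OF _ _ refl _ X] iff that by blast
  moreover have "X \<subseteq> perp_flags ?N id_mat"
    using connected_components_of_subset[OF X[unfolded perp_flag_components_def]] by auto
  ultimately show ?thesis using iff by blast
qed

theorem propositionA0p1:
  fixes n p q :: nat
  assumes "p + q = n"
  shows
    \<comment> \<open>(1) \<open>SO(2n+1)\<close>, \<open>S(O(2p) \<times> O(2q+1))\<close>\<close>
    "(\<forall>\<gamma>. is_clan (2 * p) (2 * q + 1) \<gamma> \<longrightarrow>
        (clan_orbit (2 * n + 1) (I3_mat p (2 * q + 1) p) \<gamma>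
           \<inter> perp_flags (2 * n + 1) (J_mat (2 * n + 1)) \<noteq> {}
         \<longleftrightarrow> symmetric_clan \<gamma>)) \<and>
     \<comment> \<open>(2) \<open>Sp(2n)\<close>, \<open>Sp(2p) \<times> Sp(2q)\<close>\<close>
     (\<forall>\<gamma>. is_clan (2 * p) (2 * q) \<gamma> \<longrightarrow>
        (clan_orbit (2 * n) (I3_mat p (2 * q) p) \<gamma>
           \<inter> perp_flags (2 * n) (J_skew n) \<noteq> {}
         \<longleftrightarrow> symmetric_clan \<gamma> \<and> no_mirror_pair \<gamma>)) \<and>
     \<comment> \<open>(3) \<open>Sp(2n)\<close>, \<open>GL(n)\<close>\<close>
     (\<forall>\<gamma>. is_clan n n \<gamma> \<longrightarrow>
        (clan_orbit (2 * n) (I2_mat n n) \<gamma>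
           \<inter> perp_flags (2 * n) (J_skew n) \<noteq> {}
         \<longleftrightarrow> skew_symmetric_clan \<gamma>)) \<and>
     \<comment> \<open>(4) \<open>SO(2n)\<close>, \<open>S(O(2p) \<times> O(2q))\<close>\<close>
     (\<forall>\<gamma>. is_clan (2 * p) (2 * q) \<gamma> \<longrightarrow>
        (clan_orbit (2 * n) (I3_mat p (2 * q) p) \<gamma>
           \<inter> even_perp_flags n (J_mat (2 * n)) \<noteq> {}
         \<longleftrightarrow> symmetric_clan \<gamma>)) \<and>
     \<comment> \<open>(5) \<open>SO(2n)\<close>, \<open>GL(n)\<close>\<close>
     (\<forall>\<gamma>. is_clan n n \<gamma> \<longrightarrow>
        (clan_orbit (2 * n) (I2_mat n n) \<gamma>
           \<inter> even_perp_flags n (J_mat (2 * n)) \<noteq> {}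
         \<longleftrightarrow> skew_symmetric_clan \<gamma> \<and> no_mirror_pair \<gamma> \<and> even (clan_minus \<gamma> n))) \<and>
     \<comment> \<open>(6) \<open>SO(2n)\<close>, \<open>S(O(2p+1) \<times> O(2q-1))\<close>; \<open>X\<close> is either of the two components\<close>
     (1 \<le> q \<longrightarrow>
        (\<forall>X \<in> perp_flag_components (2 * n) id_mat.
          \<forall>\<gamma>. is_clan (2 * p + 1) (2 * q - 1) \<gamma> \<longrightarrow>
            (clan_orbit (2 * n) (I2_mat (2 * p + 1) (2 * q - 1)) \<gamma> \<inter> X \<noteq> {}
             \<longleftrightarrow> symmetric_clan \<gamma>)))"
proof -
  have n: "n = p + q" using assms by simp
  show ?thesis
    unfolding n
    by (intro conjI allI impI ballI)
      ((rule clan_pair_1 clan_pair_2 clan_pair_3 clan_pair_4 clan_pair_5 clan_pair_6; assumption)+)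
qed

end
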